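(* Let $u_0,v_0\in\mathcal{B}\cap BV(\mathbb{R})$. Let $f:\mathbb{R}\to\mathbb{R}$ be convex and superlinear, with $f(0)=0$ being the minimum of $f$, and suppose that for some constant $C$ $$\|a\|_{L^\infty([0,M])}\leq C,\qquad a(w):=\frac{f'(w)w-f(w)}{w^2},\qquad M=\max\{\|u_0\|_{L^\infty(\mathbb{R})},\|v_0\|_{L^\infty(\mathbb{R})}\}.$$ Then the entropy solutions $u$ and $v$ of $w_t+f(w)_x=0$ with initial data $u_0$ and $v_0$ respectively satisfy, for all $t>0$, $$W_\infty\big(u(t),v(t)\big)\leq W_\infty(u_0,v_0).$$
   Context: $\mathcal{B}:=\{u\in L^\infty(\mathbb{R}): u\geq0,\ \mathrm{supp}(u)\text{ compact},\ \int_{\mathbb{R}}u\,dx=1\}$. Superlinear means $\lim_{|u|\to\infty}f(u)/|u|=\infty$. The derivative $f'$ of the convex function $f$ exists almost everywhere. For $u,v\in\mathcal{B}$, $W_\infty(u,v)=\|U^{-1}-V^{-1}\|_{L^\infty([0,1])}$, where $U(x)=\int_{-\infty}^xu\,dy$, $U^{-1}(\xi)=\inf\{x:U(x)>\xi\}$, and similarly for $V$. *)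

theory Defs
  imports "HOL-Probability.Essential_Supremum"
begin

text \<open>
  Elements of \<open>L\<^sup>\<infinity>\<close> are represented by Lebesgue measurable functions; every notion below depends
  only on the class of the function modulo null sets. Norms and distances are extended reals.
\<close>

definition Linf_norm :: "'a measure \<Rightarrow> ('a \<Rightarrow> real) \<Rightarrow> ereal" where
  "Linf_norm M g = esssup M (\<lambda>x. ereal \<bar>g x\<bar>)"

definition Linf :: "'a measure \<Rightarrow> ('a \<Rightarrow> real) set" where
  "Linf M = {g \<in> borel_measurable M. Linf_norm M g < \<infinity>}"

text \<open>The support of a class of functions: the complement of the largest open set on which the
  function vanishes almost everywhere.\<close>

definition ess_supp :: "(real \<Rightarrow> real) \<Rightarrow> real set" where
  "ess_supp u = - \<Union>{A. open A \<and> (AE x in lebesgue. x \<in> A \<longrightarrow> u x = 0)}"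

definition densities :: "(real \<Rightarrow> real) set" where
  "densities = {u \<in> Linf lebesgue. (AE x in lebesgue. 0 \<le> u x) \<and> compact (ess_supp u) \<and>
     (LINT x|lebesgue. u x) = 1}"

definition total_variation :: "(real \<Rightarrow> real) \<Rightarrow> ereal" where
  "total_variation u =
     (SUP \<phi> \<in> {\<phi>. \<phi> C1_differentiable_on UNIV \<and> compact (closure {x. \<phi> x \<noteq> 0}) \<and> (\<forall>x. \<bar>\<phi> x\<bar> \<le> 1)}.
        ereal (LINT x|lebesgue. u x * deriv \<phi> x))"

definition BV :: "(real \<Rightarrow> real) set" where
  "BV = {u. integrable lebesgue u \<and> total_variation u < \<infinity>}"

definition cdf_of :: "(real \<Rightarrow> real) \<Rightarrow> real \<Rightarrow> real" where
  "cdf_of u x = (LINT y:{..x}|lebesgue. u y)"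

text \<open>For densities the infimum is that of a nonempty set bounded below whenever \<open>0 \<le> \<xi> < 1\<close>. For
  \<open>\<xi> = 1\<close> the set is empty and the value is an irrelevant real number.\<close>

definition pseudo_inverse :: "(real \<Rightarrow> real) \<Rightarrow> real \<Rightarrow> real" where
  "pseudo_inverse u \<xi> = Inf {x. cdf_of u x > \<xi>}"

definition W_inf :: "(real \<Rightarrow> real) \<Rightarrow> (real \<Rightarrow> real) \<Rightarrow> ereal" where
  "W_inf u v = Linf_norm (lebesgue_on {0..1}) (\<lambda>\<xi>. pseudo_inverse u \<xi> - pseudo_inverse v \<xi>)"

definition superlinear :: "(real \<Rightarrow> real) \<Rightarrow> bool" where
  "superlinear f \<longleftrightarrow> filterlim (\<lambda>u. f u / \<bar>u\<bar>) at_top at_infinity"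

definition a_coeff :: "(real \<Rightarrow> real) \<Rightarrow> real \<Rightarrow> real" where
  "a_coeff f w = (deriv f w * w - f w) / w\<^sup>2"

text \<open>Nonnegative test functions on the open half-plane \<open>t > 0\<close> of class \<open>C\<^sup>1\<close> with compact support,
  together with their partial derivatives; points are pairs \<open>(t, x)\<close>.\<close>

definition test_function ::
    "(real \<times> real \<Rightarrow> real) \<Rightarrow> (real \<times> real \<Rightarrow> real) \<Rightarrow> (real \<times> real \<Rightarrow> real) \<Rightarrow> bool" where
  "test_function \<phi> \<phi>\<^sub>t \<phi>\<^sub>x \<longleftrightarrow>
     (\<forall>p. (\<phi> has_derivative (\<lambda>(s, y). \<phi>\<^sub>t p * s + \<phi>\<^sub>x p * y)) (at p)) \<and>
     continuous_on UNIV \<phi>\<^sub>t \<and> continuous_on UNIV \<phi>\<^sub>x \<and> (\<forall>p. 0 \<le> \<phi> p) \<and>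
     compact (closure {p. \<phi> p \<noteq> 0}) \<and> closure {p. \<phi> p \<noteq> 0} \<subseteq> {0<..} \<times> UNIV"

text \<open>
  Kruzhkov entropy solutions of \<open>w\<^sub>t + f(w)\<^sub>x = 0\<close>, \<open>w(0) = w\<^sub>0\<close>, taken as bounded curves in
  \<open>C([0,\<infinity>); L\<^sup>1\<^sub>l\<^sub>o\<^sub>c(\<real>))\<close>, so that \<open>w t\<close> (that is, \<open>w(t, \<cdot>)\<close>) is a well-defined class for every
  \<open>t \<ge> 0\<close>. The values of \<open>w\<close> at negative times are irrelevant. For continuous \<open>f\<close> the inner
  integral in the entropy inequality is a continuous function of \<open>t\<close> with compact support, so the
  iterated integral requires no joint measurability.
\<close>

definition entropy_solution ::
    "(real \<Rightarrow> real) \<Rightarrow> (real \<Rightarrow> real) \<Rightarrow> (real \<Rightarrow> real \<Rightarrow> real) \<Rightarrow> bool" where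
  "entropy_solution f w\<^sub>0 w \<longleftrightarrow>
     (\<forall>t\<ge>0. w t \<in> borel_measurable lebesgue) \<and>
     (\<exists>K::real. \<forall>t\<ge>0. Linf_norm lebesgue (w t) \<le> ereal K) \<and>
     (\<forall>s\<ge>0. \<forall>R. ((\<lambda>t. LINT x:{-R..R}|lebesgue. \<bar>w t x - w s x\<bar>) \<longlongrightarrow> 0) (at s within {0..})) \<and>
     (AE x in lebesgue. w 0 x = w\<^sub>0 x) \<and>
     (\<forall>k \<phi> \<phi>\<^sub>t \<phi>\<^sub>x. test_function \<phi> \<phi>\<^sub>t \<phi>\<^sub>x \<longrightarrow>
        (LINT t:{0<..}|lebesgue. (LINT x|lebesgue.
            \<bar>w t x - k\<bar> * \<phi>\<^sub>t (t, x) + sgn (w t x - k) * (f (w t x) - f k) * \<phi>\<^sub>x (t, x))) \<ge> 0)"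

end

theory Submission
  imports Defs
begin

text \<open>
  Let \<open>U\<close>, \<open>V\<close> be the distribution functions of the two solutions. The bound \<open>W\<^sub>\<infinity> \<le> d\<close> means
  \<open>U x \<le> V (x + d)\<close> and \<open>V x \<le> U (x + d)\<close> for all \<open>x\<close>. Since the equation is translation
  invariant, it suffices to show that \<open>U \<le> V\<close> at time \<open>0\<close> implies \<open>U \<le> V\<close> at later times.
  Formally \<open>U\<^sub>t = - f u\<close> and \<open>V\<^sub>t = - f v\<close>, so for a nondecreasing \<open>g\<close> the test function
  \<open>\<psi> = g (U x - V y) \<kappa> (x - y)\<close> in the doubled Kruzhkov inequality satisfies
  \<open>\<bar>u - v\<bar> \<psi>\<^sub>t + sgn (u - v) (f u - f v) (\<psi>\<^sub>x + \<psi>\<^sub>y) = 0\<close> identically. Hence the total variation of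
  \<open>G (U - V)\<close>, where \<open>G' = g\<close>, does not increase in time; choosing \<open>g\<close> to vanish on the negative
  half-line, it is zero initially and therefore always. Only the space variable is doubled: the
  curves are continuous in time with values in \<open>L\<^sup>1\<close>, so the two increments in time can be added up
  over small steps. To obtain admissible test functions, \<open>U\<close> and \<open>V\<close> are mollified in space.
\<close>

section \<open>Smooth steps and kernels\<close>

text \<open>Two facts make the identity exact. In \<open>\<psi>\<^sub>x + \<psi>\<^sub>y\<close> the
  derivatives of \<kappa> cancel, leaving \<open>g' (u - v) \<kappa>\<close> against
  \<open>\<psi>\<^sub>t = g' (f v - f u) \<kappa>\<close>; and \<open>sgn (a - b) (f a - f b) (a -
  b) = \<bar>a - b\<bar> (f a - f b)\<close>. The choice \<open>g z = (max 0 z)^2\<close> is C^1, as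
  a test function must be. On the diagonal \<open>\<bar>u - v\<bar> g (U - V)\<close> is the modulus
  of the derivative of \<open>(max 0 (U - V))^3 / 3\<close>, which vanishes far to the left; so a
  small doubled integral bounds it at every point.

  With mollified U and V the cancellation is only approximate, and the order of limits matters. Its
  error is controlled by the L^1 distance of u and v from their translates by less than the kernel
  width e, which is small uniformly on a compact time interval. The errors of a time step carry sup
  norms of \<kappa> and its derivative, which blow up as e tends to 0, but also a factor that
  vanishes with the step. So for fixed e the steps are refined first, which removes the second kind,
  and only then does e shrink.\<close>

lemma DERIV_compose_max:
  fixes p p' :: "real \<Rightarrow> real"
  assumes p: "\<And>x. (p has_real_derivative p' x) (at x)" and 0: "p' 0 = 0"
  shows "((\<lambda>x. p (max 0 x)) has_real_derivative p' (max 0 x)) (at x)"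
proof -
  consider "x < 0" | "x = 0" | "x > 0" by linarith
  then show ?thesis
  proof cases
    case 1
    then have "\<forall>\<^sub>F y in nhds x. p (max 0 y) = p 0"
      using eventually_nhds_in_open[of "{..<0}" x] by (auto elim!: eventually_mono simp: max_def)
    then show ?thesis
      using 1 0 by (subst DERIV_cong_ev[OF refl _ refl, of _ "\<lambda>_. p 0"]) auto
  next
    case 3
    then have "\<forall>\<^sub>F y in nhds x. p (max 0 y) = p y"
      using eventually_nhds_in_open[of "{0<..}" x] by (auto elim!: eventually_mono simp: max_def)
    then show ?thesis
      using 3 p by (subst DERIV_cong_ev[OF refl _ refl, of _ p]) auto
  next
    case 2
    have lim: "((\<lambda>h. (p (0 + h) - p 0) / h) \<longlongrightarrow> 0) (at 0)"
      using p[of 0] 0 by (simp add: DERIV_def)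
    have "((\<lambda>h. (p (max 0 (0 + h)) - p (max 0 0)) / h) \<longlongrightarrow> 0) (at 0)"
      by (rule Lim_null_comparison[OF _ tendsto_norm_zero[OF lim]])
        (auto simp: max_def divide_le_0_iff intro!: always_eventually)
    then show ?thesis using 2 0 by (simp add: DERIV_def)
  qed
qed

text \<open>Since \<open>min e x = e - max 0 (e - x)\<close>, the upper clamp is a lower clamp seen
  through the reflection at \<open>e / 2\<close>; the one-sided lemma is applied once on each
  side.\<close>

lemma DERIV_compose_clamp:
  fixes p p' :: "real \<Rightarrow> real"
  assumes p: "\<And>x. (p has_real_derivative p' x) (at x)" and "p' 0 = 0" "p' e = 0" "0 \<le> e"
  shows "((\<lambda>x. p (max 0 (min e x))) has_real_derivative p' (max 0 (min e x))) (at x)"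
proof -
  define q where "q x = p (max 0 x)" for x
  define q' where "q' x = p' (max 0 x)" for x
  have q: "(q has_real_derivative q' x) (at x)" for x
    unfolding q_def q'_def by (rule DERIV_compose_max) fact+
  have reflect: "((\<lambda>x. e - x) has_real_derivative - 1) (at x)" for x :: real
    by (auto intro!: derivative_eq_intros)
  have r: "((\<lambda>x. q (e - x)) has_real_derivative - q' (e - x)) (at x)" for x
    using DERIV_chain2[OF q reflect] by simp
  have "((\<lambda>x. q (e - max 0 x)) has_real_derivative - q' (e - max 0 x)) (at x)" for x
    using r by (rule DERIV_compose_max) (use assms in \<open>auto simp: q'_def\<close>)
  from DERIV_chain2[OF this reflect]
  have "((\<lambda>x. q (e - max 0 (e - x))) has_real_derivative q' (e - max 0 (e - x))) (at x)"
    by simp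
  moreover have "e - max 0 (e - x) = min e x" for x by (auto simp: max_def min_def)
  ultimately show ?thesis by (simp add: q_def q'_def)
qed

text \<open>One pair \<eta>, \<kappa> serves as mollifier of both curves, as coupling kernel of x
  and y, and as cutoff in space and in time. The support of \<kappa> lies on one side of 0 on
  purpose: where \<open>\<kappa> (x - y)\<close> is nonzero, y is to the left of x, so monotonicity
  of a distribution function compares diagonal and off-diagonal values.\<close>

locale smooth_step =
  fixes e :: real and \<eta> \<kappa> \<kappa>' :: "real \<Rightarrow> real"
  assumes width_pos: "0 < e"
    and step_deriv: "\<And>x. (\<eta> has_real_derivative \<kappa> x) (at x)"
    and kernel_deriv: "\<And>x. (\<kappa> has_real_derivative \<kappa>' x) (at x)"
    and continuous_kernel_deriv: "continuous_on UNIV \<kappa>'"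
    and kernel_nonneg: "\<And>x. 0 \<le> \<kappa> x"
    and step_left: "\<And>x. x \<le> 0 \<Longrightarrow> \<eta> x = 0" and step_right: "\<And>x. e \<le> x \<Longrightarrow> \<eta> x = 1"
    and kernel_outside: "\<And>x. x \<notin> {0<..<e} \<Longrightarrow> \<kappa> x = 0"
    and kernel_deriv_outside: "\<And>x. x \<notin> {0<..<e} \<Longrightarrow> \<kappa>' x = 0"

lemma smooth_step_exists:
  assumes "0 < e"
  obtains \<eta> \<kappa> \<kappa>' where "smooth_step e \<eta> \<kappa> \<kappa>'"
proof -
  define c where "c x = max 0 (min e x)" for x
  \<comment> \<open>The quintic step. Its derivative \<open>p1\<close> is a multiple of
    \<open>x^2 (e - x)^2\<close>, normalised by the integral \<open>e^5 / 30\<close>; the double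
    zeros at both ends let the clamped function keep two continuous derivatives.\<close>
  define p0 where "p0 x = (10 * e\<^sup>2 * x ^ 3 - 15 * e * x ^ 4 + 6 * x ^ 5) / e ^ 5" for x
  define p1 where "p1 x = 30 * x\<^sup>2 * (e - x)\<^sup>2 / e ^ 5" for x
  define p2 where "p2 x = 60 * x * (e - x) * (e - 2 * x) / e ^ 5" for x
  have d0: "(p0 has_real_derivative p1 x) (at x)" for x
    unfolding p0_def p1_def using assms
    by (auto intro!: derivative_eq_intros simp: divide_simps) (simp add: algebra_simps power2_eq_square power3_eq_cube eval_nat_numeral)
  have d1: "(p1 has_real_derivative p2 x) (at x)" for x
    unfolding p1_def p2_def using assms
    by (auto intro!: derivative_eq_intros simp: divide_simps) (simp add: algebra_simps power2_eq_square)
  have "smooth_step e (\<lambda>x. p0 (c x)) (\<lambda>x. p1 (c x)) (\<lambda>x. p2 (c x))"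
  proof
    show "((\<lambda>x. p0 (c x)) has_real_derivative p1 (c x)) (at x)" for x
      unfolding c_def by (rule DERIV_compose_clamp[OF d0]) (use assms in \<open>auto simp: p1_def\<close>)
    show "((\<lambda>x. p1 (c x)) has_real_derivative p2 (c x)) (at x)" for x
      unfolding c_def by (rule DERIV_compose_clamp[OF d1]) (use assms in \<open>auto simp: p2_def\<close>)
    show "continuous_on UNIV (\<lambda>x. p2 (c x))"
      unfolding c_def p2_def using assms by (intro continuous_intros) auto
    show "p0 (c x) = 1" if "e \<le> x" for x
      using that assms by (simp add: c_def p0_def power2_eq_square power3_eq_cube eval_nat_numeral)
  qed (use assms in \<open>auto simp: p0_def p1_def p2_def c_def max_def min_def\<close>)
  then show thesis by (rule that)
qed

context smooth_step begin

lemma continuous_kernel: "continuous_on A \<kappa>"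
  by (meson DERIV_isCont continuous_at_imp_continuous_on kernel_deriv)

lemma continuous_step: "continuous_on A \<eta>"
  by (meson DERIV_isCont continuous_at_imp_continuous_on step_deriv)

lemma kernel_measurable [measurable]: "\<kappa> \<in> borel_measurable borel"
  using continuous_kernel by (rule borel_measurable_continuous_onI)

lemma kernel_deriv_measurable [measurable]: "\<kappa>' \<in> borel_measurable borel"
  using continuous_kernel_deriv by (rule borel_measurable_continuous_onI)

lemma step_measurable [measurable]: "\<eta> \<in> borel_measurable borel"
  using continuous_step by (rule borel_measurable_continuous_onI)

lemma step_mono: "x \<le> y \<Longrightarrow> \<eta> x \<le> \<eta> y"
  using DERIV_nonneg_imp_nondecreasing[of x y \<eta>] step_deriv kernel_nonneg by blast

lemma step_nonneg: "0 \<le> \<eta> x"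
  using step_mono[of "min 0 x" x] step_left[of "min 0 x"] by auto

lemma step_le_1: "\<eta> x \<le> 1"
  using step_mono[of x "max e x"] step_right[of "max e x"] by auto

lemma kernel_bounds:
  obtains B where "0 < B" "\<And>x. \<kappa> x \<le> B" "\<And>x. \<bar>\<kappa>' x\<bar> \<le> B"
proof -
  have "bounded (\<kappa> ` {0..e})" "bounded (\<kappa>' ` {0..e})"
    by (auto intro!: compact_imp_bounded compact_continuous_image continuous_kernel
        continuous_on_subset[OF continuous_kernel_deriv])
  then obtain b c where b: "\<And>x. x \<in> {0..e} \<Longrightarrow> \<bar>\<kappa> x\<bar> \<le> b" and c: "\<And>x. x \<in> {0..e} \<Longrightarrow> \<bar>\<kappa>' x\<bar> \<le> c"
    unfolding bounded_iff by (auto simp del: atLeastAtMost_iff)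
  show thesis
  proof (rule that[of "\<bar>b\<bar> + \<bar>c\<bar> + 1"])
    show "\<kappa> x \<le> \<bar>b\<bar> + \<bar>c\<bar> + 1" for x
      using b[of x] kernel_outside[of x] by (cases "x \<in> {0..e}") auto
    show "\<bar>\<kappa>' x\<bar> \<le> \<bar>b\<bar> + \<bar>c\<bar> + 1" for x
      using c[of x] kernel_deriv_outside[of x] by (cases "x \<in> {0..e}") auto
  qed auto
qed

lemma has_integral_kernel: "has_bochner_integral lborel \<kappa> 1"
proof -
  have "has_bochner_integral lborel (\<lambda>x. \<kappa> x * indicator {0..e} x) (\<eta> e - \<eta> 0)"
    by (rule has_bochner_integral_FTC_Icc_real)
      (use width_pos step_deriv kernel_deriv in \<open>auto intro: DERIV_isCont\<close>)
  moreover have "\<kappa> x * indicator {0..e} x = \<kappa> x" for x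
    using kernel_outside[of x] by (cases "x \<in> {0<..<e}") auto
  ultimately show ?thesis by (simp add: step_left step_right)
qed

lemma has_integral_kernel_reflected: "has_bochner_integral lborel (\<lambda>z. \<kappa> (x - z)) 1"
  using lborel_has_bochner_integral_real_affine_iff[of "-1" \<kappa> 1 x] has_integral_kernel by simp

lemma has_integral_kernel_shifted: "has_bochner_integral lborel (\<lambda>z. \<kappa> (z - x)) 1"
  using lborel_has_bochner_integral_real_affine_iff[of 1 \<kappa> 1 "-x"] has_integral_kernel
  by (simp add: add.commute)

lemma kernel_integrable [simp]:
  "integrable lborel (\<lambda>z. \<kappa> (x - z))" "(LBINT z. \<kappa> (x - z)) = 1"
  "integrable lborel (\<lambda>z. \<kappa> (z - x))" "(LBINT z. \<kappa> (z - x)) = 1"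
  using has_integral_kernel_reflected[of x] has_integral_kernel_shifted[of x]
  by (auto simp: has_bochner_integral_iff)

text \<open>B is a Lipschitz constant of \<kappa>, and the mean value theorem gives a quadratic
  remainder that is uniform in x. This uniformity is what allows differentiation under the integral
  in \<open>smooth_cdf_deriv\<close>.\<close>

lemma step_taylor:
  assumes "\<And>x. \<bar>\<kappa>' x\<bar> \<le> B"
  shows "\<bar>\<eta> y - \<eta> x - \<kappa> x * (y - x)\<bar> \<le> B * (y - x)\<^sup>2"
proof -
  have lip: "\<bar>\<kappa> z - \<kappa> x\<bar> \<le> B * \<bar>z - x\<bar>" for z
  proof -
    have "\<exists>w. \<kappa> z - \<kappa> x = (z - x) * \<kappa>' w" if "z \<noteq> x"
      by (metis MVT2 kernel_deriv linorder_neqE_linordered_idom minus_diff_eq minus_mult_left that)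
    then show ?thesis using assms by (cases "z = x") (force simp: abs_mult mult.commute intro: mult_right_mono)+
  qed
  show ?thesis
  proof (cases "x = y")
    case False
    then obtain w where w: "\<eta> y - \<eta> x = (y - x) * \<kappa> w" "\<bar>w - x\<bar> \<le> \<bar>y - x\<bar>"
    proof (cases "x < y")
      case True
      with MVT2[of x y \<eta> \<kappa>] step_deriv show ?thesis by (force intro: that)
    next
      case F: False
      with False MVT2[of y x \<eta> \<kappa>] step_deriv obtain z where "y < z" "z < x" "\<eta> x - \<eta> y = (x - y) * \<kappa> z" by force
      then show ?thesis by (intro that[of z]) (auto simp: algebra_simps)
    qed
    have "\<eta> y - \<eta> x - \<kappa> x * (y - x) = (y - x) * (\<kappa> w - \<kappa> x)" using w by (simp add: algebra_simps)
    also have "\<bar>\<dots>\<bar> \<le> \<bar>y - x\<bar> * (B * \<bar>y - x\<bar>)"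
      unfolding abs_mult
    proof (rule mult_left_mono)
      show "\<bar>\<kappa> w - \<kappa> x\<bar> \<le> B * \<bar>y - x\<bar>"
        using lip[of w] mult_left_mono[OF w(2), of B] assms[of 0] by linarith
    qed simp
    finally show ?thesis by (simp add: power2_eq_square mult_ac)
  qed auto
qed

text \<open>The kernel has mass 1 in either variable, so a function of x alone or of y alone keeps
  its integral when it is coupled by \<open>\<kappa> (x - y)\<close>. Every error term of the
  doubled integral is of this kind and is therefore evaluated without loss.\<close>

lemma integral_times_kernel:
  fixes g :: "real \<Rightarrow> real"
  assumes g: "integrable lborel g"
  shows "integrable (lborel \<Otimes>\<^sub>M lborel) (\<lambda>(x, y). g x * \<kappa> (x - y))" "(\<integral>(x, y). g x * \<kappa> (x - y) \<partial>(lborel \<Otimes>\<^sub>M lborel)) = (LBINT x. g x)"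
    "integrable (lborel \<Otimes>\<^sub>M lborel) (\<lambda>(x, y). g y * \<kappa> (x - y))" "(\<integral>(x, y). g y * \<kappa> (x - y) \<partial>(lborel \<Otimes>\<^sub>M lborel)) = (LBINT x. g x)"
proof -
  have [measurable]: "g \<in> borel_measurable borel" using borel_measurable_integrable[OF g] by simp
  show 1: "integrable (lborel \<Otimes>\<^sub>M lborel) (\<lambda>(x, y). g x * \<kappa> (x - y))"
    by (rule lborel_pair.Fubini_integrable) (use g in \<open>auto simp: abs_mult kernel_nonneg\<close>)
  show "(\<integral>(x, y). g x * \<kappa> (x - y) \<partial>(lborel \<Otimes>\<^sub>M lborel)) = (LBINT x. g x)"
    using lborel_pair.integral_fst'[OF 1] by simp
  have 2: "integrable (lborel \<Otimes>\<^sub>M lborel) (\<lambda>(x, y). g x * \<kappa> (y - x))"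
    by (rule lborel_pair.Fubini_integrable) (use g in \<open>auto simp: abs_mult kernel_nonneg\<close>)
  show 3: "integrable (lborel \<Otimes>\<^sub>M lborel) (\<lambda>(x, y). g y * \<kappa> (x - y))"
    using lborel_pair.integrable_product_swap[OF 2] by (simp add: case_prod_beta)
  show "(\<integral>(x, y). g y * \<kappa> (x - y) \<partial>(lborel \<Otimes>\<^sub>M lborel)) = (LBINT x. g x)"
    using lborel_pair.integral_snd[OF 3] by simp
qed

end

lemma pos_square_deriv: "((\<lambda>x::real. (max 0 x)\<^sup>2) has_real_derivative 2 * max 0 x) (at x)"
  by (rule DERIV_compose_max[where p = "\<lambda>x. x\<^sup>2" and p' = "\<lambda>x. 2 * x"]) (auto intro!: derivative_eq_intros)

section \<open>Integrable functions on the line\<close>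

lemma integrable_bounded_support:
  fixes g :: "real \<Rightarrow> real"
  assumes [measurable]: "g \<in> borel_measurable borel"
    and "\<And>x. \<bar>g x\<bar> \<le> B" and "\<And>x. x \<notin> {a..b} \<Longrightarrow> g x = 0"
  shows "integrable lborel g"
proof (rule Bochner_Integration.integrable_bound)
  show "integrable lborel (\<lambda>x. B * indicator {a..b} x :: real)"
    by (auto intro!: integrable_real_indicator simp: emeasure_lborel_Icc_eq)
  show "AE x in lborel. norm (g x) \<le> norm (B * indicator {a..b} x :: real)"
    using assms by (auto intro!: AE_I2 simp: indicator_def) (metis abs_ge_self order_trans)
qed auto

lemma integrable_bounded_support2:
  fixes g :: "real \<times> real \<Rightarrow> real"
  assumes [measurable]: "g \<in> borel_measurable (lborel \<Otimes>\<^sub>M lborel)"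
    and "\<And>p. \<bar>g p\<bar> \<le> B" and "\<And>p. p \<notin> {a..b} \<times> {a..b} \<Longrightarrow> g p = 0"
  shows "integrable (lborel \<Otimes>\<^sub>M lborel) g"
proof (rule Bochner_Integration.integrable_bound)
  have "emeasure (lborel \<Otimes>\<^sub>M lborel) ({a..b} \<times> {a..b}) < \<infinity>"
    by (subst lborel.emeasure_pair_measure_Times) (auto simp: emeasure_lborel_Icc_eq ennreal_mult_less_top)
  then show "integrable (lborel \<Otimes>\<^sub>M lborel) (\<lambda>p. B * indicator ({a..b} \<times> {a..b}) p :: real)"
    by (auto intro!: integrable_real_indicator)
  show "AE p in lborel \<Otimes>\<^sub>M lborel. norm (g p) \<le> norm (B * indicator ({a..b} \<times> {a..b}) p :: real)"
    using assms(2,3) by (auto intro!: AE_I2 simp: indicator_def) (metis abs_ge_self order_trans)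
qed auto

text \<open>Stands in for differentiating \<Phi>: the interval is cut into n equal steps shorter
  than h and the one-sided bounds are telescoped. The slack \<open>d / T\<close> per unit of time
  adds up to d over the whole interval.\<close>

lemma increment_bound:
  fixes \<Phi> :: "real \<Rightarrow> real"
  assumes "0 < T"
    and step: "\<And>\<epsilon>. 0 < \<epsilon> \<Longrightarrow> \<exists>h>0. \<forall>s t. 0 \<le> s \<longrightarrow> s < t \<longrightarrow> t \<le> T \<longrightarrow> t - s < h \<longrightarrow>
      \<Phi> t - \<Phi> s \<le> (t - s) * (E + \<epsilon>)"
  shows "\<Phi> T - \<Phi> 0 \<le> T * E"
proof (rule field_le_epsilon)
  fix d :: real assume "0 < d"
  then have "0 < d / T" using assms by simp
  from step[OF this] obtain h where h: "0 < h"
    "\<And>s t. 0 \<le> s \<Longrightarrow> s < t \<Longrightarrow> t \<le> T \<Longrightarrow> t - s < h \<Longrightarrow> \<Phi> t - \<Phi> s \<le> (t - s) * (E + d / T)" by blast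
  obtain n :: nat where n: "T / h < real n" using reals_Archimedean2 by blast
  with assms h have "0 < n" by (metis divide_pos_pos not_gr_zero of_nat_0 order_less_asym)
  define \<tau> where "\<tau> i = real i * T / n" for i :: nat
  have small: "T / n < h" using n h \<open>0 < n\<close> assms by (simp add: field_simps)
  have "\<Phi> (\<tau> i) - \<Phi> 0 \<le> \<tau> i * (E + d / T)" if "i \<le> n" for i
    using that
  proof (induction i)
    case (Suc i)
    have diff: "\<tau> (Suc i) - \<tau> i = T / n" by (simp add: \<tau>_def algebra_simps add_divide_distrib)
    have "\<Phi> (\<tau> (Suc i)) - \<Phi> (\<tau> i) \<le> (\<tau> (Suc i) - \<tau> i) * (E + d / T)"
    proof (rule h(2))
      show "0 \<le> \<tau> i" using assms by (simp add: \<tau>_def)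
      show "\<tau> i < \<tau> (Suc i)" using diff assms \<open>0 < n\<close> by (smt (verit) divide_pos_pos of_nat_0_less_iff)
      show "\<tau> (Suc i) \<le> T"
        using Suc(2) assms \<open>0 < n\<close> by (simp add: \<tau>_def divide_le_eq mult.commute[of T])
      show "\<tau> (Suc i) - \<tau> i < h" using diff small by simp
    qed
    with Suc show ?case by (simp add: algebra_simps)
  qed (simp add: \<tau>_def)
  from this[of n] show "\<Phi> T - \<Phi> 0 \<le> T * E + d"
    using \<open>0 < n\<close> \<open>0 < T\<close> by (simp add: \<tau>_def distrib_left)
qed

text \<open>Measurability supplies continuous functions converging almost everywhere. Clamping them
  to \<open>[-K, K]\<close> and multiplying by a trapezoidal cutoff \<open>c\<close> that is 1 on
  \<open>[-R, R]\<close> leaves the limit unchanged and provides a common integrable majorant, so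
  dominated convergence upgrades the convergence to L^1.\<close>

lemma continuous_approximation_L1:
  fixes g :: "real \<Rightarrow> real"
  assumes [measurable]: "g \<in> borel_measurable borel" and bd: "\<And>x. \<bar>g x\<bar> \<le> K"
    and supp: "\<And>x. x \<notin> {-R..R} \<Longrightarrow> g x = 0" and "0 < \<epsilon>"
  obtains G where "continuous_on UNIV G" "\<And>x. \<bar>G x\<bar> \<le> K" "\<And>x. x \<notin> {-R-1..R+1} \<Longrightarrow> G x = 0"
    "(LBINT x. \<bar>G x - g x\<bar>) < \<epsilon>"
proof -
  have K: "0 \<le> K" using bd[of 0] by simp
  have "g measurable_on UNIV"
    by (rule lebesgue_measurable_imp_measurable_on_real) (auto intro: measurable_completion)
  then obtain N G where N: "negligible N" and G: "\<And>n. continuous_on UNIV (G n)"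
    and lim: "\<And>x. x \<notin> N \<Longrightarrow> (\<lambda>n. G n x) \<longlonglongrightarrow> g x"
    unfolding measurable_on_def by auto
  define c where "c x = max 0 (min 1 (R + 1 - \<bar>x\<bar>))" for x
  define H where "H n x = max (- K) (min K (G n x)) * c x" for n x
  have H: "continuous_on UNIV (H n)" for n
    unfolding H_def c_def by (intro continuous_intros G)
  have c: "0 \<le> c x" "c x \<le> 1" for x by (auto simp: c_def)
  have Hb: "\<bar>H n x\<bar> \<le> K" for n x
  proof -
    have "\<bar>max (- K) (min K (G n x))\<bar> * c x \<le> K * 1"
      using K c by (intro mult_mono) (auto simp: max_def min_def)
    then show ?thesis using c[of x] by (simp add: H_def abs_mult)
  qed
  have H0: "x \<notin> {-R-1..R+1} \<Longrightarrow> H n x = 0" for n x by (auto simp: H_def c_def)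
  have [measurable]: "H n \<in> borel_measurable borel" for n
    using H by (rule borel_measurable_continuous_onI)
  have limH: "(\<lambda>n. \<bar>H n x - g x\<bar>) \<longlonglongrightarrow> 0" if "x \<notin> N" for x
  proof -
    have "(\<lambda>n. H n x) \<longlonglongrightarrow> max (- K) (min K (g x)) * c x"
      unfolding H_def by (intro tendsto_intros lim that)
    also have "max (- K) (min K (g x)) * c x = g x"
      using bd[of x] supp[of x] by (cases "x \<in> {-R..R}") (auto simp: c_def)
    finally show ?thesis by (auto intro!: tendsto_eq_intros)
  qed
  have "(\<lambda>n. LBINT x. \<bar>H n x - g x\<bar>) \<longlonglongrightarrow> (LBINT x::real. 0)"
  proof (rule integral_dominated_convergence[where w = "\<lambda>x. 2 * K * indicator {-R-1..R+1} x"])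
    show "AE x in lborel. (\<lambda>n. \<bar>H n x - g x\<bar>) \<longlonglongrightarrow> 0"
    proof -
      have "AE x in lebesgue. x \<notin> N" using N by (simp add: AE_not_in negligible_iff_null_sets)
      then have "AE x in lborel. x \<notin> N" by (simp add: AE_completion_iff)
      then show ?thesis using limH by (auto elim!: eventually_mono)
    qed
    show "AE x in lborel. norm \<bar>H n x - g x\<bar> \<le> 2 * K * indicator {-R-1..R+1} x" for n
    proof (intro AE_I2)
      fix x show "norm \<bar>H n x - g x\<bar> \<le> 2 * K * indicator {-R-1..R+1} x"
        using Hb[of n x] bd[of x] H0[of x n] supp[of x] by (cases "x \<in> {-R-1..R+1}") auto
    qed
  qed (auto intro!: integrable_real_indicator simp: emeasure_lborel_Icc_eq)
  from order_tendstoD(2)[OF this, of \<epsilon>] \<open>0 < \<epsilon>\<close>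
  obtain n where "(LBINT x. \<bar>H n x - g x\<bar>) < \<epsilon>" by (auto simp: eventually_sequentially)
  then show thesis using that[of "H n"] H Hb H0 by blast
qed

lemma LBINT_translate: "(LBINT x. g (x - z)) = (LBINT x. g x)" for g :: "real \<Rightarrow> real"
  using lborel_integral_real_affine[of 1 g "-z"] by (simp add: algebra_simps)

lemma L1_translation_continuous:
  fixes g :: "real \<Rightarrow> real"
  assumes g[measurable]: "g \<in> borel_measurable borel" and bd: "\<And>x. \<bar>g x\<bar> \<le> K"
    and supp: "\<And>x. x \<notin> {-R..R} \<Longrightarrow> g x = 0" and "0 < \<epsilon>"
  obtains \<delta> where "0 < \<delta>" "\<And>z. \<bar>z\<bar> < \<delta> \<Longrightarrow> (LBINT x. \<bar>g (x - z) - g x\<bar>) < \<epsilon>"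
proof -
  obtain G where G: "continuous_on UNIV G" "\<And>x. \<bar>G x\<bar> \<le> K" "\<And>x. x \<notin> {-R-1..R+1} \<Longrightarrow> G x = 0"
    "(LBINT x. \<bar>G x - g x\<bar>) < \<epsilon> / 3"
    using continuous_approximation_L1[OF g bd supp, where \<epsilon> = "\<epsilon> / 3"] \<open>0 < \<epsilon>\<close> by auto
  have Gm [measurable]: "G \<in> borel_measurable borel" using G(1) by (rule borel_measurable_continuous_onI)
  \<comment> \<open>The modulus is integrated over \<open>[-R-2, R+2]\<close>, of length at most
    \<open>2 * \<bar>R\<bar> + 4\<close>; the larger denominator makes the result strictly less than
    \<open>\<epsilon> / 3\<close>. Uniform continuity is taken on \<open>[-R-3, R+3]\<close> to
    contain both x and \<open>x - z\<close> for \<open>\<bar>z\<bar> < 1\<close>.\<close>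
  define c where "c = \<epsilon> / (3 * (2 * \<bar>R\<bar> + 7))"
  have "0 < c" using \<open>0 < \<epsilon>\<close> by (auto simp: c_def)
  have "uniformly_continuous_on {-R-3..R+3} G"
    by (rule compact_uniformly_continuous[OF continuous_on_subset[OF G(1)]]) auto
  from uniformly_continuous_onE[OF this \<open>0 < c\<close>]
  obtain d where d: "0 < d"
    "\<And>x y. x \<in> {-R-3..R+3} \<Longrightarrow> y \<in> {-R-3..R+3} \<Longrightarrow> dist y x < d \<Longrightarrow> dist (G y) (G x) < c" by metis
  show thesis
  proof (rule that[of "min d 1"])
    fix z :: real assume z: "\<bar>z\<bar> < min d 1"
    have ptw: "\<bar>G (x - z) - G x\<bar> \<le> c * indicator {-R-2..R+2} x" for x
    proof (cases "x \<in> {-R-2..R+2}")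
      case True
      with z have "dist (G (x - z)) (G x) < c" by (intro d) (auto simp: dist_real_def)
      with True show ?thesis by (simp add: dist_real_def)
    next
      case False
      with z have "x \<notin> {-R-1..R+1}" "x - z \<notin> {-R-1..R+1}" by auto
      then show ?thesis using G(3) False by simp
    qed
    have cint: "integrable lborel (\<lambda>x. c * indicator {-R-2..R+2} x :: real)"
      by (auto intro!: integrable_real_indicator simp: emeasure_lborel_Icc_eq)
    have iG: "integrable lborel G" by (rule integrable_bounded_support[OF Gm G(2,3)])
    have ig: "integrable lborel g" by (rule integrable_bounded_support[OF g bd supp])
    have iGz: "integrable lborel (\<lambda>x. G (x - z))" and igz: "integrable lborel (\<lambda>x. g (x - z))"
      using lborel_integrable_real_affine[OF iG, of 1 "-z"] lborel_integrable_real_affine[OF ig, of 1 "-z"] by simp_all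
    have "(LBINT x. \<bar>G (x - z) - G x\<bar>) \<le> (LBINT x. c * indicator {-R-2..R+2} x)"
      using iG iGz cint ptw by (intro integral_mono) auto
    also have "\<dots> \<le> c * (2 * \<bar>R\<bar> + 4)"
      using \<open>0 < c\<close> by (auto simp: measure_def emeasure_lborel_Icc_eq)
    also have "\<dots> < \<epsilon> / 3"
      using \<open>0 < \<epsilon>\<close> by (simp add: c_def divide_simps)
    finally have 1: "(LBINT x. \<bar>G (x - z) - G x\<bar>) < \<epsilon> / 3" .
    have 2: "(LBINT x. \<bar>G (x - z) - g (x - z)\<bar>) < \<epsilon> / 3"
      using G(4) LBINT_translate[of "\<lambda>x. \<bar>G x - g x\<bar>" z] by simp
    have "(LBINT x. \<bar>g (x - z) - g x\<bar>)
        \<le> (LBINT x. \<bar>G (x - z) - g (x - z)\<bar> + \<bar>G (x - z) - G x\<bar> + \<bar>G x - g x\<bar>)"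
      using iG ig iGz igz by (intro integral_mono) auto
    also have "\<dots> = (LBINT x. \<bar>G (x - z) - g (x - z)\<bar>) + (LBINT x. \<bar>G (x - z) - G x\<bar>) + (LBINT x. \<bar>G x - g x\<bar>)"
      using iG ig iGz igz by (simp add: Bochner_Integration.integral_add)
    finally show "(LBINT x. \<bar>g (x - z) - g x\<bar>) < \<epsilon>" using 1 2 G(4) by linarith
  qed (use d in auto)
qed

lemma deriv_compact_support:
  fixes \<theta> \<theta>' :: "real \<Rightarrow> real"
  assumes d: "\<And>x. (\<theta> has_real_derivative \<theta>' x) (at x)" and c: "continuous_on UNIV \<theta>'"
    and out: "\<And>x. x \<notin> {-r..r} \<Longrightarrow> \<theta> x = 0"
  shows "x \<notin> {-r..r} \<Longrightarrow> \<theta>' x = 0" "has_bochner_integral lborel \<theta>' 0"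
proof -
  show *: "\<theta>' x = 0" if "x \<notin> {-r..r}" for x
  proof (rule DERIV_local_const[OF d])
    show "0 < max (x - r) (- r - x)" using that by auto
    show "\<forall>y. \<bar>x - y\<bar> < max (x - r) (- r - x) \<longrightarrow> \<theta> x = \<theta> y"
    proof (intro allI impI)
      fix y assume "\<bar>x - y\<bar> < max (x - r) (- r - x)"
      then have "y \<notin> {-r..r}" by auto
      with that show "\<theta> x = \<theta> y" by (simp add: out)
    qed
  qed
  \<comment> \<open>Using \<open>\<bar>r\<bar> + 1\<close> instead of r puts both end points outside
    the support and keeps the interval nonempty for negative r.\<close>
  have "has_bochner_integral lborel (\<lambda>x. \<theta>' x * indicator {-\<bar>r\<bar>-1..\<bar>r\<bar>+1} x) (\<theta> (\<bar>r\<bar>+1) - \<theta> (-\<bar>r\<bar>-1))"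
    by (rule has_bochner_integral_FTC_Icc_real[OF _ d])
      (use c in \<open>auto simp: continuous_on_eq_continuous_at\<close>)
  moreover have "\<theta>' x * indicator {-\<bar>r\<bar>-1..\<bar>r\<bar>+1} x = \<theta>' x" for x
    using *[of x] by (cases "x \<in> {-r..r}") auto
  moreover have "\<theta> (\<bar>r\<bar> + 1) = 0" "\<theta> (- \<bar>r\<bar> - 1) = 0" by (auto intro!: out)
  ultimately show "has_bochner_integral lborel \<theta>' 0" by simp
qed

section \<open>Kruzhkov fluxes and curves\<close>

text \<open>The entropy flux that belongs to Kruzhkov's entropy \<open>\<bar>a - k\<bar>\<close>.
  Being symmetric in a and k, it allows the values of the second curve to take the place of the
  constant.\<close>

definition kflux :: "(real \<Rightarrow> real) \<Rightarrow> real \<Rightarrow> real \<Rightarrow> real" where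
  "kflux f a k = sgn (a - k) * (f a - f k)"

lemma kflux_commute: "kflux f a k = kflux f k a"
  by (auto simp: kflux_def sgn_if algebra_simps)

text \<open>Both sides equal \<open>sgn (a - k) * (a - k) * (f a - f k)\<close>. This is the
  algebraic reason for the exact conservation of the doubled integral.\<close>

lemma kflux_mult_diff: "kflux f a k * (a - k) = \<bar>a - k\<bar> * (f a - f k)"
  by (auto simp: kflux_def sgn_if abs_if algebra_simps)

text \<open>On one side of k the flux is \<open>f\<close> up to sign and a constant. If k separates
  a and b, then \<open>\<bar>a - k\<bar> + \<bar>b - k\<bar> = \<bar>a - b\<bar>\<close>, so passing
  through k, where the flux vanishes, does not enlarge the constant.\<close>

lemma kflux_lipschitz:
  assumes lip: "\<And>x y. x \<in> S \<Longrightarrow> y \<in> S \<Longrightarrow> \<bar>f x - f y\<bar> \<le> L * \<bar>x - y\<bar>"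
    and "a \<in> S" "b \<in> S" "k \<in> S"
  shows "\<bar>kflux f a k - kflux f b k\<bar> \<le> L * \<bar>a - b\<bar>"
proof -
  consider "(a \<ge> k \<and> b \<ge> k) \<or> (a \<le> k \<and> b \<le> k)" | "a > k \<and> b < k" | "a < k \<and> b > k" by linarith
  then show ?thesis
  proof cases
    case 1
    then have "\<bar>kflux f a k - kflux f b k\<bar> \<le> \<bar>f a - f b\<bar>"
      by (cases "a = k"; cases "b = k") (auto simp: kflux_def sgn_if)
    then show ?thesis using lip[of a b] assms by linarith
  next
    case 2
    then have "\<bar>kflux f a k - kflux f b k\<bar> \<le> \<bar>f a - f k\<bar> + \<bar>f b - f k\<bar>" by (simp add: kflux_def)
    also have "\<dots> \<le> L * \<bar>a - k\<bar> + L * \<bar>b - k\<bar>" using assms by (intro add_mono lip)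
    also have "\<dots> = L * \<bar>a - b\<bar>" using 2 by (simp add: algebra_simps)
    finally show ?thesis .
  next
    case 3
    then have "\<bar>kflux f a k - kflux f b k\<bar> \<le> \<bar>f a - f k\<bar> + \<bar>f b - f k\<bar>" by (simp add: kflux_def)
    also have "\<dots> \<le> L * \<bar>a - k\<bar> + L * \<bar>b - k\<bar>" using assms by (intro add_mono lip)
    also have "\<dots> = L * \<bar>a - b\<bar>" using 3 by (simp add: algebra_simps)
    finally show ?thesis .
  qed
qed

lemma kflux_bound:
  assumes "\<And>x y. x \<in> S \<Longrightarrow> y \<in> S \<Longrightarrow> \<bar>f x - f y\<bar> \<le> L * \<bar>x - y\<bar>" "a \<in> S" "k \<in> S"
  shows "\<bar>kflux f a k\<bar> \<le> L * \<bar>a - k\<bar>"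
  using assms(1)[of a k] assms(2,3) by (auto simp: kflux_def abs_mult sgn_if)

lemma kflux_measurable [measurable (raw)]:
  assumes [measurable]: "f \<in> borel_measurable borel" "g \<in> borel_measurable M" "h \<in> borel_measurable M"
  shows "(\<lambda>x. kflux f (g x) (h x)) \<in> borel_measurable M"
  unfolding kflux_def by measurable

text \<open>What the comparison argument needs, with range and support holding at every point rather
  than almost everywhere. The entropy inequality is stated on a time interval with a test function
  of x alone, and b bounds each time slice of the flux term; thus no integral over time, and no
  measurability in time, enters the doubling argument.\<close>

locale kruzhkov_curve =
  fixes f :: "real \<Rightarrow> real" and K L R T :: real and u :: "real \<Rightarrow> real \<Rightarrow> real"
  assumes flux_continuous: "continuous_on UNIV f" and flux_0: "f 0 = 0"
    and flux_lipschitz: "\<And>a b. a \<in> {0..K} \<Longrightarrow> b \<in> {0..K} \<Longrightarrow> \<bar>f a - f b\<bar> \<le> L * \<bar>a - b\<bar>"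
    and radius_nonneg: "0 \<le> R" and lipschitz_nonneg: "0 \<le> L"
    and curve_measurable: "\<And>t. t \<in> {0..T} \<Longrightarrow> u t \<in> borel_measurable borel"
    and curve_range: "\<And>t x. t \<in> {0..T} \<Longrightarrow> u t x \<in> {0..K}"
    and curve_support: "\<And>t x. t \<in> {0..T} \<Longrightarrow> x \<notin> {-R..R} \<Longrightarrow> u t x = 0"
    and curve_mass: "\<And>t. t \<in> {0..T} \<Longrightarrow> (LBINT x. u t x) = 1"
    and curve_uniform: "\<And>\<epsilon>. 0 < \<epsilon> \<Longrightarrow>
      \<exists>h>0. \<forall>s\<in>{0..T}. \<forall>t\<in>{0..T}. \<bar>s - t\<bar> < h \<longrightarrow> (LBINT x. \<bar>u s x - u t x\<bar>) < \<epsilon>"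
    and curve_entropy: "\<And>t\<^sub>1 t\<^sub>2 k \<theta> \<theta>' r b. 0 \<le> t\<^sub>1 \<Longrightarrow> t\<^sub>1 < t\<^sub>2 \<Longrightarrow> t\<^sub>2 \<le> T \<Longrightarrow> k \<in> {0..K} \<Longrightarrow>
      (\<And>x. (\<theta> has_real_derivative \<theta>' x) (at x)) \<Longrightarrow> continuous_on UNIV \<theta>' \<Longrightarrow> (\<And>x. 0 \<le> \<theta> x) \<Longrightarrow>
      (\<And>x. x \<notin> {-r..r} \<Longrightarrow> \<theta> x = 0) \<Longrightarrow>
      (\<And>\<tau>. t\<^sub>1 < \<tau> \<Longrightarrow> \<tau> < t\<^sub>2 \<Longrightarrow> (LBINT x. kflux f (u \<tau> x) k * \<theta>' x) \<le> b) \<Longrightarrow>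
      (LBINT x. \<bar>u t\<^sub>2 x - k\<bar> * \<theta> x) - (LBINT x. \<bar>u t\<^sub>1 x - k\<bar> * \<theta> x) \<le> b * (t\<^sub>2 - t\<^sub>1)"
begin

lemma bound_nonneg: "t \<in> {0..T} \<Longrightarrow> 0 \<le> K" using curve_range[of t 0] by auto

lemma flux_measurable [measurable]: "f \<in> borel_measurable borel"
  using flux_continuous by (rule borel_measurable_continuous_onI)

lemma flux_bound: "a \<in> {0..K} \<Longrightarrow> \<bar>f a\<bar> \<le> L * a"
  using flux_lipschitz[of a 0] flux_0 by auto

lemma curve_integrable: "t \<in> {0..T} \<Longrightarrow> integrable lborel (u t)"
  by (rule integrable_bounded_support[where a="-R" and b=R and B=K])
    (use curve_measurable curve_range curve_support in auto)

text \<open>A continuous curve on a compact interval has a totally bounded image in L^1. Finitely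
  many times form an \<open>\<epsilon> / 3\<close>-net, the smallest of their moduli of translation
  works for all, and translation invariance of the integral carries it to every t.\<close>

lemma uniform_translation:
  assumes "0 < \<epsilon>"
  obtains \<delta> where "0 < \<delta>" "\<And>t z. t \<in> {0..T} \<Longrightarrow> \<bar>z\<bar> < \<delta> \<Longrightarrow> (LBINT x. \<bar>u t (x - z) - u t x\<bar>) < \<epsilon>"
proof -
  obtain h where h: "0 < h"
    "\<And>s t. s \<in> {0..T} \<Longrightarrow> t \<in> {0..T} \<Longrightarrow> \<bar>s - t\<bar> < h \<Longrightarrow> (LBINT x. \<bar>u s x - u t x\<bar>) < \<epsilon> / 3"
    using curve_uniform[of "\<epsilon> / 3"] assms by auto
  obtain S where S: "S \<subseteq> {0..T}" "finite S" "{0..T} \<subseteq> (\<Union>s\<in>S. ball s h)"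
    by (rule compactE_image[of "{0..T}" "{0..T}" "\<lambda>s. ball s h"]) (use h in auto)
  have "\<exists>\<delta>>0. \<forall>z. \<bar>z\<bar> < \<delta> \<longrightarrow> (LBINT x. \<bar>u s (x - z) - u s x\<bar>) < \<epsilon> / 3" if "s \<in> S" for s
  proof -
    have s: "s \<in> {0..T}" using that S by auto
    show ?thesis
      by (rule L1_translation_continuous[of "u s" K R "\<epsilon> / 3"])
        (use curve_measurable[OF s] curve_range[OF s] curve_support[OF s] assms in auto)
  qed
  then obtain \<delta> where \<delta>: "\<And>s. s \<in> S \<Longrightarrow> 0 < \<delta> s"
    "\<And>s z. s \<in> S \<Longrightarrow> \<bar>z\<bar> < \<delta> s \<Longrightarrow> (LBINT x. \<bar>u s (x - z) - u s x\<bar>) < \<epsilon> / 3" by metis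
  define d where "d = Min (insert 1 (\<delta> ` S))"
  have d: "0 < d" "\<And>s. s \<in> S \<Longrightarrow> d \<le> \<delta> s" using S \<delta> by (auto simp: d_def)
  show thesis
  proof (rule that[OF d(1)])
    fix t z :: real assume t: "t \<in> {0..T}" and z: "\<bar>z\<bar> < d"
    obtain s where s: "s \<in> S" "\<bar>s - t\<bar> < h" using S(3) t by (auto simp: dist_real_def)
    then have sT: "s \<in> {0..T}" using S by auto
    note i = curve_integrable[OF sT] curve_integrable[OF t]
    note iz = lborel_integrable_real_affine[OF i(1), of 1 "-z"] lborel_integrable_real_affine[OF i(2), of 1 "-z"]
    have "(LBINT x. \<bar>u t (x - z) - u t x\<bar>)
        \<le> (LBINT x. \<bar>u s (x - z) - u t (x - z)\<bar> + \<bar>u s (x - z) - u s x\<bar> + \<bar>u s x - u t x\<bar>)"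
      using i iz by (intro integral_mono) auto
    also have "\<dots> = (LBINT x. \<bar>u s (x - z) - u t (x - z)\<bar>) + (LBINT x. \<bar>u s (x - z) - u s x\<bar>) + (LBINT x. \<bar>u s x - u t x\<bar>)"
      using i iz by (simp add: Bochner_Integration.integral_add)
    also have "\<dots> < \<epsilon>"
      using LBINT_translate[of "\<lambda>x. \<bar>u s x - u t x\<bar>" z] h(2)[OF sT t s(2)] \<delta>(2)[OF s(1), of z] d(2)[OF s(1)] z
      by linarith
    finally show "(LBINT x. \<bar>u t (x - z) - u t x\<bar>) < \<epsilon>" .
  qed
qed

end

section \<open>Mollified curves\<close>

locale mollified_curve = kruzhkov_curve + smooth_step
begin

text \<open>Because \<eta> is a primitive of \<kappa>, this is the distribution function of
  \<open>smooth_density\<close>.\<close>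

definition smooth_cdf :: "real \<Rightarrow> real \<Rightarrow> real" where
  "smooth_cdf t x = (LBINT z. u t z * \<eta> (x - z))"

definition smooth_density :: "real \<Rightarrow> real \<Rightarrow> real" where
  "smooth_density t x = (LBINT z. u t z * \<kappa> (x - z))"

text \<open>The flux is mollified after \<open>f\<close> has been applied. The conservation law is
  linear in the pair \<open>(u, f u)\<close>, so this, and not \<open>f\<close> of the mollified
  density, is exactly minus the time derivative of \<open>smooth_cdf\<close>.\<close>

definition smooth_flux :: "real \<Rightarrow> real \<Rightarrow> real" where
  "smooth_flux t x = (LBINT z. f (u t z) * \<kappa> (x - z))"

text \<open>A common majorant at x of the mollification errors of \<open>u t\<close> and, up to the
  factor L, of \<open>f (u t)\<close>.\<close>

definition oscillation :: "real \<Rightarrow> real \<Rightarrow> real" where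
  "oscillation t x = (LBINT z. \<bar>u t z - u t x\<bar> * \<kappa> (x - z))"

lemma integrable_curve_mult:
  assumes t: "t \<in> {0..T}" and [measurable]: "c \<in> borel_measurable borel" and c: "\<And>x. \<bar>c x\<bar> \<le> C"
  shows "integrable lborel (\<lambda>z. u t z * c z)" "integrable lborel (\<lambda>z. f (u t z) * c z)"
proof -
  note [measurable] = curve_measurable[OF t]
  show "integrable lborel (\<lambda>z. u t z * c z)"
  proof (rule integrable_bounded_support[where a = "-R" and b = R and B = "K * C"])
    show "\<bar>u t x * c x\<bar> \<le> K * C" for x
      unfolding abs_mult using curve_range[OF t, of x] c[of x] by (intro mult_mono) auto
  qed (use curve_support[OF t] in auto)
  show "integrable lborel (\<lambda>z. f (u t z) * c z)"
  proof (rule integrable_bounded_support[where a = "-R" and b = R and B = "(L * K) * C"])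
    show "\<bar>f (u t x) * c x\<bar> \<le> (L * K) * C" for x
      unfolding abs_mult
    proof (intro mult_mono)
      show "\<bar>f (u t x)\<bar> \<le> L * K"
        using flux_bound[OF curve_range[OF t, of x]] curve_range[OF t, of x] lipschitz_nonneg
        by (auto intro: order_trans mult_left_mono)
    qed (use c[of x] lipschitz_nonneg bound_nonneg[OF t] in auto)
  qed (use curve_support[OF t] flux_0 in auto)
qed

lemma smooth_integrable:
  assumes t: "t \<in> {0..T}"
  shows "integrable lborel (\<lambda>z. u t z * \<eta> (x - z))" "integrable lborel (\<lambda>z. u t z * \<kappa> (x - z))"
    "integrable lborel (\<lambda>z. f (u t z) * \<kappa> (x - z))"
proof -
  obtain B where B: "0 < B" "\<And>x. \<kappa> x \<le> B" using kernel_bounds by metis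
  show "integrable lborel (\<lambda>z. u t z * \<eta> (x - z))"
    by (rule integrable_curve_mult[OF t, where C=1]) (auto simp: step_nonneg step_le_1)
  show "integrable lborel (\<lambda>z. u t z * \<kappa> (x - z))"
    by (rule integrable_curve_mult[OF t, where C=B]) (auto simp: kernel_nonneg B)
  show "integrable lborel (\<lambda>z. f (u t z) * \<kappa> (x - z))"
    by (rule integrable_curve_mult[OF t, where C=B]) (auto simp: kernel_nonneg B)
qed

lemma smooth_cdf_bounds:
  assumes t: "t \<in> {0..T}" shows "0 \<le> smooth_cdf t x" "smooth_cdf t x \<le> 1"
proof -
  have r: "0 \<le> u t z" for z using curve_range[OF t, of z] by simp
  show "0 \<le> smooth_cdf t x" unfolding smooth_cdf_def using r step_nonneg by (intro integral_nonneg_AE) auto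
  have "smooth_cdf t x \<le> (LBINT z. u t z)"
    unfolding smooth_cdf_def using smooth_integrable[OF t] curve_integrable[OF t] r step_le_1 step_nonneg
    by (intro integral_mono) (auto intro: mult_left_le)
  then show "smooth_cdf t x \<le> 1" by (simp add: curve_mass[OF t])
qed

lemma smooth_density_bounds:
  assumes t: "t \<in> {0..T}" shows "0 \<le> smooth_density t x" "smooth_density t x \<le> K"
proof -
  have r: "u t z \<in> {0..K}" for z using curve_range[OF t, of z] by simp
  show "0 \<le> smooth_density t x"
    unfolding smooth_density_def using r kernel_nonneg by (intro integral_nonneg_AE) auto
  have "smooth_density t x \<le> (LBINT z. K * \<kappa> (x - z))"
    unfolding smooth_density_def using smooth_integrable[OF t] r kernel_nonneg
    by (intro integral_mono) (auto intro: mult_right_mono)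
  then show "smooth_density t x \<le> K" by simp
qed

lemma smooth_flux_bound:
  assumes t: "t \<in> {0..T}" shows "\<bar>smooth_flux t x\<bar> \<le> L * K"
proof -
  have r: "\<bar>f (u t z)\<bar> \<le> L * K" for z
    using flux_bound[OF curve_range[OF t, of z]] curve_range[OF t, of z] lipschitz_nonneg
    by (auto intro: order_trans mult_left_mono)
  have "\<bar>smooth_flux t x\<bar> \<le> (LBINT z. \<bar>f (u t z) * \<kappa> (x - z)\<bar>)"
    unfolding smooth_flux_def by (rule integral_abs_bound)
  also have "\<dots> \<le> (LBINT z. (L * K) * \<kappa> (x - z))"
    using smooth_integrable(3)[OF t, of x] r
    by (intro integral_mono integrable_abs) (auto simp: abs_mult kernel_nonneg intro!: mult_right_mono)
  finally show ?thesis by simp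
qed

lemma smooth_measurable [measurable]:
  assumes t: "t \<in> {0..T}"
  shows "smooth_density t \<in> borel_measurable borel" "smooth_flux t \<in> borel_measurable borel"
    "smooth_cdf t \<in> borel_measurable borel" "oscillation t \<in> borel_measurable borel"
proof -
  note [measurable] = curve_measurable[OF t]
  show "smooth_density t \<in> borel_measurable borel" "smooth_flux t \<in> borel_measurable borel"
    "smooth_cdf t \<in> borel_measurable borel" "oscillation t \<in> borel_measurable borel"
    unfolding smooth_density_def smooth_flux_def smooth_cdf_def oscillation_def by measurable
qed

text \<open>The remainder of \<open>step_taylor\<close> is integrated against a density of mass 1,
  so the difference quotient is off by at most \<open>B * \<bar>h\<bar>\<close>.\<close>

lemma smooth_cdf_deriv:
  assumes t: "t \<in> {0..T}" shows "(smooth_cdf t has_real_derivative smooth_density t x) (at x)"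
proof -
  obtain B where B: "0 < B" "\<And>x. \<bar>\<kappa>' x\<bar> \<le> B" using kernel_bounds by metis
  have bound: "\<bar>smooth_cdf t (x + h) - smooth_cdf t x - smooth_density t x * h\<bar> \<le> B * h\<^sup>2" for h
  proof -
    note i = smooth_integrable[OF t]
    have "smooth_cdf t (x + h) - smooth_cdf t x - smooth_density t x * h
        = (LBINT z. u t z * (\<eta> (x + h - z) - \<eta> (x - z) - \<kappa> (x - z) * h))"
    proof -
      have "(LBINT z. u t z * (\<eta> (x + h - z) - \<eta> (x - z) - \<kappa> (x - z) * h))
        = (LBINT z. (u t z * \<eta> (x + h - z) - u t z * \<eta> (x - z)) - (u t z * \<kappa> (x - z)) * h)"
        by (simp add: algebra_simps)
      also have "\<dots> = smooth_cdf t (x + h) - smooth_cdf t x - smooth_density t x * h"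
        unfolding smooth_cdf_def smooth_density_def using i by simp
      finally show ?thesis by simp
    qed
    then have "\<bar>smooth_cdf t (x + h) - smooth_cdf t x - smooth_density t x * h\<bar>
        \<le> (LBINT z. \<bar>u t z * (\<eta> (x + h - z) - \<eta> (x - z) - \<kappa> (x - z) * h)\<bar>)"
      by (simp only: integral_abs_bound)
    also have "\<dots> \<le> (LBINT z. u t z * (B * h\<^sup>2))"
    proof (rule integral_mono)
      show "integrable lborel (\<lambda>z. \<bar>u t z * (\<eta> (x + h - z) - \<eta> (x - z) - \<kappa> (x - z) * h)\<bar>)"
      proof (rule integrable_abs)
        have "integrable lborel (\<lambda>z. (u t z * \<eta> (x + h - z) - u t z * \<eta> (x - z)) - (u t z * \<kappa> (x - z)) * h)"
          using i by simp
        then show "integrable lborel (\<lambda>z. u t z * (\<eta> (x + h - z) - \<eta> (x - z) - \<kappa> (x - z) * h))"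
          by (simp add: algebra_simps)
      qed
      show "integrable lborel (\<lambda>z. u t z * (B * h\<^sup>2))" using curve_integrable[OF t] by simp
      show "\<bar>u t z * (\<eta> (x + h - z) - \<eta> (x - z) - \<kappa> (x - z) * h)\<bar> \<le> u t z * (B * h\<^sup>2)" for z
        using step_taylor[OF B(2), of "x + h - z" "x - z"] curve_range[OF t, of z]
        by (auto simp: abs_mult intro!: mult_left_mono)
    qed
    also have "\<dots> = B * h\<^sup>2" using curve_mass[OF t] by simp
    finally show ?thesis .
  qed
  have "((\<lambda>h. (smooth_cdf t (x + h) - smooth_cdf t x) / h - smooth_density t x) \<longlongrightarrow> 0) (at 0)"
  proof (rule Lim_null_comparison)
    show "\<forall>\<^sub>F h in at 0. norm ((smooth_cdf t (x + h) - smooth_cdf t x) / h - smooth_density t x) \<le> B * \<bar>h\<bar>"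
    proof (rule eventually_at_filter[THEN iffD2], intro always_eventually allI impI)
      fix h :: real assume "h \<noteq> 0"
      then have "norm ((smooth_cdf t (x + h) - smooth_cdf t x) / h - smooth_density t x)
        = \<bar>smooth_cdf t (x + h) - smooth_cdf t x - smooth_density t x * h\<bar> / \<bar>h\<bar>"
        by (simp add: divide_simps flip: abs_divide)
      also have "\<dots> \<le> B * h\<^sup>2 / \<bar>h\<bar>" using bound by (intro divide_right_mono) auto
      also have "\<dots> = B * \<bar>h\<bar>" using \<open>h \<noteq> 0\<close> by (simp add: power2_eq_square divide_simps abs_mult_self_eq)
      finally show "norm ((smooth_cdf t (x + h) - smooth_cdf t x) / h - smooth_density t x) \<le> B * \<bar>h\<bar>" .
    qed
    show "((\<lambda>h. B * \<bar>h\<bar>) \<longlongrightarrow> 0) (at 0)" by (auto intro!: tendsto_eq_intros)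
  qed
  then show ?thesis by (simp add: DERIV_def LIM_zero_iff)
qed

lemma smooth_density_continuous:
  assumes t: "t \<in> {0..T}" shows "continuous_on A (smooth_density t)"
proof -
  obtain B where B: "0 < B" "\<And>x. \<bar>\<kappa>' x\<bar> \<le> B" using kernel_bounds by metis
  have lip: "\<bar>\<kappa> y - \<kappa> x\<bar> \<le> B * \<bar>y - x\<bar>" for x y
    using field_differentiable_bound[of UNIV \<kappa> \<kappa>' B y x] kernel_deriv B(2) by auto
  have "B-lipschitz_on A (smooth_density t)"
  proof (rule lipschitz_onI)
    fix x y
    note i = smooth_integrable[OF t]
    have "smooth_density t x - smooth_density t y = (LBINT z. u t z * (\<kappa> (x - z) - \<kappa> (y - z)))"
      unfolding smooth_density_def using i
      by (simp add: algebra_simps flip: Bochner_Integration.integral_diff)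
    also have "\<bar>\<dots>\<bar> \<le> (LBINT z. \<bar>u t z * (\<kappa> (x - z) - \<kappa> (y - z))\<bar>)"
      by (rule integral_abs_bound)
    also have "\<dots> \<le> (LBINT z. u t z * (B * \<bar>x - y\<bar>))"
    proof (rule integral_mono)
      show "integrable lborel (\<lambda>z. \<bar>u t z * (\<kappa> (x - z) - \<kappa> (y - z))\<bar>)"
        using i(2)[of y] i(2)[of x] by (auto simp: algebra_simps)
      show "\<bar>u t z * (\<kappa> (x - z) - \<kappa> (y - z))\<bar> \<le> u t z * (B * \<bar>x - y\<bar>)" for z
        using lip[of "x - z" "y - z"] curve_range[OF t, of z]
        by (auto simp: abs_mult intro!: mult_left_mono)
    qed (use curve_integrable[OF t] in simp)
    also have "\<dots> = B * \<bar>x - y\<bar>" using curve_mass[OF t] by simp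
    finally show "dist (smooth_density t x) (smooth_density t y) \<le> B * dist x y"
      by (simp add: dist_real_def)
  qed (use B in auto)
  then show ?thesis by (rule lipschitz_on_continuous_on)
qed

lemma oscillation_integrable:
  assumes t: "t \<in> {0..T}" shows "integrable lborel (\<lambda>z. \<bar>u t z - u t x\<bar> * \<kappa> (x - z))"
proof (rule Bochner_Integration.integrable_bound)
  note [measurable] = curve_measurable[OF t]
  show "integrable lborel (\<lambda>z. K * \<kappa> (x - z))" by simp
  show "AE z in lborel. norm (\<bar>u t z - u t x\<bar> * \<kappa> (x - z)) \<le> norm (K * \<kappa> (x - z))"
  proof (intro AE_I2)
    fix z show "norm (\<bar>u t z - u t x\<bar> * \<kappa> (x - z)) \<le> norm (K * \<kappa> (x - z))"
      using curve_range[OF t, of z] curve_range[OF t, of x] kernel_nonneg[of "x - z"]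
      by (auto simp: abs_mult intro!: mult_right_mono)
  qed
  show "(\<lambda>z. \<bar>u t z - u t x\<bar> * \<kappa> (x - z)) \<in> borel_measurable lborel" by measurable
qed

lemma smooth_density_error:
  assumes t: "t \<in> {0..T}" shows "\<bar>smooth_density t x - u t x\<bar> \<le> oscillation t x"
proof -
  have "smooth_density t x - u t x = smooth_density t x - (LBINT z. u t x * \<kappa> (x - z))" by simp
  also have "\<dots> = (LBINT z. (u t z - u t x) * \<kappa> (x - z))"
    unfolding smooth_density_def using smooth_integrable[OF t]
    by (subst Bochner_Integration.integral_diff[symmetric]) (auto simp: algebra_simps)
  also have "\<bar>\<dots>\<bar> \<le> (LBINT z. \<bar>(u t z - u t x) * \<kappa> (x - z)\<bar>)" by (rule integral_abs_bound)
  finally show ?thesis by (simp add: oscillation_def abs_mult kernel_nonneg)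
qed

lemma smooth_flux_error:
  assumes t: "t \<in> {0..T}" shows "\<bar>smooth_flux t x - f (u t x)\<bar> \<le> L * oscillation t x"
proof -
  have "smooth_flux t x - f (u t x) = smooth_flux t x - (LBINT z. f (u t x) * \<kappa> (x - z))" by simp
  also have "\<dots> = (LBINT z. (f (u t z) - f (u t x)) * \<kappa> (x - z))"
    unfolding smooth_flux_def using smooth_integrable[OF t]
    by (subst Bochner_Integration.integral_diff[symmetric]) (auto simp: algebra_simps)
  also have "\<bar>\<dots>\<bar> \<le> (LBINT z. \<bar>(f (u t z) - f (u t x)) * \<kappa> (x - z)\<bar>)" by (rule integral_abs_bound)
  also have "\<dots> \<le> (LBINT z. L * (\<bar>u t z - u t x\<bar> * \<kappa> (x - z)))"
  proof (rule integral_mono)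
    show "integrable lborel (\<lambda>z. \<bar>(f (u t z) - f (u t x)) * \<kappa> (x - z)\<bar>)"
      using smooth_integrable(3)[OF t] by (auto simp: left_diff_distrib)
    show "integrable lborel (\<lambda>z. L * (\<bar>u t z - u t x\<bar> * \<kappa> (x - z)))"
      using oscillation_integrable[OF t] by simp
    show "\<bar>(f (u t z) - f (u t x)) * \<kappa> (x - z)\<bar> \<le> L * (\<bar>u t z - u t x\<bar> * \<kappa> (x - z))" for z
      using flux_lipschitz[OF curve_range[OF t, of z] curve_range[OF t, of x]] kernel_nonneg[of "x - z"]
      by (auto simp: abs_mult mult.assoc[symmetric] intro!: mult_right_mono)
  qed
  finally show ?thesis by (simp add: oscillation_def)
qed

lemma oscillation_nonneg: "0 \<le> oscillation t x"
  unfolding oscillation_def using kernel_nonneg by (intro integral_nonneg_AE) auto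

text \<open>With \<open>z = x - w\<close> and the order of integration exchanged, the total
  oscillation is the average, with weight \<open>\<kappa> w\<close>, of the L^1 distances between
  \<open>u t\<close> and its translates by w. Only \<open>0 < w < e\<close> carries weight.\<close>

lemma oscillation_integral:
  assumes t: "t \<in> {0..T}" and \<omega>: "\<And>w. 0 < w \<Longrightarrow> w < e \<Longrightarrow> (LBINT x. \<bar>u t (x - w) - u t x\<bar>) \<le> \<omega>"
  shows "integrable lborel (oscillation t)" "(LBINT x. oscillation t x) \<le> \<omega>"
proof -
  note [measurable] = curve_measurable[OF t]
  obtain B where B: "0 < B" "\<And>x. \<kappa> x \<le> B" using kernel_bounds by metis
  define G where "G = (\<lambda>(x, w). \<bar>u t (x - w) - u t x\<bar> * \<kappa> w)"
  have alt: "oscillation t x = (LBINT w. G (x, w))" for x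
    unfolding oscillation_def G_def
    using lborel_integral_real_affine[of "-1" "\<lambda>z. \<bar>u t z - u t x\<bar> * \<kappa> (x - z)" x] by simp
  have Gm [measurable]: "G \<in> borel_measurable (lborel \<Otimes>\<^sub>M lborel)" unfolding G_def by measurable
  have "integrable (lborel \<Otimes>\<^sub>M lborel) G"
  proof (rule integrable_bounded_support2[where a = "-(R + e)" and b = "R + e" and B = "K * B"])
    show "\<bar>G p\<bar> \<le> K * B" for p
    proof -
      obtain x w where p: "p = (x, w)" by fastforce
      have "\<bar>u t (x - w) - u t x\<bar> * \<kappa> w \<le> K * B"
        using curve_range[OF t, of x] curve_range[OF t, of "x - w"] kernel_nonneg[of w] B(2)[of w]
        by (intro mult_mono) auto
      then show ?thesis by (simp add: p G_def abs_mult kernel_nonneg)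
    qed
    show "G p = 0" if "p \<notin> {- (R + e)..R + e} \<times> {- (R + e)..R + e}" for p
    proof -
      obtain x w where p: "p = (x, w)" by fastforce
      show ?thesis
      proof (cases "w \<in> {0<..<e}")
        case True
        with that p radius_nonneg have "x \<notin> {-R..R}" "x - w \<notin> {-R..R}" by auto
        then show ?thesis using curve_support[OF t] by (simp add: p G_def)
      qed (simp add: p G_def kernel_outside)
    qed
  qed simp
  note G = this
  show "integrable lborel (oscillation t)"
    using lborel_pair.integrable_fst'[OF G] by (simp add: alt[abs_def])
  have "(LBINT x. oscillation t x) = (LBINT w. LBINT x. G (x, w))"
    using lborel_pair.Fubini_integral[of "\<lambda>x w. G (x, w)"] G by (simp add: alt)
  also have "\<dots> \<le> (LBINT w. \<omega> * \<kappa> w)"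
  proof (rule integral_mono)
    show "integrable lborel (\<lambda>w. LBINT x. G (x, w))"
      using lborel_pair.integrable_snd[of "\<lambda>x w. G (x, w)"] G by simp
    show "integrable lborel (\<lambda>w. \<omega> * \<kappa> w)" using kernel_integrable(3)[of 0] by simp
    show "(LBINT x. G (x, w)) \<le> \<omega> * \<kappa> w" for w
      using \<omega>[of w] kernel_outside[of w] kernel_nonneg[of w]
      by (cases "w \<in> {0<..<e}") (auto simp: G_def intro: mult_right_mono)
  qed
  also have "\<dots> = \<omega>" using kernel_integrable(4)[of 0] by simp
  finally show "(LBINT x. oscillation t x) \<le> \<omega>" .
qed

lemma smooth_flux_time_lipschitz:
  assumes "s \<in> {0..T}" "t \<in> {0..T}" and B: "\<And>x. \<kappa> x \<le> B"
  shows "\<bar>smooth_flux s x - smooth_flux t x\<bar> \<le> B * L * (LBINT z. \<bar>u s z - u t z\<bar>)"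
proof -
  note i = smooth_integrable[OF assms(1)] smooth_integrable[OF assms(2)]
  have "smooth_flux s x - smooth_flux t x = (LBINT z. (f (u s z) - f (u t z)) * \<kappa> (x - z))"
    unfolding smooth_flux_def using i
    by (subst Bochner_Integration.integral_diff[symmetric]) (auto simp: algebra_simps)
  also have "\<bar>\<dots>\<bar> \<le> (LBINT z. \<bar>(f (u s z) - f (u t z)) * \<kappa> (x - z)\<bar>)" by (rule integral_abs_bound)
  also have "\<dots> \<le> (LBINT z. (B * L) * \<bar>u s z - u t z\<bar>)"
  proof (rule integral_mono)
    show "integrable lborel (\<lambda>z. \<bar>(f (u s z) - f (u t z)) * \<kappa> (x - z)\<bar>)"
      using i by (auto simp: left_diff_distrib)
    show "integrable lborel (\<lambda>z. (B * L) * \<bar>u s z - u t z\<bar>)"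
      using curve_integrable[OF assms(1)] curve_integrable[OF assms(2)] by auto
    show "\<bar>(f (u s z) - f (u t z)) * \<kappa> (x - z)\<bar> \<le> (B * L) * \<bar>u s z - u t z\<bar>" for z
    proof -
      have "\<bar>f (u s z) - f (u t z)\<bar> * \<kappa> (x - z) \<le> (L * \<bar>u s z - u t z\<bar>) * B"
        using flux_lipschitz[OF curve_range[OF assms(1), of z] curve_range[OF assms(2), of z]]
          kernel_nonneg[of "x - z"] B[of "x - z"] lipschitz_nonneg
        by (intro mult_mono) auto
      then show ?thesis by (simp add: abs_mult kernel_nonneg mult_ac)
    qed
  qed
  finally show ?thesis by simp
qed

text \<open>An integrated form of "the time derivative of \<open>smooth_cdf\<close> is minus
  \<open>smooth_flux\<close>"; c is a reference value of the flux and b its deviation during the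
  step. For values in \<open>[0, K]\<close> the entropies with \<open>k = 0\<close> and
  \<open>k = K\<close> are affine in u with slopes 1 and -1, so the two entropy inequalities bound
  the increment from above and from below.\<close>

lemma smooth_cdf_increment:
  assumes t: "0 \<le> s" "s < t" "t \<le> T"
    and b: "\<And>\<tau>. s < \<tau> \<Longrightarrow> \<tau> < t \<Longrightarrow> \<bar>smooth_flux \<tau> x - c\<bar> \<le> b"
  shows "\<bar>smooth_cdf t x - smooth_cdf s x + c * (t - s)\<bar> \<le> b * (t - s)"
proof -
  \<comment> \<open>The first factor is the desired weight but stays 1 far to the left. The second
    cuts it off there and equals 1 on \<open>[-R, R]\<close>, so wherever u is nonzero nothing
    changes.\<close>
  define \<theta> where "\<theta> z = \<eta> (x - z) * \<eta> (z + R + e)" for z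
  define \<theta>' where "\<theta>' z = \<eta> (x - z) * \<kappa> (z + R + e) - \<kappa> (x - z) * \<eta> (z + R + e)" for z
  define r where "r = \<bar>x\<bar> + R + e"
  have shift: "((\<lambda>z. z + R + e) has_real_derivative 1) (at z)" "((\<lambda>z. x - z) has_real_derivative -1) (at z)" for z
    by (auto intro!: derivative_eq_intros)
  have d: "(\<theta> has_real_derivative \<theta>' z) (at z)" for z
    unfolding \<theta>_def
    by (rule DERIV_cong[OF DERIV_mult[OF DERIV_chain2[OF step_deriv shift(2)] DERIV_chain2[OF step_deriv shift(1)]]])
      (simp add: \<theta>'_def algebra_simps)
  have c': "continuous_on A \<theta>'" for A unfolding \<theta>'_def
    by (intro continuous_intros continuous_on_compose2[OF continuous_step[of UNIV]] continuous_on_compose2[OF continuous_kernel[of UNIV]]) auto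
  have nonneg: "0 \<le> \<theta> z" for z by (simp add: \<theta>_def step_nonneg)
  have out: "\<theta> z = 0" if "z \<notin> {-r..r}" for z
  proof -
    have "x - z \<le> 0 \<or> z + R + e \<le> 0" using that radius_nonneg width_pos by (auto simp: r_def)
    then show "\<theta> z = 0" by (auto simp: \<theta>_def step_left)
  qed
  have cm: "continuous_on UNIV \<theta>" using d by (meson DERIV_isCont continuous_at_imp_continuous_on)
  note m [measurable] = borel_measurable_continuous_onI[OF c'[of UNIV]] borel_measurable_continuous_onI[OF cm]
  have inside: "z \<in> {-R..R} \<Longrightarrow> \<theta> z = \<eta> (x - z)" "z \<in> {-R..R} \<Longrightarrow> \<theta>' z = - \<kappa> (x - z)" for z
    by (auto simp: \<theta>_def \<theta>'_def step_right kernel_outside)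
  have bd: "\<bar>\<theta> z\<bar> \<le> 1" for z
    using nonneg[of z] step_le_1 step_nonneg by (auto simp: \<theta>_def intro: mult_le_one)
  have i\<theta>: "integrable lborel \<theta>" by (rule integrable_bounded_support[OF _ bd out]) auto
  have I\<theta>': "has_bochner_integral lborel \<theta>' 0" by (rule deriv_compact_support(2)[OF d c' out])
  have tT: "s \<in> {0..T}" "t \<in> {0..T}" using t by auto
  have k0: "(LBINT z. \<bar>u \<tau> z - 0\<bar> * \<theta> z) = smooth_cdf \<tau> x" if "\<tau> \<in> {0..T}" for \<tau>
    unfolding smooth_cdf_def
  proof (rule Bochner_Integration.integral_cong)
    fix z show "\<bar>u \<tau> z - 0\<bar> * \<theta> z = u \<tau> z * \<eta> (x - z)"
      using curve_range[OF that, of z] curve_support[OF that, of z] inside(1)[of z] by (cases "z \<in> {-R..R}") auto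
  qed simp
  have f0: "(LBINT z. kflux f (u \<tau> z) 0 * \<theta>' z) = - smooth_flux \<tau> x" if "\<tau> \<in> {0..T}" for \<tau>
    unfolding smooth_flux_def integral_minus[symmetric]
  proof (rule Bochner_Integration.integral_cong)
    fix z show "kflux f (u \<tau> z) 0 * \<theta>' z = - (f (u \<tau> z) * \<kappa> (x - z))"
      using curve_range[OF that, of z] curve_support[OF that, of z] inside(2)[of z] flux_0
      by (cases "z \<in> {-R..R}") (auto simp: kflux_def sgn_if)
  qed simp
  have kK: "(LBINT z. \<bar>u \<tau> z - K\<bar> * \<theta> z) = (LBINT z. K * \<theta> z) - smooth_cdf \<tau> x" if "\<tau> \<in> {0..T}" for \<tau>
    unfolding smooth_cdf_def using i\<theta> smooth_integrable(1)[OF that]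
  proof (subst Bochner_Integration.integral_diff[symmetric])
    show "(LBINT z. \<bar>u \<tau> z - K\<bar> * \<theta> z) = (LBINT z. K * \<theta> z - u \<tau> z * \<eta> (x - z))"
    proof (rule Bochner_Integration.integral_cong)
      fix z show "\<bar>u \<tau> z - K\<bar> * \<theta> z = K * \<theta> z - u \<tau> z * \<eta> (x - z)"
        using curve_range[OF that, of z] curve_support[OF that, of z] inside(1)[of z]
        by (cases "z \<in> {-R..R}") (auto simp: algebra_simps)
    qed simp
  qed auto
  \<comment> \<open>For \<open>k = K\<close> the flux is \<open>f K - f u\<close>; the constant
    \<open>f K\<close> drops out because \<theta>' has integral 0.\<close>
  have fK: "(LBINT z. kflux f (u \<tau> z) K * \<theta>' z) = smooth_flux \<tau> x" if "\<tau> \<in> {0..T}" for \<tau>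
  proof -
    have "(LBINT z. kflux f (u \<tau> z) K * \<theta>' z) = (LBINT z. f K * \<theta>' z + f (u \<tau> z) * \<kappa> (x - z))"
    proof (rule Bochner_Integration.integral_cong)
      fix z show "kflux f (u \<tau> z) K * \<theta>' z = f K * \<theta>' z + f (u \<tau> z) * \<kappa> (x - z)"
        using curve_range[OF that, of z] curve_support[OF that, of z] inside(2)[of z] flux_0
        by (cases "z \<in> {-R..R}") (auto simp: kflux_def sgn_if algebra_simps)
    qed simp
    also have "\<dots> = smooth_flux \<tau> x"
      using I\<theta>' smooth_integrable(3)[OF that]
      by (subst Bochner_Integration.integral_add) (auto simp: has_bochner_integral_iff smooth_flux_def)
    finally show ?thesis .
  qed
  have "(LBINT z. \<bar>u t z - 0\<bar> * \<theta> z) - (LBINT z. \<bar>u s z - 0\<bar> * \<theta> z) \<le> (b - c) * (t - s)"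
  proof (rule curve_entropy[OF t _ d c' nonneg out])
    fix \<tau> assume \<tau>: "s < \<tau>" "\<tau> < t"
    then show "(LBINT z. kflux f (u \<tau> z) 0 * \<theta>' z) \<le> b - c"
      using b[OF \<tau>] f0[of \<tau>] t by (simp add: abs_le_iff)
  qed (use bound_nonneg[OF tT(1)] in simp)
  moreover have "(LBINT z. \<bar>u t z - K\<bar> * \<theta> z) - (LBINT z. \<bar>u s z - K\<bar> * \<theta> z) \<le> (b + c) * (t - s)"
  proof (rule curve_entropy[OF t _ d c' nonneg out])
    fix \<tau> assume \<tau>: "s < \<tau>" "\<tau> < t"
    then show "(LBINT z. kflux f (u \<tau> z) K * \<theta>' z) \<le> b + c"
      using b[OF \<tau>] fK[of \<tau>] t by (simp add: abs_le_iff)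
  qed (use bound_nonneg[OF tT(1)] in simp)
  ultimately have "smooth_cdf t x - smooth_cdf s x \<le> (b - c) * (t - s)" "smooth_cdf s x - smooth_cdf t x \<le> (b + c) * (t - s)"
    unfolding k0[OF tT(1)] k0[OF tT(2)] kK[OF tT(1)] kK[OF tT(2)] by simp_all
  then show ?thesis unfolding abs_le_iff by (simp add: algebra_simps)
qed

end

text \<open>For each y the entropy inequality is used with the constant \<open>k y\<close> and the
  test function \<open>\<psi> _ y\<close>, and the result is integrated over y. In the applications
  k is the other curve at the time where it is held, and k' is that curve at time s: on the right
  every flux is brought to time s, at a cost proportional to the L^1 displacement of the two
  curves.\<close>

lemma (in kruzhkov_curve) entropy_integrated:
  fixes \<psi> \<psi>' :: "real \<Rightarrow> real \<Rightarrow> real"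
  assumes t: "0 \<le> s" "s < t" "t \<le> T" and "0 < e"
    and k: "k \<in> borel_measurable borel" "\<And>y. k y \<in> {0..K}" "\<And>y. y \<notin> {-R..R} \<Longrightarrow> k y = 0"
    and k': "k' \<in> borel_measurable borel" "\<And>y. k' y \<in> {0..K}" "\<And>y. y \<notin> {-R..R} \<Longrightarrow> k' y = 0"
    and d: "\<And>x y. ((\<lambda>x. \<psi> x y) has_real_derivative \<psi>' x y) (at x)"
    and c: "\<And>y. continuous_on UNIV (\<lambda>x. \<psi>' x y)"
    and m: "(\<lambda>(x, y). \<psi> x y) \<in> borel_measurable (lborel \<Otimes>\<^sub>M lborel)"
      "(\<lambda>(x, y). \<psi>' x y) \<in> borel_measurable (lborel \<Otimes>\<^sub>M lborel)"
    and b: "\<And>x y. 0 \<le> \<psi> x y" "\<And>x y. \<psi> x y \<le> B" "\<And>x y. \<bar>\<psi>' x y\<bar> \<le> B"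
    and out: "\<And>x y. x \<notin> {y - e..y + e} \<Longrightarrow> \<psi> x y = 0" "\<And>x y. x \<notin> {y - e..y + e} \<Longrightarrow> \<psi>' x y = 0"
    and \<mu>: "\<And>\<tau>. s < \<tau> \<Longrightarrow> \<tau> < t \<Longrightarrow> (LBINT x. \<bar>u \<tau> x - u s x\<bar>) \<le> \<mu>"
  shows "(\<integral>(x, y). \<bar>u t x - k y\<bar> * \<psi> x y \<partial>(lborel \<Otimes>\<^sub>M lborel))
      - (\<integral>(x, y). \<bar>u s x - k y\<bar> * \<psi> x y \<partial>(lborel \<Otimes>\<^sub>M lborel))
    \<le> (t - s) * ((\<integral>(x, y). kflux f (u s x) (k' y) * \<psi>' x y \<partial>(lborel \<Otimes>\<^sub>M lborel))
        + L * B * \<mu> * (2 * (R + e)) + L * B * (2 * e) * (LBINT y. \<bar>k y - k' y\<bar>))"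
proof -
  have tT: "s \<in> {0..T}" "t \<in> {0..T}" using t by auto
  note K = bound_nonneg[OF tT(1)]
  have B: "0 \<le> B" using b(1)[of 0 0] b(2)[of 0 0] by linarith
  note [measurable] = k(1) k'(1) m
  have [measurable]: "(\<lambda>x. \<psi>' x y) \<in> borel_measurable borel" for y
    using c by (rule borel_measurable_continuous_onI)
  \<comment> \<open>In the band \<open>\<bar>x - y\<bar> \<le> e\<close> that carries \<psi>, one
    coordinate beyond \<open>R + e\<close> forces both beyond R, where \<open>u\<close>,
    \<open>k\<close> and \<open>k'\<close> all vanish.\<close>
  define r where "r = R + e"
  have i1: "integrable (lborel \<Otimes>\<^sub>M lborel) (\<lambda>(x, y). \<bar>u \<tau> x - k y\<bar> * \<psi> x y)" if \<tau>: "\<tau> \<in> {0..T}" for \<tau>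
  proof (rule integrable_bounded_support2[where a = "-r" and b = r and B = "K * B"])
    note [measurable] = curve_measurable[OF \<tau>]
    show "(\<lambda>(x, y). \<bar>u \<tau> x - k y\<bar> * \<psi> x y) \<in> borel_measurable (lborel \<Otimes>\<^sub>M lborel)" by measurable
    show "\<bar>case p of (x, y) \<Rightarrow> \<bar>u \<tau> x - k y\<bar> * \<psi> x y\<bar> \<le> K * B" for p
    proof (cases p)
      case (Pair x y)
      have "\<bar>u \<tau> x - k y\<bar> * \<psi> x y \<le> K * B"
        using curve_range[OF \<tau>, of x] k(2)[of y] b by (intro mult_mono) auto
      then show ?thesis using b by (simp add: Pair abs_mult)
    qed
    show "(case p of (x, y) \<Rightarrow> \<bar>u \<tau> x - k y\<bar> * \<psi> x y) = 0" if "p \<notin> {-r..r} \<times> {-r..r}" for p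
    proof (cases p)
      case (Pair x y)
      show ?thesis
      proof (cases "x \<in> {y - e..y + e}")
        case True
        with that Pair \<open>0 < e\<close> have "x \<notin> {-R..R}" "y \<notin> {-R..R}" by (auto simp: r_def)
        then show ?thesis using curve_support[OF \<tau>] k(3) Pair by simp
      qed (simp add: Pair out)
    qed
  qed
  have i2: "integrable (lborel \<Otimes>\<^sub>M lborel) (\<lambda>(x, y). kflux f (u s x) (k' y) * \<psi>' x y)"
  proof (rule integrable_bounded_support2[where a = "-r" and b = r and B = "(L * K) * B"])
    note [measurable] = curve_measurable[OF tT(1)]
    show "(\<lambda>(x, y). kflux f (u s x) (k' y) * \<psi>' x y) \<in> borel_measurable (lborel \<Otimes>\<^sub>M lborel)" by measurable
    show "\<bar>case p of (x, y) \<Rightarrow> kflux f (u s x) (k' y) * \<psi>' x y\<bar> \<le> (L * K) * B" for p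
    proof (cases p)
      case (Pair x y)
      have "\<bar>kflux f (u s x) (k' y)\<bar> \<le> L * \<bar>u s x - k' y\<bar>"
        using kflux_bound[of "{0..K}" f L, OF flux_lipschitz curve_range[OF tT(1), of x] k'(2)[of y]] .
      also have "\<dots> \<le> L * K"
        using curve_range[OF tT(1), of x] k'(2)[of y] lipschitz_nonneg by (intro mult_left_mono) auto
      finally show ?thesis
        unfolding Pair using b(3)[of x y] lipschitz_nonneg K by (auto simp: abs_mult intro: mult_mono)
    qed
    show "(case p of (x, y) \<Rightarrow> kflux f (u s x) (k' y) * \<psi>' x y) = 0" if "p \<notin> {-r..r} \<times> {-r..r}" for p
    proof (cases p)
      case (Pair x y)
      show ?thesis
      proof (cases "x \<in> {y - e..y + e}")
        case True
        with that Pair \<open>0 < e\<close> have "x \<notin> {-R..R}" "y \<notin> {-R..R}" by (auto simp: r_def)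
        then show ?thesis using curve_support[OF tT(1)] k'(3) Pair by (simp add: kflux_def)
      qed (simp add: Pair out)
    qed
  qed
  have kk: "integrable lborel (\<lambda>y. \<bar>k y - k' y\<bar>)"
  proof (rule integrable_bounded_support[where a = "-R" and b = R and B = K])
    show "\<bar>\<bar>k y - k' y\<bar>\<bar> \<le> K" for y using k(2)[of y] k'(2)[of y] by auto
    show "\<bar>k y - k' y\<bar> = 0" if "y \<notin> {-R..R}" for y using k(3)[OF that] k'(3)[OF that] by simp
  qed simp
  define Q where "Q y = (LBINT x. kflux f (u s x) (k' y) * \<psi>' x y)" for y
  define G where "G \<tau> y = (LBINT x. \<bar>u \<tau> x - k y\<bar> * \<psi> x y)" for \<tau> y
  have each: "G t y - G s y \<le> (t - s) * (Q y + L * B * \<mu> * indicator {-r..r} y + L * B * (2 * e) * \<bar>k y - k' y\<bar>)" for y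
  proof (cases "y \<in> {-r..r}")
    case True
    \<comment> \<open>The Kruzhkov flux is moved from \<open>(u \<tau> x, k y)\<close> to
      \<open>(u s x, k' y)\<close>, one argument at a time; by symmetry the Lipschitz bound holds in
      both. The second exchange does not depend on x and is paid for on a band of length
      \<open>2 * e\<close>.\<close>
    have slice: "(LBINT x. kflux f (u \<tau> x) (k y) * \<psi>' x y) \<le> Q y + L * B * \<mu> + L * B * (2 * e) * \<bar>k y - k' y\<bar>"
      if \<tau>: "s < \<tau>" "\<tau> < t" for \<tau>
    proof -
      have \<tau>T: "\<tau> \<in> {0..T}" using \<tau> t by auto
      note [measurable] = curve_measurable[OF tT(1)] curve_measurable[OF \<tau>T]
      have ik: "integrable lborel (\<lambda>x. kflux f (u \<sigma> x) j * \<psi>' x y)" if \<sigma>: "\<sigma> \<in> {0..T}" and j: "j \<in> {0..K}" for \<sigma> j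
      proof (rule integrable_bounded_support[where a = "y - e" and b = "y + e" and B = "(L * K) * B"])
        note [measurable] = curve_measurable[OF \<sigma>]
        show "(\<lambda>x. kflux f (u \<sigma> x) j * \<psi>' x y) \<in> borel_measurable borel" by measurable
        show "\<bar>kflux f (u \<sigma> x) j * \<psi>' x y\<bar> \<le> (L * K) * B" for x
        proof -
          have "\<bar>kflux f (u \<sigma> x) j\<bar> \<le> L * \<bar>u \<sigma> x - j\<bar>"
            using kflux_bound[of "{0..K}" f L, OF flux_lipschitz curve_range[OF \<sigma>, of x] j] .
          also have "\<dots> \<le> L * K"
            using curve_range[OF \<sigma>, of x] j lipschitz_nonneg by (intro mult_left_mono) auto
          finally show ?thesis
            using b(3)[of x y] lipschitz_nonneg K by (auto simp: abs_mult intro: mult_mono)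
        qed
      qed (simp add: out)
      have iu: "integrable lborel (\<lambda>x. \<bar>u \<tau> x - u s x\<bar>)"
        using curve_integrable[OF \<tau>T] curve_integrable[OF tT(1)] by auto
      have ie: "integrable lborel (indicator {y - e..y + e} :: real \<Rightarrow> real)"
        by (auto intro!: integrable_real_indicator simp: emeasure_lborel_Icc_eq)
      have "(LBINT x. kflux f (u \<tau> x) (k y) * \<psi>' x y) \<le>
        (LBINT x. kflux f (u s x) (k' y) * \<psi>' x y + (L * B) * \<bar>u \<tau> x - u s x\<bar>
          + (L * B * \<bar>k y - k' y\<bar>) * indicator {y - e..y + e} x)"
      proof (rule integral_mono)
        fix x
        show "kflux f (u \<tau> x) (k y) * \<psi>' x y \<le> kflux f (u s x) (k' y) * \<psi>' x y + (L * B) * \<bar>u \<tau> x - u s x\<bar>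
          + (L * B * \<bar>k y - k' y\<bar>) * indicator {y - e..y + e} x"
        proof (cases "x \<in> {y - e..y + e}")
          case True
          have "\<bar>kflux f (u \<tau> x) (k y) - kflux f (u s x) (k y)\<bar> \<le> L * \<bar>u \<tau> x - u s x\<bar>"
            by (rule kflux_lipschitz[of "{0..K}"]) (use flux_lipschitz curve_range[OF \<tau>T] curve_range[OF tT(1)] k(2) in blast)+
          moreover have "\<bar>kflux f (k y) (u s x) - kflux f (k' y) (u s x)\<bar> \<le> L * \<bar>k y - k' y\<bar>"
            by (rule kflux_lipschitz[of "{0..K}"]) (use flux_lipschitz curve_range[OF tT(1)] k(2) k'(2) in blast)+
          ultimately have 1: "\<bar>kflux f (u \<tau> x) (k y) - kflux f (u s x) (k' y)\<bar> \<le> L * \<bar>u \<tau> x - u s x\<bar> + L * \<bar>k y - k' y\<bar>"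
            using kflux_commute[of f "k y" "u s x"] kflux_commute[of f "k' y" "u s x"] by linarith
          have "(kflux f (u \<tau> x) (k y) - kflux f (u s x) (k' y)) * \<psi>' x y
            \<le> \<bar>kflux f (u \<tau> x) (k y) - kflux f (u s x) (k' y)\<bar> * \<bar>\<psi>' x y\<bar>"
            by (metis abs_ge_self abs_mult)
          also have "\<dots> \<le> (L * \<bar>u \<tau> x - u s x\<bar> + L * \<bar>k y - k' y\<bar>) * B"
            using 1 b(3)[of x y] lipschitz_nonneg by (intro mult_mono) auto
          finally show ?thesis using True by (simp add: algebra_simps)
        qed (use B lipschitz_nonneg in \<open>simp add: out\<close>)
        show "integrable lborel (\<lambda>x. kflux f (u \<tau> x) (k y) * \<psi>' x y)" by (rule ik[OF \<tau>T k(2)])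
        show "integrable lborel (\<lambda>x. kflux f (u s x) (k' y) * \<psi>' x y + (L * B) * \<bar>u \<tau> x - u s x\<bar>
          + (L * B * \<bar>k y - k' y\<bar>) * indicator {y - e..y + e} x)"
          by (intro Bochner_Integration.integrable_add ik[OF tT(1) k'(2)] integrable_mult_right iu ie)
      qed
      also have "\<dots> = Q y + L * B * (LBINT x. \<bar>u \<tau> x - u s x\<bar>) + (L * B * \<bar>k y - k' y\<bar>) * (2 * e)"
        using ik[OF tT(1) k'(2), of y] iu ie \<open>0 < e\<close>
        by (simp add: Bochner_Integration.integral_add Q_def measure_def emeasure_lborel_Icc_eq)
      also have "\<dots> \<le> Q y + L * B * \<mu> + (L * B * \<bar>k y - k' y\<bar>) * (2 * e)"
        using \<mu>[OF \<tau>] lipschitz_nonneg B by (intro add_mono mult_left_mono) auto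
      finally show ?thesis by (simp add: mult_ac)
    qed
    have "G t y - G s y \<le> (Q y + L * B * \<mu> + L * B * (2 * e) * \<bar>k y - k' y\<bar>) * (t - s)"
      unfolding G_def
    proof (rule curve_entropy[OF t k(2) d c b(1) _ slice])
      show "\<psi> x y = 0" if "x \<notin> {-(\<bar>y\<bar> + e)..\<bar>y\<bar> + e}" for x
        using that by (intro out) auto
    qed
    with True show ?thesis by (simp add: mult.commute)
  next
    case False
    \<comment> \<open>Beyond \<open>R + e\<close> both constants are 0 and the band keeps x away
      from the support of u, so both sides vanish. This confines the \<mu> term to an interval of
      length \<open>2 * (R + e)\<close>.\<close>
    then have y: "k y = 0" "k' y = 0" using k(3) k'(3) \<open>0 < e\<close> by (auto simp: r_def)
    have z: "u \<tau> x = 0 \<or> x \<notin> {y - e..y + e}" if "\<tau> \<in> {0..T}" for x \<tau>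
      using False curve_support[OF that, of x] by (auto simp: r_def)
    have "G \<tau> y = 0" if "\<tau> \<in> {0..T}" for \<tau>
      unfolding G_def using z[OF that] out(1)[of _ y] y
      by (intro integral_eq_zero_AE AE_I2) (metis abs_zero diff_zero mult_eq_0_iff)
    moreover have "Q y = 0"
      unfolding Q_def using z[OF tT(1)] out(2)[of _ y] y flux_0
      by (intro integral_eq_zero_AE AE_I2) (metis diff_self kflux_def mult_eq_0_iff)
    ultimately show ?thesis using tT y False by simp
  qed
  have iG: "integrable lborel (G \<tau>)" "(LBINT y. G \<tau> y) = (\<integral>(x, y). \<bar>u \<tau> x - k y\<bar> * \<psi> x y \<partial>(lborel \<Otimes>\<^sub>M lborel))"
    if "\<tau> \<in> {0..T}" for \<tau>
    using lborel_pair.integrable_snd[OF i1[OF that]] lborel_pair.integral_snd[OF i1[OF that]] by (simp_all add: G_def[abs_def])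
  have iQ: "integrable lborel Q" "(LBINT y. Q y) = (\<integral>(x, y). kflux f (u s x) (k' y) * \<psi>' x y \<partial>(lborel \<Otimes>\<^sub>M lborel))"
    using lborel_pair.integrable_snd[OF i2] lborel_pair.integral_snd[OF i2] by (simp_all add: Q_def[abs_def])
  have ir: "integrable lborel (indicator {-r..r} :: real \<Rightarrow> real)"
    by (auto intro!: integrable_real_indicator simp: emeasure_lborel_Icc_eq)
  have "(LBINT y. G t y - G s y) \<le> (LBINT y. (t - s) * (Q y + L * B * \<mu> * indicator {-r..r} y + L * B * (2 * e) * \<bar>k y - k' y\<bar>))"
    by (intro integral_mono each Bochner_Integration.integrable_diff Bochner_Integration.integrable_add
        integrable_mult_right iG iQ ir kk tT)
  also have "\<dots> = (t - s) * ((LBINT y. Q y) + L * B * \<mu> * (2 * (R + e)) + L * B * (2 * e) * (LBINT y. \<bar>k y - k' y\<bar>))"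
    using iQ(1) ir kk radius_nonneg \<open>0 < e\<close>
    by (simp add: Bochner_Integration.integral_add measure_def emeasure_lborel_Icc_eq r_def)
  finally show ?thesis using iG[OF tT(1)] iG[OF tT(2)] iQ by simp
qed

section \<open>Doubling the space variable\<close>

locale curve_pair =
  U: mollified_curve f K L R T u e \<eta> \<kappa> \<kappa>' + V: mollified_curve f K L R T v e \<eta> \<kappa> \<kappa>'
  for f K L R T u v e \<eta> \<kappa> \<kappa>'
begin

definition gap :: "real \<Rightarrow> real \<Rightarrow> real \<Rightarrow> real" where
  "gap t x y = U.smooth_cdf t x - V.smooth_cdf t y"

text \<open>The test function \<psi> of the overview for mollified distribution functions, with
  \<open>g z = (max 0 z)^2\<close>.\<close>

definition weight :: "real \<Rightarrow> real \<Rightarrow> real \<Rightarrow> real" where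
  "weight t x y = (max 0 (gap t x y))\<^sup>2 * \<kappa> (x - y)"

definition weight_x :: "real \<Rightarrow> real \<Rightarrow> real \<Rightarrow> real" where
  "weight_x t x y = 2 * max 0 (gap t x y) * U.smooth_density t x * \<kappa> (x - y) + (max 0 (gap t x y))\<^sup>2 * \<kappa>' (x - y)"

definition weight_y :: "real \<Rightarrow> real \<Rightarrow> real \<Rightarrow> real" where
  "weight_y t x y = - (2 * max 0 (gap t x y) * V.smooth_density t y * \<kappa> (x - y) + (max 0 (gap t x y))\<^sup>2 * \<kappa>' (x - y))"

definition doubled :: "real \<Rightarrow> real" where
  "doubled t = (\<integral>(x, y). \<bar>u t x - v t y\<bar> * weight t x y \<partial>(lborel \<Otimes>\<^sub>M lborel))"

lemma gap_bounds: assumes "t \<in> {0..T}" shows "gap t x y \<le> 1" "- 1 \<le> gap t x y"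
  using U.smooth_cdf_bounds[OF assms, of x] V.smooth_cdf_bounds[OF assms, of y] by (auto simp: gap_def)

lemma weight_measurable:
  assumes "t \<in> {0..T}"
  shows "(\<lambda>(x, y). weight t x y) \<in> borel_measurable (lborel \<Otimes>\<^sub>M lborel)"
    "(\<lambda>(x, y). weight_x t x y) \<in> borel_measurable (lborel \<Otimes>\<^sub>M lborel)"
    "(\<lambda>(x, y). weight_y t x y) \<in> borel_measurable (lborel \<Otimes>\<^sub>M lborel)"
proof -
  note [measurable] = U.smooth_measurable[OF assms] V.smooth_measurable[OF assms]
  show "(\<lambda>(x, y). weight t x y) \<in> borel_measurable (lborel \<Otimes>\<^sub>M lborel)"
    "(\<lambda>(x, y). weight_x t x y) \<in> borel_measurable (lborel \<Otimes>\<^sub>M lborel)"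
    "(\<lambda>(x, y). weight_y t x y) \<in> borel_measurable (lborel \<Otimes>\<^sub>M lborel)"
    unfolding weight_def weight_x_def weight_y_def gap_def by measurable
qed

lemma weight_deriv_x:
  assumes t: "t \<in> {0..T}"
  shows "((\<lambda>x. weight t x y) has_real_derivative weight_x t x y) (at x)"
proof -
  have g: "((\<lambda>x. gap t x y) has_real_derivative U.smooth_density t x) (at x)"
    unfolding gap_def using U.smooth_cdf_deriv[OF t, of x] by (auto intro!: derivative_eq_intros)
  have k: "((\<lambda>x. \<kappa> (x - y)) has_real_derivative \<kappa>' (x - y) * 1) (at x)"
    by (rule DERIV_chain2[OF U.kernel_deriv]) (auto intro!: derivative_eq_intros)
  show ?thesis unfolding weight_def
    by (rule DERIV_cong[OF DERIV_mult[OF DERIV_chain2[OF pos_square_deriv g] k]]) (simp add: weight_x_def)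
qed

lemma weight_deriv_y:
  assumes t: "t \<in> {0..T}"
  shows "((\<lambda>y. weight t x y) has_real_derivative weight_y t x y) (at y)"
proof -
  have g: "((\<lambda>y. gap t x y) has_real_derivative - V.smooth_density t y) (at y)"
    unfolding gap_def using V.smooth_cdf_deriv[OF t, of y] by (auto intro!: derivative_eq_intros)
  have k: "((\<lambda>y. \<kappa> (x - y)) has_real_derivative \<kappa>' (x - y) * (- 1)) (at y)"
    by (rule DERIV_chain2[OF U.kernel_deriv]) (auto intro!: derivative_eq_intros)
  show ?thesis unfolding weight_def
    by (rule DERIV_cong[OF DERIV_mult[OF DERIV_chain2[OF pos_square_deriv g] k]]) (simp add: weight_y_def)
qed

lemma weight_continuous:
  assumes t: "t \<in> {0..T}"
  shows "continuous_on UNIV (\<lambda>x. weight_x t x y)" "continuous_on UNIV (\<lambda>y. weight_y t x y)"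
proof -
  have cU: "continuous_on UNIV (U.smooth_cdf t)" and cV: "continuous_on UNIV (V.smooth_cdf t)"
    using U.smooth_cdf_deriv[OF t] V.smooth_cdf_deriv[OF t]
    by (meson DERIV_isCont continuous_at_imp_continuous_on)+
  show "continuous_on UNIV (\<lambda>x. weight_x t x y)" "continuous_on UNIV (\<lambda>y. weight_y t x y)"
    unfolding weight_x_def weight_y_def gap_def
    by (intro continuous_intros cU cV U.smooth_density_continuous[OF t] V.smooth_density_continuous[OF t]
        continuous_on_compose2[OF U.continuous_kernel[of UNIV]]
        continuous_on_compose2[OF U.continuous_kernel_deriv]; simp)+
qed

lemma weight_nonneg: "0 \<le> weight t x y"
  by (simp add: weight_def U.kernel_nonneg)

text \<open>The gap lies in \<open>[-1, 1]\<close> and the mollified densities in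
  \<open>[0, K]\<close>. Differentiating the square costs \<open>2 * K\<close> and differentiating
  the kernel costs 1, each times B.\<close>

lemma weight_bounds:
  assumes t: "t \<in> {0..T}" and B: "\<And>x. \<kappa> x \<le> B" "\<And>x. \<bar>\<kappa>' x\<bar> \<le> B"
  shows "weight t x y \<le> (2 * K + 1) * B" "\<bar>weight_x t x y\<bar> \<le> (2 * K + 1) * B" "\<bar>weight_y t x y\<bar> \<le> (2 * K + 1) * B"
proof -
  have g: "0 \<le> max 0 (gap t x y)" "max 0 (gap t x y) \<le> 1" using gap_bounds[OF t, of x y] by auto
  then have g2: "(max 0 (gap t x y))\<^sup>2 \<le> 1" by (simp add: abs_square_le_1)
  have B0: "0 \<le> B" using U.kernel_nonneg[of 0] B(1)[of 0] by linarith
  have K0: "0 \<le> K" by (rule U.bound_nonneg[OF t])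
  have *: "\<bar>(max 0 (gap t x y))\<^sup>2 * \<kappa>' (x - y)\<bar> \<le> 1 * B"
    unfolding abs_mult using g2 B by (intro mult_mono) auto
  have **: "\<bar>2 * max 0 (gap t x y) * d * \<kappa> (x - y)\<bar> \<le> 2 * 1 * K * B" if "0 \<le> d" "d \<le> K" for d
    unfolding abs_mult using g B that K0 U.kernel_nonneg[of "x - y"] by (intro mult_mono) auto
  have "(max 0 (gap t x y))\<^sup>2 * \<kappa> (x - y) \<le> 1 * B"
    using g2 B U.kernel_nonneg[of "x - y"] by (intro mult_mono) auto
  then show "weight t x y \<le> (2 * K + 1) * B"
    using mult_nonneg_nonneg[OF K0 B0] by (simp add: weight_def algebra_simps)
  show "\<bar>weight_x t x y\<bar> \<le> (2 * K + 1) * B"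
    using * **[OF U.smooth_density_bounds[OF t, of x]] by (simp add: weight_x_def algebra_simps)
  show "\<bar>weight_y t x y\<bar> \<le> (2 * K + 1) * B"
    using * **[OF V.smooth_density_bounds[OF t, of y]] by (simp add: weight_y_def algebra_simps)
qed

lemma weight_outside:
  assumes "x \<notin> {y - e..y + e}"
  shows "weight t x y = 0" "weight_x t x y = 0" "weight_y t x y = 0"
proof -
  have "\<kappa> (x - y) = 0" "\<kappa>' (x - y) = 0"
    using assms U.width_pos by (auto intro!: U.kernel_outside U.kernel_deriv_outside)
  then show "weight t x y = 0" "weight_x t x y = 0" "weight_y t x y = 0"
    by (simp_all add: weight_def weight_x_def weight_y_def)
qed

text \<open>
  The doubled integral is exactly conserved for the formal solutions; only the mollification
  errors, measured by the oscillation, survive.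
\<close>

lemma cancellation:
  assumes t: "t \<in> {0..T}"
  shows "kflux f (u t x) (v t y) * (weight_x t x y + weight_y t x y)
      + \<bar>u t x - v t y\<bar> * (2 * max 0 (gap t x y) * (V.smooth_flux t y - U.smooth_flux t x) * \<kappa> (x - y))
    \<le> 4 * L * K * (U.oscillation t x * \<kappa> (x - y) + V.oscillation t y * \<kappa> (x - y))"
proof -
  define a b where "a = u t x" and "b = v t y"
  define p q where "p = U.smooth_density t x - a" and "q = V.smooth_density t y - b"
  define \<alpha> \<beta> where "\<alpha> = U.smooth_flux t x - f a" and "\<beta> = V.smooth_flux t y - f b"
  define O1 O2 where "O1 = U.oscillation t x" and "O2 = V.oscillation t y"
  define c where "c = 2 * max 0 (gap t x y) * \<kappa> (x - y)"
  have ab: "a \<in> {0..K}" "b \<in> {0..K}" using U.curve_range[OF t] V.curve_range[OF t] by (auto simp: a_def b_def)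
  have O: "\<bar>p\<bar> \<le> O1" "\<bar>q\<bar> \<le> O2" "\<bar>\<alpha>\<bar> \<le> L * O1" "\<bar>\<beta>\<bar> \<le> L * O2"
    unfolding p_def q_def \<alpha>_def \<beta>_def O1_def O2_def a_def b_def
    using U.smooth_density_error[OF t] V.smooth_density_error[OF t] U.smooth_flux_error[OF t] V.smooth_flux_error[OF t] by auto
  have c: "0 \<le> c" "c \<le> 2 * \<kappa> (x - y)"
    using gap_bounds[OF t, of x y] U.kernel_nonneg[of "x - y"] by (auto simp: c_def intro!: mult_left_le_one_le)
  have abK: "\<bar>a - b\<bar> \<le> K" using ab by auto
  have kf: "\<bar>kflux f a b\<bar> \<le> L * K"
  proof -
    have "\<bar>kflux f a b\<bar> \<le> L * \<bar>a - b\<bar>" by (rule kflux_bound[of "{0..K}"]) (use U.flux_lipschitz ab in blast)+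
    also have "\<dots> \<le> L * K" using abK U.lipschitz_nonneg by (rule mult_left_mono)
    finally show ?thesis .
  qed
  have LK: "0 \<le> L * K" using U.lipschitz_nonneg U.bound_nonneg[OF t] by simp
  \<comment> \<open>The two \<kappa>' terms cancel in the sum of the partial derivatives. Writing
    each mollified quantity as exact value plus error then isolates the part that
    \<open>kflux_mult_diff\<close> annihilates; \<open>p\<close>, \<open>q\<close>, \<alpha>,
    \<beta> are what remains.\<close>
  have "kflux f a b * (weight_x t x y + weight_y t x y)
      + \<bar>a - b\<bar> * (2 * max 0 (gap t x y) * (V.smooth_flux t y - U.smooth_flux t x) * \<kappa> (x - y))
      = c * (kflux f a b * (a - b) + kflux f a b * (p - q) - \<bar>a - b\<bar> * (f a - f b) - \<bar>a - b\<bar> * (\<alpha> - \<beta>))"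
    by (simp add: weight_x_def weight_y_def c_def p_def q_def \<alpha>_def \<beta>_def algebra_simps)
  also have "\<dots> = c * (kflux f a b * (p - q) - \<bar>a - b\<bar> * (\<alpha> - \<beta>))" by (simp add: kflux_mult_diff)
  also have "\<dots> \<le> c * (2 * (L * K) * (O1 + O2))"
  proof (rule mult_left_mono[OF _ c(1)])
    have "\<bar>kflux f a b * (p - q)\<bar> \<le> (L * K) * (O1 + O2)"
      unfolding abs_mult using kf O LK by (intro mult_mono) auto
    moreover have "\<bar>\<bar>a - b\<bar> * (\<alpha> - \<beta>)\<bar> \<le> K * (L * O1 + L * O2)"
      unfolding abs_mult using abK O U.bound_nonneg[OF t] by (intro mult_mono) auto
    ultimately show "kflux f a b * (p - q) - \<bar>a - b\<bar> * (\<alpha> - \<beta>) \<le> 2 * (L * K) * (O1 + O2)"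
      by (simp add: algebra_simps)
  qed
  also have "\<dots> \<le> (2 * \<kappa> (x - y)) * (2 * (L * K) * (O1 + O2))"
  proof (rule mult_right_mono[OF c(2)])
    have "0 \<le> O1 + O2" using O by linarith
    then show "0 \<le> 2 * (L * K) * (O1 + O2)" using LK by simp
  qed
  finally show ?thesis by (simp add: a_def b_def O1_def O2_def algebra_simps)
qed

section \<open>Increments of the doubled integral over one time step\<close>

lemma pair_integrable:
  assumes s: "s \<in> {0..T}" and t: "t \<in> {0..T}"
    and m: "(\<lambda>(x, y). c x y) \<in> borel_measurable (lborel \<Otimes>\<^sub>M lborel)"
    and c: "\<And>x y. \<bar>c x y\<bar> \<le> C" and out: "\<And>x y. x \<notin> {y - e..y + e} \<Longrightarrow> c x y = 0"
  shows "integrable (lborel \<Otimes>\<^sub>M lborel) (\<lambda>(x, y). \<bar>u s x - v t y\<bar> * c x y)"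
    "integrable (lborel \<Otimes>\<^sub>M lborel) (\<lambda>(x, y). kflux f (u s x) (v t y) * c x y)"
proof -
  note [measurable] = m U.curve_measurable[OF s] V.curve_measurable[OF t]
  have r: "u s x \<in> {0..K}" "v t y \<in> {0..K}" "\<bar>u s x - v t y\<bar> \<le> K" for x y
    using U.curve_range[OF s, of x] V.curve_range[OF t, of y] by auto
  have K0: "0 \<le> K" by (rule U.bound_nonneg[OF s])
  have z: "x \<notin> {y - e..y + e} \<or> u s x = v t y" if "(x, y) \<notin> {-(R + e)..R + e} \<times> {-(R + e)..R + e}" for x y
  proof (cases "x \<in> {y - e..y + e}")
    case True
    with that U.width_pos have "x \<notin> {-R..R}" "y \<notin> {-R..R}" by auto
    then show ?thesis by (simp add: U.curve_support[OF s] V.curve_support[OF t])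
  qed simp
  show "integrable (lborel \<Otimes>\<^sub>M lborel) (\<lambda>(x, y). \<bar>u s x - v t y\<bar> * c x y)"
  proof (rule integrable_bounded_support2[where a = "-(R+e)" and b = "R + e" and B = "K * C"])
    show "(\<lambda>(x, y). \<bar>u s x - v t y\<bar> * c x y) \<in> borel_measurable (lborel \<Otimes>\<^sub>M lborel)" by measurable
    show "\<bar>case p of (x, y) \<Rightarrow> \<bar>u s x - v t y\<bar> * c x y\<bar> \<le> K * C" for p
      using r(3) c K0 by (cases p) (auto simp: abs_mult intro!: mult_mono)
    show "(case p of (x, y) \<Rightarrow> \<bar>u s x - v t y\<bar> * c x y) = 0" if "p \<notin> {-(R + e)..R + e} \<times> {-(R + e)..R + e}" for p
      using z[of "fst p" "snd p"] out[of "fst p" "snd p"] that by (auto simp: case_prod_beta)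
  qed
  have kf: "\<bar>kflux f (u s x) (v t y)\<bar> \<le> L * K" for x y
  proof -
    have "\<bar>kflux f (u s x) (v t y)\<bar> \<le> L * \<bar>u s x - v t y\<bar>"
      by (rule kflux_bound[of "{0..K}"]) (use U.flux_lipschitz r in blast)+
    also have "\<dots> \<le> L * K" using r U.lipschitz_nonneg by (intro mult_left_mono)
    finally show ?thesis .
  qed
  show "integrable (lborel \<Otimes>\<^sub>M lborel) (\<lambda>(x, y). kflux f (u s x) (v t y) * c x y)"
  proof (rule integrable_bounded_support2[where a = "-(R+e)" and b = "R + e" and B = "(L * K) * C"])
    show "(\<lambda>(x, y). kflux f (u s x) (v t y) * c x y) \<in> borel_measurable (lborel \<Otimes>\<^sub>M lborel)" by measurable
    show "\<bar>case p of (x, y) \<Rightarrow> kflux f (u s x) (v t y) * c x y\<bar> \<le> (L * K) * C" for p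
      using kf c K0 U.lipschitz_nonneg by (cases p) (auto simp: abs_mult intro!: mult_mono)
    show "(case p of (x, y) \<Rightarrow> kflux f (u s x) (v t y) * c x y) = 0" if "p \<notin> {-(R + e)..R + e} \<times> {-(R + e)..R + e}" for p
      using z[of "fst p" "snd p"] out[of "fst p" "snd p"] that by (auto simp: case_prod_beta kflux_def)
  qed
qed

text \<open>The first curve advances while the second is already at its later time and the weight is
  still at its earlier one. The flux is nevertheless expressed through \<open>v s\<close>, so that
  it can cancel against the other contributions at time s. The drift of u costs \<mu> with factor
  \<open>2 * (R + e)\<close>, the exchange of \<open>v t\<close> for \<open>v s\<close> costs \<mu>
  with factor \<open>2 * e\<close>.\<close>

lemma first_curve_increment:
  assumes t: "0 \<le> s" "s < t" "t \<le> T"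
    and B: "\<And>x. \<kappa> x \<le> B" "\<And>x. \<bar>\<kappa>' x\<bar> \<le> B"
    and \<mu>: "\<And>\<tau>. s < \<tau> \<Longrightarrow> \<tau> \<le> t \<Longrightarrow> (LBINT x. \<bar>u \<tau> x - u s x\<bar>) \<le> \<mu>"
      "(LBINT x. \<bar>v t x - v s x\<bar>) \<le> \<mu>"
  shows "(\<integral>(x, y). \<bar>u t x - v t y\<bar> * weight s x y \<partial>(lborel \<Otimes>\<^sub>M lborel))
      - (\<integral>(x, y). \<bar>u s x - v t y\<bar> * weight s x y \<partial>(lborel \<Otimes>\<^sub>M lborel))
    \<le> (t - s) * ((\<integral>(x, y). kflux f (u s x) (v s y) * weight_x s x y \<partial>(lborel \<Otimes>\<^sub>M lborel))
        + L * ((2 * K + 1) * B) * (2 * (R + e) + 2 * e) * \<mu>)"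
proof -
  have tT: "s \<in> {0..T}" "t \<in> {0..T}" using t by auto
  have "(\<integral>(x, y). \<bar>u t x - v t y\<bar> * weight s x y \<partial>(lborel \<Otimes>\<^sub>M lborel))
      - (\<integral>(x, y). \<bar>u s x - v t y\<bar> * weight s x y \<partial>(lborel \<Otimes>\<^sub>M lborel))
    \<le> (t - s) * ((\<integral>(x, y). kflux f (u s x) (v s y) * weight_x s x y \<partial>(lborel \<Otimes>\<^sub>M lborel))
        + L * ((2 * K + 1) * B) * \<mu> * (2 * (R + e)) + L * ((2 * K + 1) * B) * (2 * e) * (LBINT y. \<bar>v t y - v s y\<bar>))"
    by (rule U.entropy_integrated[OF t U.width_pos V.curve_measurable[OF tT(2)] V.curve_range[OF tT(2)]
      V.curve_support[OF tT(2)] V.curve_measurable[OF tT(1)] V.curve_range[OF tT(1)] V.curve_support[OF tT(1)]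
      weight_deriv_x[OF tT(1)] weight_continuous(1)[OF tT(1)] weight_measurable(1,2)[OF tT(1)]
      weight_nonneg weight_bounds(1,2)[OF tT(1) B] weight_outside(1,2)])
      (use \<mu> in auto)
  also have "\<dots> \<le> (t - s) * ((\<integral>(x, y). kflux f (u s x) (v s y) * weight_x s x y \<partial>(lborel \<Otimes>\<^sub>M lborel))
        + L * ((2 * K + 1) * B) * \<mu> * (2 * (R + e)) + L * ((2 * K + 1) * B) * (2 * e) * \<mu>)"
  proof (intro mult_left_mono add_left_mono)
    show "0 \<le> L * ((2 * K + 1) * B) * (2 * e)"
      using U.lipschitz_nonneg U.bound_nonneg[OF tT(1)] B(2)[of 0] U.width_pos by auto
  qed (use \<mu> t in auto)
  finally show ?thesis by (simp add: algebra_simps)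
qed

text \<open>The coordinates are swapped so that v becomes the moving curve and u, held at time s,
  supplies the constants. Here k and k' coincide, so only the drift of v contributes an
  error.\<close>

lemma second_curve_increment:
  assumes t: "0 \<le> s" "s < t" "t \<le> T"
    and B: "\<And>x. \<kappa> x \<le> B" "\<And>x. \<bar>\<kappa>' x\<bar> \<le> B"
    and \<mu>: "\<And>\<tau>. s < \<tau> \<Longrightarrow> \<tau> \<le> t \<Longrightarrow> (LBINT x. \<bar>v \<tau> x - v s x\<bar>) \<le> \<mu>"
  shows "(\<integral>(x, y). \<bar>u s x - v t y\<bar> * weight s x y \<partial>(lborel \<Otimes>\<^sub>M lborel))
      - (\<integral>(x, y). \<bar>u s x - v s y\<bar> * weight s x y \<partial>(lborel \<Otimes>\<^sub>M lborel))
    \<le> (t - s) * ((\<integral>(x, y). kflux f (u s x) (v s y) * weight_y s x y \<partial>(lborel \<Otimes>\<^sub>M lborel))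
        + L * ((2 * K + 1) * B) * (2 * (R + e)) * \<mu>)"
proof -
  have tT: "s \<in> {0..T}" "t \<in> {0..T}" using t by auto
  note [measurable] = U.curve_measurable[OF tT(1)] V.curve_measurable[OF tT(1)] V.curve_measurable[OF tT(2)]
    weight_measurable[OF tT(1)] U.smooth_measurable[OF tT(1)] V.smooth_measurable[OF tT(1)]
  have m: "(\<lambda>(y, x). weight s x y) \<in> borel_measurable (lborel \<Otimes>\<^sub>M lborel)"
    "(\<lambda>(y, x). weight_y s x y) \<in> borel_measurable (lborel \<Otimes>\<^sub>M lborel)"
    unfolding weight_def weight_y_def gap_def by measurable
  have out: "weight s x y = 0" "weight_y s x y = 0" if "y \<notin> {x - e..x + e}" for x y
    using that by (auto intro!: weight_outside)
  have "(\<integral>(y, x). \<bar>v t y - u s x\<bar> * weight s x y \<partial>(lborel \<Otimes>\<^sub>M lborel))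
      - (\<integral>(y, x). \<bar>v s y - u s x\<bar> * weight s x y \<partial>(lborel \<Otimes>\<^sub>M lborel))
    \<le> (t - s) * ((\<integral>(y, x). kflux f (v s y) (u s x) * weight_y s x y \<partial>(lborel \<Otimes>\<^sub>M lborel))
        + L * ((2 * K + 1) * B) * \<mu> * (2 * (R + e)) + L * ((2 * K + 1) * B) * (2 * e) * (LBINT y. \<bar>u s y - u s y\<bar>))"
    by (rule V.entropy_integrated[OF t U.width_pos U.curve_measurable[OF tT(1)] U.curve_range[OF tT(1)]
      U.curve_support[OF tT(1)] U.curve_measurable[OF tT(1)] U.curve_range[OF tT(1)] U.curve_support[OF tT(1)]
      weight_deriv_y[OF tT(1)] weight_continuous(2)[OF tT(1)] m
      weight_nonneg weight_bounds(1,3)[OF tT(1) B] out])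
      (use \<mu> in auto)
  moreover have "(\<integral>(y, x). \<bar>v \<tau> y - u s x\<bar> * weight s x y \<partial>(lborel \<Otimes>\<^sub>M lborel))
      = (\<integral>(x, y). \<bar>u s x - v \<tau> y\<bar> * weight s x y \<partial>(lborel \<Otimes>\<^sub>M lborel))"
    if [measurable]: "v \<tau> \<in> borel_measurable borel" for \<tau>
    using lborel_pair.integral_product_swap[of "\<lambda>(x, y). \<bar>u s x - v \<tau> y\<bar> * weight s x y"]
    by (simp add: case_prod_beta abs_minus_commute)
  moreover have "(\<integral>(y, x). kflux f (v s y) (u s x) * weight_y s x y \<partial>(lborel \<Otimes>\<^sub>M lborel))
      = (\<integral>(x, y). kflux f (u s x) (v s y) * weight_y s x y \<partial>(lborel \<Otimes>\<^sub>M lborel))"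
    using lborel_pair.integral_product_swap[of "\<lambda>(x, y). kflux f (u s x) (v s y) * weight_y s x y"]
    by (simp add: case_prod_beta kflux_commute[of f "v s _"])
  ultimately show ?thesis using V.curve_measurable tT by (simp add: algebra_simps)
qed

text \<open>The chain rule for \<open>(max 0 gap)^2\<close> over a short step, the gap moving with
  speed \<open>smooth_flux\<close> of v minus \<open>smooth_flux\<close> of u. Both fluxes drift by
  at most \<open>B * L * \<mu>\<close>, which yields \<open>4 * B * L * \<mu>\<close> after
  multiplication by \<open>2 * max 0 gap \<le> 2\<close>. The squared bracket is a bound for the
  speed, made independent of \<mu> by \<open>\<mu> \<le> 1\<close>.\<close>

lemma weight_increment:
  assumes t: "0 \<le> s" "s < t" "t \<le> T"
    and B: "\<And>x. \<kappa> x \<le> B"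
    and \<mu>: "\<And>\<tau>. s < \<tau> \<Longrightarrow> \<tau> \<le> t \<Longrightarrow> (LBINT x. \<bar>u \<tau> x - u s x\<bar>) \<le> \<mu>"
      "\<And>\<tau>. s < \<tau> \<Longrightarrow> \<tau> \<le> t \<Longrightarrow> (LBINT x. \<bar>v \<tau> x - v s x\<bar>) \<le> \<mu>" "\<mu> \<le> 1"
  shows "weight t x y - weight s x y \<le> \<kappa> (x - y) * (t - s) *
    (2 * max 0 (gap s x y) * (V.smooth_flux s y - U.smooth_flux s x) + 4 * B * L * \<mu> + (2 * L * K + 2 * B * L)\<^sup>2 * (t - s))"
proof -
  have tT: "s \<in> {0..T}" "t \<in> {0..T}" using t by auto
  define h where "h = t - s"
  define \<alpha> \<beta> where "\<alpha> = U.smooth_flux s x" and "\<beta> = V.smooth_flux s y"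
  define w w' where "w = gap s x y" and "w' = gap t x y"
  have B0: "0 \<le> B" using U.kernel_nonneg[of 0] B[of 0] by linarith
  have BL: "0 \<le> B * L" using B0 U.lipschitz_nonneg by simp
  have \<mu>0: "0 \<le> \<mu>"
  proof -
    have "0 \<le> (LBINT x. \<bar>u t x - u s x\<bar>)" by (intro integral_nonneg_AE) auto
    also have "\<dots> \<le> \<mu>" using \<mu>(1)[of t] t by simp
    finally show ?thesis .
  qed
  have h: "0 < h" using t by (simp add: h_def)
  have "\<bar>U.smooth_cdf t x - U.smooth_cdf s x + \<alpha> * h\<bar> \<le> (B * L * \<mu>) * h"
    unfolding h_def \<alpha>_def
  proof (rule U.smooth_cdf_increment[OF t])
    fix \<tau> assume \<tau>: "s < \<tau>" "\<tau> < t"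
    then have "\<bar>U.smooth_flux \<tau> x - U.smooth_flux s x\<bar> \<le> B * L * (LBINT z. \<bar>u \<tau> z - u s z\<bar>)"
      using t by (intro U.smooth_flux_time_lipschitz B) auto
    also have "\<dots> \<le> B * L * \<mu>" using \<mu>(1)[of \<tau>] \<tau> BL by (intro mult_left_mono) auto
    finally show "\<bar>U.smooth_flux \<tau> x - U.smooth_flux s x\<bar> \<le> B * L * \<mu>" .
  qed
  moreover have "\<bar>V.smooth_cdf t y - V.smooth_cdf s y + \<beta> * h\<bar> \<le> (B * L * \<mu>) * h"
    unfolding h_def \<beta>_def
  proof (rule V.smooth_cdf_increment[OF t])
    fix \<tau> assume \<tau>: "s < \<tau>" "\<tau> < t"
    then have "\<bar>V.smooth_flux \<tau> y - V.smooth_flux s y\<bar> \<le> B * L * (LBINT z. \<bar>v \<tau> z - v s z\<bar>)"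
      using t by (intro V.smooth_flux_time_lipschitz B) auto
    also have "\<dots> \<le> B * L * \<mu>" using \<mu>(2)[of \<tau>] \<tau> BL by (intro mult_left_mono) auto
    finally show "\<bar>V.smooth_flux \<tau> y - V.smooth_flux s y\<bar> \<le> B * L * \<mu>" .
  qed
  ultimately have diff: "\<bar>(w' - w) - h * (\<beta> - \<alpha>)\<bar> \<le> 2 * (B * L * \<mu>) * h"
    by (auto simp: w_def w'_def gap_def abs_le_iff algebra_simps)
  have \<alpha>\<beta>: "\<bar>\<beta> - \<alpha>\<bar> \<le> 2 * (L * K)"
    using U.smooth_flux_bound[OF tT(1), of x] V.smooth_flux_bound[OF tT(1), of y] by (simp add: \<alpha>_def \<beta>_def)
  have "B * L * \<mu> \<le> B * L" using BL \<mu>(3) \<mu>0 by (simp add: mult_left_le)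
  then have "2 * (B * L * \<mu>) * h \<le> 2 * (B * L) * h" using h by (intro mult_right_mono) auto
  moreover have "\<bar>h * (\<beta> - \<alpha>)\<bar> \<le> h * (2 * (L * K))" unfolding abs_mult using \<alpha>\<beta> h by (intro mult_mono) auto
  ultimately have "\<bar>w' - w\<bar> \<le> h * (2 * L * K + 2 * B * L)" using diff by (simp add: algebra_simps)
  then have sq: "(w' - w)\<^sup>2 \<le> (h * (2 * L * K + 2 * B * L))\<^sup>2" by (rule power2_le_iff_abs_le[THEN iffD2, rotated]) (use h U.lipschitz_nonneg BL U.bound_nonneg[OF tT(1)] in auto)
  \<comment> \<open>The derivative \<open>2 * max 0 z\<close> of the squared positive part is
    Lipschitz with constant 2, so the remainder is at most the square of the increment, also when
    the sign of the gap changes.\<close>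
  have taylor: "(max 0 w')\<^sup>2 - (max 0 w)\<^sup>2 \<le> 2 * max 0 w * (w' - w) + (w' - w)\<^sup>2"
    using zero_le_power2[of "w' - w"] by (cases "0 \<le> w"; cases "0 \<le> w'") (auto simp: power2_eq_square algebra_simps mult_nonpos_nonpos intro: mult_mono')
  have "2 * max 0 w * (w' - w) \<le> 2 * max 0 w * (h * (\<beta> - \<alpha>) + 2 * (B * L * \<mu>) * h)"
    using diff by (intro mult_left_mono) auto
  also have "\<dots> \<le> 2 * max 0 w * (h * (\<beta> - \<alpha>)) + 2 * (2 * (B * L * \<mu>) * h)"
  proof -
    have "max 0 w * (2 * (B * L * \<mu>) * h) \<le> 1 * (2 * (B * L * \<mu>) * h)"
      using gap_bounds[OF tT(1), of x y] BL \<mu>0 h by (intro mult_right_mono) (auto simp: w_def)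
    then show ?thesis by (simp add: algebra_simps)
  qed
  finally have first: "2 * max 0 w * (w' - w) \<le> 2 * max 0 w * (h * (\<beta> - \<alpha>)) + 2 * (2 * (B * L * \<mu>) * h)" .
  define c where "c = (2 * L * K + 2 * B * L)\<^sup>2"
  have "(w' - w)\<^sup>2 \<le> h * (c * h)" using sq by (simp only: power_mult_distrib c_def) (simp add: power2_eq_square mult_ac)
  with first taylor have "(max 0 w')\<^sup>2 - (max 0 w)\<^sup>2 \<le> h * (2 * max 0 w * (\<beta> - \<alpha>) + 4 * B * L * \<mu> + c * h)"
    by (simp add: algebra_simps)
  from mult_left_mono[OF this U.kernel_nonneg[of "x - y"]] show ?thesis
    unfolding c_def[symmetric] by (simp add: weight_def w_def w'_def h_def \<alpha>_def \<beta>_def algebra_simps)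
qed

text \<open>The weight changes while both curves are already at time t. In the leading term
  \<open>\<bar>u t x - v t y\<bar>\<close> is exchanged for its value at time s, which costs
  \<open>4 * L * K\<close> for each curve's displacement; in the error terms it is bounded by
  \<open>u t x + v t y\<close>, of total mass 2 against the kernel.\<close>

lemma weight_increment_integrated:
  assumes t: "0 \<le> s" "s < t" "t \<le> T"
    and B: "\<And>x. \<kappa> x \<le> B" "\<And>x. \<bar>\<kappa>' x\<bar> \<le> B"
    and \<mu>: "\<And>\<tau>. s < \<tau> \<Longrightarrow> \<tau> \<le> t \<Longrightarrow> (LBINT x. \<bar>u \<tau> x - u s x\<bar>) \<le> \<mu>"
      "\<And>\<tau>. s < \<tau> \<Longrightarrow> \<tau> \<le> t \<Longrightarrow> (LBINT x. \<bar>v \<tau> x - v s x\<bar>) \<le> \<mu>" "\<mu> \<le> 1"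
  shows "(\<integral>(x, y). \<bar>u t x - v t y\<bar> * weight t x y \<partial>(lborel \<Otimes>\<^sub>M lborel))
      - (\<integral>(x, y). \<bar>u t x - v t y\<bar> * weight s x y \<partial>(lborel \<Otimes>\<^sub>M lborel))
    \<le> (t - s) * ((\<integral>(x, y). \<bar>u s x - v s y\<bar> *
          (2 * max 0 (gap s x y) * (V.smooth_flux s y - U.smooth_flux s x) * \<kappa> (x - y)) \<partial>(lborel \<Otimes>\<^sub>M lborel))
        + (8 * L * K + 8 * B * L) * \<mu> + 2 * (2 * L * K + 2 * B * L)\<^sup>2 * (t - s))"
proof -
  let ?P = "lborel \<Otimes>\<^sub>M lborel :: (real \<times> real) measure"
  have tT: "s \<in> {0..T}" "t \<in> {0..T}" using t by auto
  note [measurable] = U.curve_measurable[OF tT(1)] U.curve_measurable[OF tT(2)] V.curve_measurable[OF tT(1)] V.curve_measurable[OF tT(2)]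
    weight_measurable[OF tT(1)] U.smooth_measurable[OF tT(1)] V.smooth_measurable[OF tT(1)]
  define h where "h = t - s"
  have h: "0 < h" using t by (simp add: h_def)
  define \<rho> where "\<rho> x y = 2 * max 0 (gap s x y) * (V.smooth_flux s y - U.smooth_flux s x)" for x y
  define d where "d = 4 * B * L * \<mu> + (2 * L * K + 2 * B * L)\<^sup>2 * h"
  have B0: "0 \<le> B" using U.kernel_nonneg[of 0] B(1)[of 0] by linarith
  have \<mu>0: "0 \<le> \<mu>"
  proof -
    have "0 \<le> (LBINT x. \<bar>u t x - u s x\<bar>)" by (intro integral_nonneg_AE) auto
    also have "\<dots> \<le> \<mu>" using \<mu>(1)[of t] t by simp
    finally show ?thesis .
  qed
  have d0: "0 \<le> d" using B0 \<mu>0 h U.lipschitz_nonneg by (simp add: d_def)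
  have LK: "0 \<le> L * K" using U.lipschitz_nonneg U.bound_nonneg[OF tT(1)] by simp
  have \<rho>: "\<bar>\<rho> x y\<bar> \<le> 4 * (L * K)" for x y
  proof -
    have "\<bar>V.smooth_flux s y - U.smooth_flux s x\<bar> \<le> 2 * (L * K)"
      using U.smooth_flux_bound[OF tT(1), of x] V.smooth_flux_bound[OF tT(1), of y] by simp
    then have "\<bar>\<rho> x y\<bar> \<le> (2 * 1) * (2 * (L * K))"
      unfolding \<rho>_def abs_mult using gap_bounds[OF tT(1), of x y] by (intro mult_mono) auto
    then show ?thesis by simp
  qed
  have iJ: "integrable ?P (\<lambda>(x, y). \<bar>u s x - v s y\<bar> * (\<rho> x y * \<kappa> (x - y)))"
  proof (rule pair_integrable(1)[OF tT(1) tT(1)])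
    show "(\<lambda>(x, y). \<rho> x y * \<kappa> (x - y)) \<in> borel_measurable ?P" unfolding \<rho>_def gap_def by measurable
    show "\<bar>\<rho> x y * \<kappa> (x - y)\<bar> \<le> 4 * (L * K) * B" for x y
      unfolding abs_mult using \<rho> B(1)[of "x - y"] U.kernel_nonneg[of "x - y"] LK by (intro mult_mono) auto
    show "\<rho> x y * \<kappa> (x - y) = 0" if "x \<notin> {y - e..y + e}" for x y
      using that U.width_pos by (auto intro!: U.kernel_outside)
  qed
  have iu: "integrable lborel (\<lambda>x. \<bar>u t x - u s x\<bar>)" "integrable lborel (u t)"
    using U.curve_integrable[OF tT(1)] U.curve_integrable[OF tT(2)] by auto
  have iv: "integrable lborel (\<lambda>x. \<bar>v t x - v s x\<bar>)" "integrable lborel (v t)"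
    using V.curve_integrable[OF tT(1)] V.curve_integrable[OF tT(2)] by auto
  note ku = U.integral_times_kernel[OF iu(1)] U.integral_times_kernel[OF iu(2)]
  note kv = U.integral_times_kernel[OF iv(1)] U.integral_times_kernel[OF iv(2)]
  have i\<psi>: "integrable ?P (\<lambda>(x, y). \<bar>u t x - v t y\<bar> * weight \<tau> x y)" if "\<tau> \<in> {0..T}" for \<tau>
    by (rule pair_integrable(1)[OF tT(2) tT(2) weight_measurable(1)[OF that], where C = "(2 * K + 1) * B"])
      (use weight_bounds(1)[OF that B] weight_nonneg weight_outside in auto)
  \<comment> \<open>A pointwise majorant: the leading term at time s, the exchange errors of u and
    v, and the remainder \<open>d\<close> of the weight. Apart from the first, each summand depends
    on one variable times the kernel and is integrated by
    \<open>integral_times_kernel\<close>.\<close>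
  let ?g = "\<lambda>(x, y). h * (\<bar>u s x - v s y\<bar> * (\<rho> x y * \<kappa> (x - y)))
      + (h * (4 * (L * K))) * (\<bar>u t x - u s x\<bar> * \<kappa> (x - y)) + (h * (4 * (L * K))) * (\<bar>v t y - v s y\<bar> * \<kappa> (x - y))
      + (h * d) * (u t x * \<kappa> (x - y)) + (h * d) * (v t y * \<kappa> (x - y))"
  have ig: "integrable ?P ?g"
    using iJ ku(1,5) kv(3,7) unfolding split_beta'
    by (intro Bochner_Integration.integrable_add integrable_mult_right)
  have "(\<integral>(x, y). \<bar>u t x - v t y\<bar> * weight t x y \<partial>?P) - (\<integral>(x, y). \<bar>u t x - v t y\<bar> * weight s x y \<partial>?P)
    = (\<integral>p. (case p of (x, y) \<Rightarrow> \<bar>u t x - v t y\<bar> * weight t x y) - (case p of (x, y) \<Rightarrow> \<bar>u t x - v t y\<bar> * weight s x y) \<partial>?P)"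
    by (rule Bochner_Integration.integral_diff[OF i\<psi>[OF tT(2)] i\<psi>[OF tT(1)], symmetric])
  also have "\<dots> \<le> integral\<^sup>L ?P ?g"
  proof (rule integral_mono[OF _ ig])
    show "integrable ?P (\<lambda>p. (case p of (x, y) \<Rightarrow> \<bar>u t x - v t y\<bar> * weight t x y) - (case p of (x, y) \<Rightarrow> \<bar>u t x - v t y\<bar> * weight s x y))"
      by (rule Bochner_Integration.integrable_diff[OF i\<psi>[OF tT(2)] i\<psi>[OF tT(1)]])
    fix p :: "real \<times> real"
    obtain x y where p: "p = (x, y)" by fastforce
    define \<delta> where "\<delta> = \<bar>u t x - v t y\<bar>"
    define k where "k = \<kappa> (x - y)"
    have k0: "0 \<le> k" by (simp add: k_def U.kernel_nonneg)
    have "\<delta> * (weight t x y - weight s x y) \<le> \<delta> * (k * h * (\<rho> x y + d))"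
      using weight_increment[OF t B(1) \<mu>, of x y] by (intro mult_left_mono) (auto simp: \<delta>_def k_def h_def \<rho>_def d_def add.assoc)
    also have "\<dots> = (k * h) * (\<delta> * \<rho> x y + \<delta> * d)" by (simp add: algebra_simps)
    also have "\<dots> \<le> (k * h) * ((\<bar>u s x - v s y\<bar> * \<rho> x y + (\<bar>u t x - u s x\<bar> + \<bar>v t y - v s y\<bar>) * (4 * (L * K))) + (u t x + v t y) * d)"
    proof (intro mult_left_mono add_mono)
      have "(\<delta> - \<bar>u s x - v s y\<bar>) * \<rho> x y \<le> \<bar>\<delta> - \<bar>u s x - v s y\<bar>\<bar> * \<bar>\<rho> x y\<bar>" by (metis abs_ge_self abs_mult)
      also have "\<dots> \<le> (\<bar>u t x - u s x\<bar> + \<bar>v t y - v s y\<bar>) * (4 * (L * K))"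
        using \<rho> by (intro mult_mono) (auto simp: \<delta>_def)
      finally show "\<delta> * \<rho> x y \<le> \<bar>u s x - v s y\<bar> * \<rho> x y + (\<bar>u t x - u s x\<bar> + \<bar>v t y - v s y\<bar>) * (4 * (L * K))"
        by (simp add: algebra_simps)
      show "\<delta> * d \<le> (u t x + v t y) * d"
        using U.curve_range[OF tT(2), of x] V.curve_range[OF tT(2), of y] d0 by (intro mult_right_mono) (auto simp: \<delta>_def)
    qed (use k0 h in auto)
    finally show "(case p of (x, y) \<Rightarrow> \<bar>u t x - v t y\<bar> * weight t x y) - (case p of (x, y) \<Rightarrow> \<bar>u t x - v t y\<bar> * weight s x y) \<le> ?g p"
      by (simp add: p \<delta>_def k_def algebra_simps)
  qed
  also have "\<dots> = h * (\<integral>(x, y). \<bar>u s x - v s y\<bar> * (\<rho> x y * \<kappa> (x - y)) \<partial>?P)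
      + h * (4 * (L * K)) * (LBINT x. \<bar>u t x - u s x\<bar>) + h * (4 * (L * K)) * (LBINT x. \<bar>v t x - v s x\<bar>)
      + h * d * 1 + h * d * 1"
    using iJ ku(1,2,5,6) kv(3,4,7,8) U.curve_mass[OF tT(2)] V.curve_mass[OF tT(2)]
    unfolding split_beta' by simp
  also have "\<dots> \<le> h * (\<integral>(x, y). \<bar>u s x - v s y\<bar> * (\<rho> x y * \<kappa> (x - y)) \<partial>?P)
      + h * (4 * (L * K)) * \<mu> + h * (4 * (L * K)) * \<mu> + h * d * 1 + h * d * 1"
    using \<mu>(1,2)[of t] t h LK by (intro add_mono mult_left_mono order_refl) auto
  finally show ?thesis by (simp add: h_def d_def \<rho>_def algebra_simps)
qed

end

section \<open>Sharp distribution functions and mollification errors\<close>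

definition (in kruzhkov_curve) cdf :: "real \<Rightarrow> real \<Rightarrow> real" where
  "cdf t x = (LBINT z. u t z * indicator {..x} z)"

context kruzhkov_curve begin

lemma cdf_integrable:
  assumes "t \<in> {0..T}" shows "integrable lborel (\<lambda>z. u t z * indicator {..x} z)"
  using integrable_mult_indicator[OF _ curve_integrable[OF assms], of "{..x}"] by (simp add: mult.commute)

lemma cdf_mono: assumes "t \<in> {0..T}" "x \<le> y" shows "cdf t x \<le> cdf t y"
  unfolding cdf_def using curve_range[OF assms(1)] assms(2)
  by (intro integral_mono cdf_integrable assms) (auto simp: indicator_def)

lemma cdf_lipschitz: assumes t: "t \<in> {0..T}" and "x \<le> y" shows "cdf t y - cdf t x \<le> K * (y - x)"
proof -
  have "cdf t y - cdf t x = (LBINT z. u t z * indicator {..y} z - u t z * indicator {..x} z)"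
    unfolding cdf_def using cdf_integrable[OF t] by simp
  also have "\<dots> \<le> (LBINT z. K * indicator {x..y} z)"
  proof (rule integral_mono)
    show "integrable lborel (\<lambda>z. K * indicator {x..y} z :: real)"
      by (auto intro!: integrable_real_indicator simp: emeasure_lborel_Icc_eq)
  qed (use cdf_integrable[OF t] curve_range[OF t] bound_nonneg[OF t] in \<open>auto simp: indicator_def\<close>)
  also have "\<dots> = K * (y - x)" using assms(2) by (simp add: measure_def emeasure_lborel_Icc_eq)
  finally show ?thesis .
qed

end

context mollified_curve begin

text \<open>The step and the indicator function differ only on the window \<open>[x - e, x]\<close>,
  and there u is at most K.\<close>

lemma smooth_cdf_error:
  assumes t: "t \<in> {0..T}" shows "\<bar>smooth_cdf t x - cdf t x\<bar> \<le> K * e"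
proof -
  have d: "smooth_cdf t x - cdf t x = (LBINT z. u t z * \<eta> (x - z) - u t z * indicator {..x} z)"
    unfolding cdf_def smooth_cdf_def using cdf_integrable[OF t] smooth_integrable[OF t] by simp
  have "\<bar>smooth_cdf t x - cdf t x\<bar> \<le> (LBINT z. \<bar>u t z * \<eta> (x - z) - u t z * indicator {..x} z\<bar>)"
    unfolding d by (rule integral_abs_bound)
  also have "\<dots> \<le> (LBINT z. K * indicator {x - e..x} z)"
  proof (rule integral_mono)
    show "integrable lborel (\<lambda>z. \<bar>u t z * \<eta> (x - z) - u t z * indicator {..x} z\<bar>)"
      using cdf_integrable[OF t] smooth_integrable[OF t] by simp
    show "integrable lborel (\<lambda>z. K * indicator {x - e..x} z :: real)"
      by (auto intro!: integrable_real_indicator simp: emeasure_lborel_Icc_eq)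
    fix z
    consider "z < x - e" | "z \<in> {x - e..x}" | "z > x" by fastforce
    then show "\<bar>u t z * \<eta> (x - z) - u t z * indicator {..x} z\<bar> \<le> K * indicator {x - e..x} z"
    proof cases
      case 2
      have "\<bar>u t z * \<eta> (x - z) - u t z\<bar> = u t z * (1 - \<eta> (x - z))"
        using curve_range[OF t, of z] step_le_1[of "x - z"] mult_left_le[of "\<eta> (x - z)" "u t z"]
        by (simp add: algebra_simps)
      also have "\<dots> \<le> K * 1"
        using curve_range[OF t, of z] step_le_1[of "x - z"] step_nonneg[of "x - z"] by (intro mult_mono) auto
      finally show ?thesis using 2 by simp
    qed (use width_pos in \<open>auto simp: step_left step_right\<close>)
  qed
  also have "\<dots> = K * e" using width_pos by (simp add: measure_def emeasure_lborel_Icc_eq)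
  finally show ?thesis .
qed

lemma oscillation_double_integral:
  assumes t: "t \<in> {0..T}" and i: "integrable lborel (oscillation t)"
  shows "integrable (lborel \<Otimes>\<^sub>M lborel) (\<lambda>(x, y). \<bar>u t y - u t x\<bar> * \<kappa> (x - y))"
    "(\<integral>(x, y). \<bar>u t y - u t x\<bar> * \<kappa> (x - y) \<partial>(lborel \<Otimes>\<^sub>M lborel)) = (LBINT x. oscillation t x)"
proof -
  note [measurable] = curve_measurable[OF t]
  show 1: "integrable (lborel \<Otimes>\<^sub>M lborel) (\<lambda>(x, y). \<bar>u t y - u t x\<bar> * \<kappa> (x - y))"
  proof (rule lborel_pair.Fubini_integrable)
    show "integrable lborel (\<lambda>x. LBINT y. norm (case (x, y) of (x, y) \<Rightarrow> \<bar>u t y - u t x\<bar> * \<kappa> (x - y)))"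
      using i by (simp add: oscillation_def[abs_def] abs_mult kernel_nonneg)
  qed (use oscillation_integrable[OF t] in auto)
  show "(\<integral>(x, y). \<bar>u t y - u t x\<bar> * \<kappa> (x - y) \<partial>(lborel \<Otimes>\<^sub>M lborel)) = (LBINT x. oscillation t x)"
    using lborel_pair.integral_fst'[OF 1] by (simp add: oscillation_def)
qed

lemma smooth_cdf_mono: "t \<in> {0..T} \<Longrightarrow> x \<le> y \<Longrightarrow> smooth_cdf t x \<le> smooth_cdf t y"
  using DERIV_nonneg_imp_nondecreasing[of x y "smooth_cdf t"] smooth_cdf_deriv smooth_density_bounds by blast

lemma smooth_cdf_left: assumes "t \<in> {0..T}" "x \<le> - R" shows "smooth_cdf t x = 0"
  unfolding smooth_cdf_def
proof (intro integral_eq_zero_AE AE_I2)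
  fix z show "u t z * \<eta> (x - z) = 0"
    using curve_support[OF assms(1), of z] step_left[of "x - z"] assms(2) by (cases "z \<in> {-R..R}") auto
qed

end

section \<open>Evolution, initial size and terminal size of the doubled integral\<close>

context curve_pair begin

text \<open>The step is split into three moves: first v, then u, then the weight. The leading terms
  of the three are all taken at time s and add up to the integrand of \<open>cancellation\<close>,
  which leaves \<open>4 * L * K\<close> times the total oscillation of each curve. Everything else
  carries a factor \<mu> or an additional \<open>t - s\<close>.\<close>

lemma doubled_increment:
  assumes t: "0 \<le> s" "s < t" "t \<le> T"
    and B: "\<And>x. \<kappa> x \<le> B" "\<And>x. \<bar>\<kappa>' x\<bar> \<le> B"
    and \<mu>: "\<And>\<tau>. s < \<tau> \<Longrightarrow> \<tau> \<le> t \<Longrightarrow> (LBINT x. \<bar>u \<tau> x - u s x\<bar>) \<le> \<mu>"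
      "\<And>\<tau>. s < \<tau> \<Longrightarrow> \<tau> \<le> t \<Longrightarrow> (LBINT x. \<bar>v \<tau> x - v s x\<bar>) \<le> \<mu>" "\<mu> \<le> 1"
    and \<omega>: "\<And>w. 0 < w \<Longrightarrow> w < e \<Longrightarrow> (LBINT x. \<bar>u s (x - w) - u s x\<bar>) \<le> \<omega>"
      "\<And>w. 0 < w \<Longrightarrow> w < e \<Longrightarrow> (LBINT x. \<bar>v s (x - w) - v s x\<bar>) \<le> \<omega>"
  shows "doubled t - doubled s \<le> (t - s) * (8 * L * K * \<omega>
      + (L * ((2 * K + 1) * B) * (4 * (R + e) + 2 * e) + 8 * L * K + 8 * B * L) * \<mu>
      + 2 * (2 * L * K + 2 * B * L)\<^sup>2 * (t - s))"
proof -
  let ?P = "lborel \<Otimes>\<^sub>M lborel :: (real \<times> real) measure"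
  have tT: "s \<in> {0..T}" "t \<in> {0..T}" using t by auto
  note [measurable] = U.smooth_measurable[OF tT(1)] V.smooth_measurable[OF tT(1)]
  have B0: "0 \<le> B" using U.kernel_nonneg[of 0] B(1)[of 0] by linarith
  have LK: "0 \<le> L * K" using U.lipschitz_nonneg U.bound_nonneg[OF tT(1)] by simp
  define Jx where "Jx = (\<integral>(x, y). kflux f (u s x) (v s y) * weight_x s x y \<partial>?P)"
  define Jy where "Jy = (\<integral>(x, y). kflux f (u s x) (v s y) * weight_y s x y \<partial>?P)"
  define Jt where "Jt = (\<integral>(x, y). \<bar>u s x - v s y\<bar> *
          (2 * max 0 (gap s x y) * (V.smooth_flux s y - U.smooth_flux s x) * \<kappa> (x - y)) \<partial>?P)"
  note oU = U.oscillation_integral[OF tT(1) \<omega>(1)] and oV = V.oscillation_integral[OF tT(1) \<omega>(2)]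
  note kU = U.integral_times_kernel(1,2)[OF oU(1)] and kV = U.integral_times_kernel(3,4)[OF oV(1)]
  have ix: "integrable ?P (\<lambda>(x, y). kflux f (u s x) (v s y) * weight_x s x y)"
    by (rule pair_integrable(2)[OF tT(1) tT(1) weight_measurable(2)[OF tT(1)] weight_bounds(2)[OF tT(1) B] weight_outside(2)])
  have iy: "integrable ?P (\<lambda>(x, y). kflux f (u s x) (v s y) * weight_y s x y)"
    by (rule pair_integrable(2)[OF tT(1) tT(1) weight_measurable(3)[OF tT(1)] weight_bounds(3)[OF tT(1) B] weight_outside(3)])
  have it: "integrable ?P (\<lambda>(x, y). \<bar>u s x - v s y\<bar> *
          (2 * max 0 (gap s x y) * (V.smooth_flux s y - U.smooth_flux s x) * \<kappa> (x - y)))"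
  proof (rule pair_integrable(1)[OF tT(1) tT(1)])
    show "(\<lambda>(x, y). 2 * max 0 (gap s x y) * (V.smooth_flux s y - U.smooth_flux s x) * \<kappa> (x - y)) \<in> borel_measurable ?P"
      unfolding gap_def by measurable
    show "\<bar>2 * max 0 (gap s x y) * (V.smooth_flux s y - U.smooth_flux s x) * \<kappa> (x - y)\<bar> \<le> (2 * 1) * (2 * (L * K)) * B" for x y
    proof -
      have "\<bar>V.smooth_flux s y - U.smooth_flux s x\<bar> \<le> 2 * (L * K)"
        using U.smooth_flux_bound[OF tT(1), of x] V.smooth_flux_bound[OF tT(1), of y] by simp
      then show ?thesis
        unfolding abs_mult using gap_bounds[OF tT(1), of x y] B(1)[of "x - y"] U.kernel_nonneg[of "x - y"] LK
        by (intro mult_mono) auto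
    qed
    show "2 * max 0 (gap s x y) * (V.smooth_flux s y - U.smooth_flux s x) * \<kappa> (x - y) = 0" if "x \<notin> {y - e..y + e}" for x y
      using that U.width_pos by (auto intro!: U.kernel_outside)
  qed
  have "Jx + Jy + Jt = (\<integral>p. (case p of (x, y) \<Rightarrow> kflux f (u s x) (v s y) * weight_x s x y)
      + (case p of (x, y) \<Rightarrow> kflux f (u s x) (v s y) * weight_y s x y)
      + (case p of (x, y) \<Rightarrow> \<bar>u s x - v s y\<bar> *
          (2 * max 0 (gap s x y) * (V.smooth_flux s y - U.smooth_flux s x) * \<kappa> (x - y))) \<partial>?P)"
    unfolding Jx_def Jy_def Jt_def
    using Bochner_Integration.integral_add[OF Bochner_Integration.integrable_add[OF ix iy] it]
      Bochner_Integration.integral_add[OF ix iy] by linarith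
  also have "\<dots> \<le> (\<integral>p. 4 * L * K * ((case p of (x, y) \<Rightarrow> U.oscillation s x * \<kappa> (x - y))
      + (case p of (x, y) \<Rightarrow> V.oscillation s y * \<kappa> (x - y))) \<partial>?P)"
  proof (rule integral_mono)
    fix p :: "real \<times> real"
    show "(case p of (x, y) \<Rightarrow> kflux f (u s x) (v s y) * weight_x s x y)
      + (case p of (x, y) \<Rightarrow> kflux f (u s x) (v s y) * weight_y s x y)
      + (case p of (x, y) \<Rightarrow> \<bar>u s x - v s y\<bar> *
          (2 * max 0 (gap s x y) * (V.smooth_flux s y - U.smooth_flux s x) * \<kappa> (x - y)))
      \<le> 4 * L * K * ((case p of (x, y) \<Rightarrow> U.oscillation s x * \<kappa> (x - y))
      + (case p of (x, y) \<Rightarrow> V.oscillation s y * \<kappa> (x - y)))"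
      using cancellation[OF tT(1), of "fst p" "snd p"] by (simp add: case_prod_beta distrib_left)
  qed (intro Bochner_Integration.integrable_add integrable_mult_right ix iy it kU kV)+
  also have "\<dots> = 4 * L * K * ((LBINT x. U.oscillation s x) + (LBINT x. V.oscillation s x))"
    using Bochner_Integration.integral_add[OF kU(1) kV(1)] kU(2) kV(2) by simp
  also have "\<dots> \<le> 4 * L * K * (\<omega> + \<omega>)"
    using oU(2) oV(2) LK by (intro mult_left_mono add_mono) (auto simp: mult.commute)
  finally have J: "Jx + Jy + Jt \<le> 8 * L * K * \<omega>" by (simp add: algebra_simps)
  have "doubled t - doubled s \<le> (t - s) * (Jt + (8 * L * K + 8 * B * L) * \<mu> + 2 * (2 * L * K + 2 * B * L)\<^sup>2 * (t - s))
     + (t - s) * (Jx + L * ((2 * K + 1) * B) * (2 * (R + e) + 2 * e) * \<mu>)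
     + (t - s) * (Jy + L * ((2 * K + 1) * B) * (2 * (R + e)) * \<mu>)"
    using weight_increment_integrated[OF t B \<mu>] first_curve_increment[OF t B \<mu>(1) \<mu>(2)[of t]]
      second_curve_increment[OF t B \<mu>(2)] t(2)
    unfolding doubled_def Jx_def[symmetric] Jy_def[symmetric] Jt_def[symmetric] by linarith
  also have "\<dots> = (t - s) * ((Jx + Jy + Jt) + (L * ((2 * K + 1) * B) * (4 * (R + e) + 2 * e) + 8 * L * K + 8 * B * L) * \<mu>
      + 2 * (2 * L * K + 2 * B * L)\<^sup>2 * (t - s))"
    by (simp add: distrib_left distrib_right)
  also have "\<dots> \<le> (t - s) * (8 * L * K * \<omega> + (L * ((2 * K + 1) * B) * (4 * (R + e) + 2 * e) + 8 * L * K + 8 * B * L) * \<mu>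
      + 2 * (2 * L * K + 2 * B * L)\<^sup>2 * (t - s))"
    using J t by (intro mult_left_mono add_right_mono) auto
  finally show ?thesis .
qed

text \<open>B is fixed together with the kernel, before the time step is chosen. So \<mu> can be
  taken so small that \<open>C\<^sub>1 * \<mu> \<le> \<epsilon> / 2\<close>, and the step so short
  that \<mu> bounds the displacements and \<open>C\<^sub>2 * (t - s) \<le> \<epsilon> / 2\<close>.
  After summation only the translation error \<omega> is left.\<close>

lemma doubled_bound:
  assumes "0 < T"
    and \<omega>: "\<And>t w. t \<in> {0..T} \<Longrightarrow> 0 < w \<Longrightarrow> w < e \<Longrightarrow> (LBINT x. \<bar>u t (x - w) - u t x\<bar>) \<le> \<omega>"
      "\<And>t w. t \<in> {0..T} \<Longrightarrow> 0 < w \<Longrightarrow> w < e \<Longrightarrow> (LBINT x. \<bar>v t (x - w) - v t x\<bar>) \<le> \<omega>"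
  shows "doubled T - doubled 0 \<le> T * (8 * L * K * \<omega>)"
proof (rule increment_bound[OF \<open>0 < T\<close>])
  fix \<epsilon> :: real assume "0 < \<epsilon>"
  obtain B where B: "\<And>x. \<kappa> x \<le> B" "\<And>x. \<bar>\<kappa>' x\<bar> \<le> B" using U.kernel_bounds by metis
  define C\<^sub>1 where "C\<^sub>1 = L * ((2 * K + 1) * B) * (4 * (R + e) + 2 * e) + 8 * L * K + 8 * B * L"
  define C\<^sub>2 where "C\<^sub>2 = 2 * (2 * L * K + 2 * B * L)\<^sup>2"
  define \<mu> where "\<mu> = min 1 (\<epsilon> / (2 * (\<bar>C\<^sub>1\<bar> + 1)))"
  have \<mu>: "0 < \<mu>" "\<mu> \<le> 1" using \<open>0 < \<epsilon>\<close> by (auto simp: \<mu>_def)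
  have "C\<^sub>1 * \<mu> \<le> (\<bar>C\<^sub>1\<bar> + 1) * (\<epsilon> / (2 * (\<bar>C\<^sub>1\<bar> + 1)))"
    using \<mu>(1) by (intro mult_mono) (auto simp: \<mu>_def)
  also have "(\<bar>C\<^sub>1\<bar> + 1) * (\<epsilon> / (2 * (\<bar>C\<^sub>1\<bar> + 1))) = \<epsilon> / 2" by (simp add: field_simps add_nonneg_eq_0_iff)
  finally have C1: "C\<^sub>1 * \<mu> \<le> \<epsilon> / 2" .
  obtain h1 where h1: "0 < h1" "\<And>s t. s \<in> {0..T} \<Longrightarrow> t \<in> {0..T} \<Longrightarrow> \<bar>s - t\<bar> < h1 \<Longrightarrow> (LBINT x. \<bar>u s x - u t x\<bar>) < \<mu>"
    using U.curve_uniform[OF \<mu>(1)] by blast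
  obtain h2 where h2: "0 < h2" "\<And>s t. s \<in> {0..T} \<Longrightarrow> t \<in> {0..T} \<Longrightarrow> \<bar>s - t\<bar> < h2 \<Longrightarrow> (LBINT x. \<bar>v s x - v t x\<bar>) < \<mu>"
    using V.curve_uniform[OF \<mu>(1)] by blast
  define h where "h = min (min h1 h2) (\<epsilon> / (2 * (C\<^sub>2 + 1)))"
  have C20: "0 \<le> C\<^sub>2" by (simp add: C\<^sub>2_def)
  show "\<exists>h>0. \<forall>s t. 0 \<le> s \<longrightarrow> s < t \<longrightarrow> t \<le> T \<longrightarrow> t - s < h \<longrightarrow> doubled t - doubled s \<le> (t - s) * (8 * L * K * \<omega> + \<epsilon>)"
  proof (intro exI[of _ h] conjI allI impI)
    show "0 < h" using h1 h2 \<open>0 < \<epsilon>\<close> C20 by (auto simp: h_def)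
    fix s t assume t: "0 \<le> s" "s < t" "t \<le> T" "t - s < h"
    have mu1: "(LBINT x. \<bar>u \<tau> x - u s x\<bar>) \<le> \<mu>" if "s < \<tau>" "\<tau> \<le> t" for \<tau>
      using h1(2)[of \<tau> s] that t by (auto simp: h_def)
    have mu2: "(LBINT x. \<bar>v \<tau> x - v s x\<bar>) \<le> \<mu>" if "s < \<tau>" "\<tau> \<le> t" for \<tau>
      using h2(2)[of \<tau> s] that t by (auto simp: h_def)
    have "doubled t - doubled s \<le> (t - s) * (8 * L * K * \<omega> + C\<^sub>1 * \<mu> + C\<^sub>2 * (t - s))"
      unfolding C\<^sub>1_def C\<^sub>2_def
      by (rule doubled_increment[OF t(1-3) B mu1 mu2 \<mu>(2)]) (use \<omega> t in auto)
    also have "\<dots> \<le> (t - s) * (8 * L * K * \<omega> + \<epsilon>)"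
    proof (rule mult_left_mono)
      have "C\<^sub>2 * (t - s) \<le> (C\<^sub>2 + 1) * (\<epsilon> / (2 * (C\<^sub>2 + 1)))"
        using C20 t by (intro mult_mono) (auto simp: h_def)
      also have "(C\<^sub>2 + 1) * (\<epsilon> / (2 * (C\<^sub>2 + 1))) = \<epsilon> / 2" using C20 by (simp add: field_simps add_nonneg_eq_0_iff)
      finally have "C\<^sub>2 * (t - s) \<le> \<epsilon> / 2" .
      with C1 show "8 * L * K * \<omega> + C\<^sub>1 * \<mu> + C\<^sub>2 * (t - s) \<le> 8 * L * K * \<omega> + \<epsilon>" by simp
    qed (use t in simp)
    finally show "doubled t - doubled s \<le> (t - s) * (8 * L * K * \<omega> + \<epsilon>)" .
  qed
qed

text \<open>Where the kernel lives, the gap is at most \<open>3 * K * e\<close>: two mollification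
  errors \<open>K * e\<close>, and the growth of V between y and x, again at most
  \<open>K * e\<close> by its Lipschitz bound. The weight squares this, and
  \<open>\<bar>u - v\<bar> \<le> u + v\<close> has mass 2 against the kernel, whence
  \<open>18 = 2 * 9\<close>.\<close>

lemma doubled_initial:
  assumes "0 \<le> T" and le: "\<And>x. U.cdf 0 x \<le> V.cdf 0 x"
  shows "doubled 0 \<le> 18 * K\<^sup>2 * e\<^sup>2"
proof -
  let ?P = "lborel \<Otimes>\<^sub>M lborel :: (real \<times> real) measure"
  have t: "0 \<in> {0..T}" using assms by simp
  have K0: "0 \<le> K" by (rule U.bound_nonneg[OF t])
  obtain B where B: "\<And>x. \<kappa> x \<le> B" "\<And>x. \<bar>\<kappa>' x\<bar> \<le> B" using U.kernel_bounds by metis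
  note ku = U.integral_times_kernel(1,2)[OF U.curve_integrable[OF t]]
    and kv = U.integral_times_kernel(3,4)[OF V.curve_integrable[OF t]]
  have w: "weight 0 x y \<le> (3 * K * e)\<^sup>2 * \<kappa> (x - y)" for x y
  proof (cases "x - y \<in> {0<..<e}")
    case True
    have "gap 0 x y \<le> U.cdf 0 x - V.cdf 0 y + 2 * (K * e)"
      using U.smooth_cdf_error[OF t, of x] V.smooth_cdf_error[OF t, of y] by (simp add: gap_def abs_le_iff)
    also have "U.cdf 0 x - V.cdf 0 y \<le> V.cdf 0 x - V.cdf 0 y" using le by simp
    also have "V.cdf 0 x - V.cdf 0 y \<le> K * (x - y)" using True by (intro V.cdf_lipschitz[OF t]) auto
    also have "K * (x - y) \<le> K * e" using K0 True by (intro mult_left_mono) auto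
    finally have "max 0 (gap 0 x y) \<le> 3 * K * e" using K0 U.width_pos by simp
    then have "(max 0 (gap 0 x y))\<^sup>2 \<le> (3 * K * e)\<^sup>2" by (intro power_mono) auto
    then show ?thesis unfolding weight_def by (rule mult_right_mono[OF _ U.kernel_nonneg])
  qed (simp add: weight_def U.kernel_outside)
  have "doubled 0 \<le> (\<integral>p. (3 * K * e)\<^sup>2 * ((case p of (x, y) \<Rightarrow> u 0 x * \<kappa> (x - y)) + (case p of (x, y) \<Rightarrow> v 0 y * \<kappa> (x - y))) \<partial>?P)"
    unfolding doubled_def
  proof (rule integral_mono)
    show "integrable ?P (\<lambda>(x, y). \<bar>u 0 x - v 0 y\<bar> * weight 0 x y)"
      by (rule pair_integrable(1)[OF t t weight_measurable(1)[OF t], where C = "(2 * K + 1) * B"])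
        (use weight_bounds(1)[OF t B] weight_nonneg weight_outside in auto)
    fix p :: "real \<times> real"
    obtain x y where p: "p = (x, y)" by fastforce
    have "\<bar>u 0 x - v 0 y\<bar> * weight 0 x y \<le> (u 0 x + v 0 y) * ((3 * K * e)\<^sup>2 * \<kappa> (x - y))"
      using U.curve_range[OF t, of x] V.curve_range[OF t, of y] w weight_nonneg by (intro mult_mono) auto
    then show "(case p of (x, y) \<Rightarrow> \<bar>u 0 x - v 0 y\<bar> * weight 0 x y)
      \<le> (3 * K * e)\<^sup>2 * ((case p of (x, y) \<Rightarrow> u 0 x * \<kappa> (x - y)) + (case p of (x, y) \<Rightarrow> v 0 y * \<kappa> (x - y)))"
      by (simp add: p algebra_simps)
  qed (intro Bochner_Integration.integrable_add integrable_mult_right ku kv)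
  also have "\<dots> = (3 * K * e)\<^sup>2 * (1 + 1)"
    using Bochner_Integration.integral_add[OF ku(1) kv(1)] ku(2) kv(2) U.curve_mass[OF t] V.curve_mass[OF t] by simp
  finally show ?thesis by (simp add: power_mult_distrib)
qed

text \<open>Bounds the total variation of \<open>(max 0 (gap t x x)) ^ 3 / 3\<close>, as a function of \<open>x\<close>, by the doubled integral.\<close>

lemma doubled_terminal:
  assumes t: "t \<in> {0..T}"
    and \<omega>: "\<And>w. 0 < w \<Longrightarrow> w < e \<Longrightarrow> (LBINT x. \<bar>u t (x - w) - u t x\<bar>) \<le> \<omega>"
      "\<And>w. 0 < w \<Longrightarrow> w < e \<Longrightarrow> (LBINT x. \<bar>v t (x - w) - v t x\<bar>) \<le> \<omega>"
  shows "(max 0 (gap t b b)) ^ 3 / 3 \<le> doubled t + 3 * \<omega>"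
proof -
  let ?P = "lborel \<Otimes>\<^sub>M lborel :: (real \<times> real) measure"
  note [measurable] = U.curve_measurable[OF t] V.curve_measurable[OF t] U.smooth_measurable[OF t] V.smooth_measurable[OF t]
  obtain B where B: "\<And>x. \<kappa> x \<le> B" "\<And>x. \<bar>\<kappa>' x\<bar> \<le> B" using U.kernel_bounds by metis
  note oU = U.oscillation_integral[OF t \<omega>(1)] and oV = V.oscillation_integral[OF t \<omega>(2)]
  note dV = V.oscillation_double_integral[OF t oV(1)]
  define g where "g x = (max 0 (gap t x x))\<^sup>2" for x
  have g: "0 \<le> g x" "g x \<le> 1" for x
    using gap_bounds[OF t, of x x] by (auto simp: g_def abs_square_le_1)
  have cU: "continuous_on A (U.smooth_cdf t)" and cV: "continuous_on A (V.smooth_cdf t)" for A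
    using U.smooth_cdf_deriv[OF t] V.smooth_cdf_deriv[OF t]
    by (meson DERIV_isCont continuous_at_imp_continuous_on)+
  have gc: "continuous_on A g" for A unfolding g_def gap_def by (intro continuous_intros cU cV)
  have [measurable]: "g \<in> borel_measurable borel" using gc by (rule borel_measurable_continuous_onI)
  \<comment> \<open>To the left of both supports and of b: the gap is 0 there, so the fundamental
    theorem on \<open>[a, b]\<close> gives the value at b itself.\<close>
  define a where "a = - (\<bar>b\<bar> + R)"
  have ab: "a \<le> b" using U.radius_nonneg by (simp add: a_def)
  have "((\<lambda>x. (max 0 x) ^ 3 / 3) has_real_derivative (max 0 x)\<^sup>2) (at x)" for x :: real
    by (rule DERIV_compose_max[where p = "\<lambda>x. x ^ 3 / 3" and p' = "\<lambda>x. x\<^sup>2"]) (auto intro!: derivative_eq_intros)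
  moreover have "((\<lambda>x. gap t x x) has_real_derivative U.smooth_density t x - V.smooth_density t x) (at x)" for x
    unfolding gap_def by (intro derivative_intros U.smooth_cdf_deriv V.smooth_cdf_deriv t)
  ultimately have der: "((\<lambda>x. (max 0 (gap t x x)) ^ 3 / 3) has_real_derivative g x * (U.smooth_density t x - V.smooth_density t x)) (at x)" for x
    unfolding g_def by (rule DERIV_chain2)
  have "has_bochner_integral lborel (\<lambda>x. g x * (U.smooth_density t x - V.smooth_density t x) * indicator {a..b} x)
      ((max 0 (gap t b b)) ^ 3 / 3 - (max 0 (gap t a a)) ^ 3 / 3)"
  proof (rule has_bochner_integral_FTC_Icc_real[OF ab der])
    have "continuous_on UNIV (\<lambda>x. g x * (U.smooth_density t x - V.smooth_density t x))"
      by (intro continuous_intros gc U.smooth_density_continuous[OF t] V.smooth_density_continuous[OF t])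
    then show "isCont (\<lambda>x. g x * (U.smooth_density t x - V.smooth_density t x)) x" for x
      by (simp add: continuous_on_eq_continuous_at)
  qed
  moreover have "gap t a a = 0"
    unfolding gap_def using U.smooth_cdf_left[OF t, of a] V.smooth_cdf_left[OF t, of a] by (simp add: a_def)
  ultimately have hi: "has_bochner_integral lborel (\<lambda>x. g x * (U.smooth_density t x - V.smooth_density t x) * indicator {a..b} x)
      ((max 0 (gap t b b)) ^ 3 / 3)" by simp
  define j where "j x = g x * \<bar>u t x - v t x\<bar>" for x
  have ij: "integrable lborel j"
  proof (rule Bochner_Integration.integrable_bound)
    show "integrable lborel (\<lambda>x. \<bar>u t x - v t x\<bar>)" using U.curve_integrable[OF t] V.curve_integrable[OF t] by auto
    show "AE x in lborel. norm (j x) \<le> norm \<bar>u t x - v t x\<bar>"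
      using g by (auto intro!: AE_I2 mult_left_le_one_le simp: j_def abs_mult)
    show "j \<in> borel_measurable lborel" unfolding j_def by measurable
  qed
  note kj = U.integral_times_kernel(1,2)[OF ij]
  have "(max 0 (gap t b b)) ^ 3 / 3 = (LBINT x. g x * (U.smooth_density t x - V.smooth_density t x) * indicator {a..b} x)"
    using hi by (simp add: has_bochner_integral_iff)
  \<comment> \<open>Mollified densities are replaced by the curves themselves; since
    \<open>g \<le> 1\<close>, the price is one oscillation of each.\<close>
  also have "\<dots> \<le> (LBINT x. j x + U.oscillation t x + V.oscillation t x)"
  proof (rule integral_mono)
    fix x
    have "g x * (U.smooth_density t x - V.smooth_density t x) * indicator {a..b} x \<le> \<bar>g x * (U.smooth_density t x - V.smooth_density t x)\<bar> * 1"
      by (auto simp: indicator_def)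
    also have "\<dots> \<le> g x * (\<bar>u t x - v t x\<bar> + (U.oscillation t x + V.oscillation t x))"
      unfolding abs_mult using g(1)[of x] U.smooth_density_error[OF t, of x] V.smooth_density_error[OF t, of x]
      by (auto intro!: mult_left_mono)
    also have "\<dots> \<le> j x + 1 * (U.oscillation t x + V.oscillation t x)"
      unfolding j_def distrib_left using g U.oscillation_nonneg[of t x] V.oscillation_nonneg[of t x]
      by (intro add_left_mono mult_right_mono add_mono) auto
    finally show "g x * (U.smooth_density t x - V.smooth_density t x) * indicator {a..b} x \<le> j x + U.oscillation t x + V.oscillation t x"
      by simp
  qed (use hi ij oU oV in \<open>auto simp: has_bochner_integral_iff\<close>)
  also have "\<dots> = (LBINT x. j x) + (LBINT x. U.oscillation t x) + (LBINT x. V.oscillation t x)"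
    using ij oU oV by simp
  also have "(LBINT x. j x) = (\<integral>(x, y). j x * \<kappa> (x - y) \<partial>?P)" using kj by simp
  also have "\<dots> \<le> (\<integral>p. (case p of (x, y) \<Rightarrow> \<bar>u t x - v t y\<bar> * weight t x y) + (case p of (x, y) \<Rightarrow> \<bar>v t y - v t x\<bar> * \<kappa> (x - y)) \<partial>?P)"
  proof (rule integral_mono)
    have i1: "integrable ?P (\<lambda>(x, y). \<bar>u t x - v t y\<bar> * weight t x y)"
      by (rule pair_integrable(1)[OF t t weight_measurable(1)[OF t], where C = "(2 * K + 1) * B"])
        (use weight_bounds(1)[OF t B] weight_nonneg weight_outside in auto)
    show "integrable ?P (\<lambda>p. (case p of (x, y) \<Rightarrow> \<bar>u t x - v t y\<bar> * weight t x y) + (case p of (x, y) \<Rightarrow> \<bar>v t y - v t x\<bar> * \<kappa> (x - y)))"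
      by (intro Bochner_Integration.integrable_add i1 dV)
    show "integrable ?P (\<lambda>(x, y). j x * \<kappa> (x - y))" by (rule kj)
    fix p :: "real \<times> real"
    obtain x y where p: "p = (x, y)" by fastforce
    have "j x * \<kappa> (x - y) \<le> \<bar>u t x - v t y\<bar> * weight t x y + \<bar>v t y - v t x\<bar> * \<kappa> (x - y)"
    proof (cases "x - y \<in> {0<..<e}")
      case True
      \<comment> \<open>Here the one-sided support of the kernel enters: y lies to the left of x, so
        replacing \<open>V x\<close> by \<open>V y\<close> can only enlarge the gap, and no error
        arises in the weight.\<close>
      have "gap t x x \<le> gap t x y" using V.smooth_cdf_mono[OF t, of y x] True by (simp add: gap_def)
      then have mono: "g x \<le> (max 0 (gap t x y))\<^sup>2" unfolding g_def by (intro power_mono) auto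
      have "j x \<le> g x * (\<bar>u t x - v t y\<bar> + \<bar>v t y - v t x\<bar>)" unfolding j_def using g by (intro mult_left_mono) auto
      also have "\<dots> \<le> (max 0 (gap t x y))\<^sup>2 * \<bar>u t x - v t y\<bar> + 1 * \<bar>v t y - v t x\<bar>"
        unfolding distrib_left using mono g by (intro add_mono mult_right_mono) auto
      finally have "j x * \<kappa> (x - y) \<le> ((max 0 (gap t x y))\<^sup>2 * \<bar>u t x - v t y\<bar> + 1 * \<bar>v t y - v t x\<bar>) * \<kappa> (x - y)"
        by (rule mult_right_mono[OF _ U.kernel_nonneg])
      then show ?thesis by (simp add: weight_def algebra_simps)
    qed (simp add: weight_def U.kernel_outside)
    then show "(case p of (x, y) \<Rightarrow> j x * \<kappa> (x - y)) \<le> (case p of (x, y) \<Rightarrow> \<bar>u t x - v t y\<bar> * weight t x y) + (case p of (x, y) \<Rightarrow> \<bar>v t y - v t x\<bar> * \<kappa> (x - y))"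
      by (simp add: p)
  qed
  also have "\<dots> = doubled t + (LBINT x. V.oscillation t x)"
  proof -
    have "integrable ?P (\<lambda>(x, y). \<bar>u t x - v t y\<bar> * weight t x y)"
      by (rule pair_integrable(1)[OF t t weight_measurable(1)[OF t], where C = "(2 * K + 1) * B"])
        (use weight_bounds(1)[OF t B] weight_nonneg weight_outside in auto)
    from Bochner_Integration.integral_add[OF this dV(1)] show ?thesis by (simp add: doubled_def dV(2))
  qed
  \<comment> \<open>Three oscillations in total: one of each curve from the mollified densities, and
    a second one of v from exchanging \<open>v t x\<close> for \<open>v t y\<close>.\<close>
  finally show ?thesis using oU oV by simp
qed

end

text \<open>If the order failed by c at b, then for small e the mollified gap there would still be
  at least \<open>c / 2\<close>, which forces \<open>\<gamma> = (c / 2)^3 / 3\<close> below the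
  terminal bound. The initial value and the translation errors contribute at most
  \<open>\<gamma> / 4\<close> each, a contradiction.\<close>

theorem cdf_comparison:
  assumes U: "kruzhkov_curve f K L R T u" and V: "kruzhkov_curve f K L R T v" and "0 < T"
    and le: "\<And>x. kruzhkov_curve.cdf u 0 x \<le> kruzhkov_curve.cdf v 0 x"
  shows "kruzhkov_curve.cdf u T b \<le> kruzhkov_curve.cdf v T b"
proof (rule ccontr)
  interpret u: kruzhkov_curve f K L R T u by fact
  interpret v: kruzhkov_curve f K L R T v by fact
  assume "\<not> u.cdf T b \<le> v.cdf T b"
  define c where "c = u.cdf T b - v.cdf T b"
  have c: "0 < c" using \<open>\<not> u.cdf T b \<le> v.cdf T b\<close> by (simp add: c_def)
  have T: "0 \<in> {0..T}" "T \<in> {0..T}" using \<open>0 < T\<close> by auto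
  have K0: "0 \<le> K" by (rule u.bound_nonneg[OF T(1)])
  \<comment> \<open>Total coefficient of \<omega>: \<open>8 * L * K * T\<close> from the evolution
    and 3 from the terminal estimate.\<close>
  define D where "D = 8 * L * K * T + 3"
  have D: "0 < D" using u.lipschitz_nonneg K0 \<open>0 < T\<close> by (simp add: D_def add_nonneg_pos)
  define \<gamma> where "\<gamma> = (c / 2) ^ 3 / 3"
  have \<gamma>: "0 < \<gamma>" using c by (simp add: \<gamma>_def)
  define \<omega> where "\<omega> = \<gamma> / (4 * D)"
  have \<omega>: "0 < \<omega>" "D * \<omega> = \<gamma> / 4" using \<gamma> D by (auto simp: \<omega>_def)
  obtain d1 where d1: "0 < d1" "\<And>t z. t \<in> {0..T} \<Longrightarrow> \<bar>z\<bar> < d1 \<Longrightarrow> (LBINT x. \<bar>u t (x - z) - u t x\<bar>) < \<omega>"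
    using u.uniform_translation[OF \<omega>(1)] by blast
  obtain d2 where d2: "0 < d2" "\<And>t z. t \<in> {0..T} \<Longrightarrow> \<bar>z\<bar> < d2 \<Longrightarrow> (LBINT x. \<bar>v t (x - z) - v t x\<bar>) < \<omega>"
    using v.uniform_translation[OF \<omega>(1)] by blast
  \<comment> \<open>\<open>d1\<close> and \<open>d2\<close> make translations cheaper than \<omega>;
    1 gives \<open>e^2 \<le> e\<close>; \<open>c / (4 * (K + 1))\<close> lets mollification consume
    at most half of c; the last bound pushes \<open>18 * K^2 * e^2\<close> to at most
    \<open>\<gamma> / 4\<close>. The summand 1 next to K keeps the denominators positive.\<close>
  define e where "e = min (min d1 d2) (min 1 (min (c / (4 * (K + 1))) (\<gamma> / (72 * (K\<^sup>2 + 1)))))"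
  have e: "0 < e" "e \<le> d1" "e \<le> d2" "e \<le> 1" "e \<le> c / (4 * (K + 1))" "e \<le> \<gamma> / (72 * (K\<^sup>2 + 1))"
    using d1 d2 c \<gamma> K0 sum_power2_gt_zero_iff[of K 1] by (auto simp: e_def intro!: divide_pos_pos add_nonneg_pos)
  obtain \<eta> \<kappa> \<kappa>' where ss: "smooth_step e \<eta> \<kappa> \<kappa>'" using smooth_step_exists[OF e(1)] by blast
  interpret p: curve_pair f K L R T u v e \<eta> \<kappa> \<kappa>'
    using ss by (intro curve_pair.intro mollified_curve.intro U V)
  have w: "\<And>t w. t \<in> {0..T} \<Longrightarrow> 0 < w \<Longrightarrow> w < e \<Longrightarrow> (LBINT x. \<bar>u t (x - w) - u t x\<bar>) \<le> \<omega>"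
    "\<And>t w. t \<in> {0..T} \<Longrightarrow> 0 < w \<Longrightarrow> w < e \<Longrightarrow> (LBINT x. \<bar>v t (x - w) - v t x\<bar>) \<le> \<omega>"
    using d1(2) d2(2) e by (auto intro: less_imp_le)
  have "(max 0 (p.gap T b b)) ^ 3 / 3 \<le> p.doubled T + 3 * \<omega>"
    using w T by (intro p.doubled_terminal) auto
  also have "p.doubled T \<le> 18 * K\<^sup>2 * e\<^sup>2 + T * (8 * L * K * \<omega>)"
    using p.doubled_bound[OF \<open>0 < T\<close> w] p.doubled_initial[OF less_imp_le[OF \<open>0 < T\<close>] le] by linarith
  finally have "(max 0 (p.gap T b b)) ^ 3 / 3 \<le> 18 * K\<^sup>2 * e\<^sup>2 + D * \<omega>" by (simp add: D_def algebra_simps)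
  also have "18 * K\<^sup>2 * e\<^sup>2 \<le> 18 * (K\<^sup>2 + 1) * e"
    using e K0 by (intro mult_mono) (auto simp: power2_eq_square mult_left_le)
  also have "18 * (K\<^sup>2 + 1) * e \<le> 18 * (K\<^sup>2 + 1) * (\<gamma> / (72 * (K\<^sup>2 + 1)))"
    using e by (intro mult_left_mono) auto
  also have "\<dots> = \<gamma> / 4"
    using add_nonneg_pos[of "K\<^sup>2" 1] by (simp add: field_simps)
  finally have "(max 0 (p.gap T b b)) ^ 3 / 3 < \<gamma>" using \<omega> \<gamma> by simp
  moreover have "c / 2 \<le> p.gap T b b"
  proof -
    have "(K + 1) * e \<le> c / 4" using e(5) K0 by (simp add: field_simps)
    then have "2 * (K * e) \<le> c / 2" using e(1) by (simp add: algebra_simps)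
    then show ?thesis
      using p.U.smooth_cdf_error[OF T(2), of b] p.V.smooth_cdf_error[OF T(2), of b]
      by (simp add: p.gap_def c_def abs_le_iff)
  qed
  then have "(c / 2) ^ 3 \<le> (max 0 (p.gap T b b)) ^ 3" using c by (intro power_mono) auto
  ultimately show False by (simp add: \<gamma>_def)
qed

section \<open>From the entropy inequality to Kruzhkov curves\<close>

text \<open>An entropy solution with Borel slices and values in a symmetric interval, since no sign
  is known at first. Sign, support and mass are derived below from the entropy inequality and turn
  it into a \<open>kruzhkov_curve\<close>.\<close>

locale entropy_curve =
  fixes f :: "real \<Rightarrow> real" and K L :: real and w :: "real \<Rightarrow> real \<Rightarrow> real"
  assumes continuous_flux: "continuous_on UNIV f"
    and lipschitz_flux: "\<And>a b. a \<in> {-K..K} \<Longrightarrow> b \<in> {-K..K} \<Longrightarrow> \<bar>f a - f b\<bar> \<le> L * \<bar>a - b\<bar>"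
    and L_nonneg: "0 \<le> L"
    and meas: "\<And>t. 0 \<le> t \<Longrightarrow> w t \<in> borel_measurable borel"
    and range: "\<And>t x. 0 \<le> t \<Longrightarrow> w t x \<in> {-K..K}"
    and L1_continuous: "\<And>s R. 0 \<le> s \<Longrightarrow>
      ((\<lambda>t. LBINT x. \<bar>w t x - w s x\<bar> * indicator {-R..R} x) \<longlongrightarrow> 0) (at s within {0..})"
    and entropy: "\<And>k \<phi> \<phi>\<^sub>t \<phi>\<^sub>x. test_function \<phi> \<phi>\<^sub>t \<phi>\<^sub>x \<Longrightarrow>
      0 \<le> (LINT t:{0<..}|lebesgue. (LBINT x. \<bar>w t x - k\<bar> * \<phi>\<^sub>t (t, x) + kflux f (w t x) k * \<phi>\<^sub>x (t, x)))"
begin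

lemma flux_measurable [measurable]: "f \<in> borel_measurable borel"
  using continuous_flux by (rule borel_measurable_continuous_onI)

lemma K_nonneg: "0 \<le> K" using range[of 0 0] by auto

section \<open>Continuity of pairings in time and entropy inequalities on slabs\<close>

lemma pairing_integrable:
  fixes c j :: "real \<Rightarrow> real"
  assumes t: "0 \<le> t" and [measurable]: "j \<in> borel_measurable borel"
    and j: "\<And>a. a \<in> {-K..K} \<Longrightarrow> \<bar>j a\<bar> \<le> J"
    and c: "continuous_on UNIV c" and out: "\<And>x. x \<notin> {-r..r} \<Longrightarrow> c x = 0"
  shows "integrable lborel (\<lambda>x. j (w t x) * c x)"
proof -
  note [measurable] = meas[OF t] borel_measurable_continuous_onI[OF c]
  have "bounded (c ` {-r..r})"
    by (intro compact_imp_bounded compact_continuous_image continuous_on_subset[OF c]) auto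
  then obtain C where "\<forall>y\<in>c ` {-r..r}. norm y \<le> C" unfolding bounded_iff by blast
  then have C: "\<bar>c x\<bar> \<le> C" if "x \<in> {-r..r}" for x using that by auto
  show ?thesis
  proof (rule integrable_bounded_support[where a = "-r" and b = r and B = "J * \<bar>C\<bar>"])
    show "\<bar>j (w t x) * c x\<bar> \<le> J * \<bar>C\<bar>" for x
    proof -
      have "\<bar>c x\<bar> \<le> \<bar>C\<bar>" using C[of x] out[of x] by (cases "x \<in> {-r..r}") auto
      then show ?thesis unfolding abs_mult using j[OF range[OF t, of x]] by (intro mult_mono) auto
    qed
  qed (use out in auto)
qed

text \<open>Two effects are separated. The motion of w is controlled by local L^1 continuity and the
  Lipschitz bound of j, the motion of the test function by uniform continuity on a compact
  rectangle; \<alpha> and \<beta> allot \<open>\<epsilon> / 2\<close> to each.\<close>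

lemma pairing_continuous:
  assumes t12: "0 \<le> t\<^sub>1" and [measurable]: "j \<in> borel_measurable borel"
    and lip: "\<And>a b. a \<in> {-K..K} \<Longrightarrow> b \<in> {-K..K} \<Longrightarrow> \<bar>j a - j b\<bar> \<le> \<Lambda> * \<bar>a - b\<bar>"
    and c: "continuous_on UNIV c" and out: "\<And>t x. t \<in> {t\<^sub>1..t\<^sub>2} \<Longrightarrow> x \<notin> {-r..r} \<Longrightarrow> c (t, x) = 0"
  shows "continuous_on {t\<^sub>1..t\<^sub>2} (\<lambda>t. LBINT x. j (w t x) * c (t, x))"
proof -
  define J where "J = \<bar>j 0\<bar> + \<bar>\<Lambda>\<bar> * K"
  have J: "\<bar>j a\<bar> \<le> J" if "a \<in> {-K..K}" for a
  proof -
    have "\<bar>j a - j 0\<bar> \<le> \<Lambda> * \<bar>a\<bar>" using lip[OF that, of 0] K_nonneg by simp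
    also have "\<dots> \<le> \<bar>\<Lambda>\<bar> * K" using that by (intro mult_mono) auto
    finally show ?thesis by (simp add: J_def)
  qed
  have J0: "0 \<le> J" using K_nonneg by (simp add: J_def)
  have cx: "continuous_on UNIV (\<lambda>x. c (t, x))" for t
    by (intro continuous_on_compose2[OF c] continuous_intros) auto
  have cm: "compact ({t\<^sub>1..t\<^sub>2} \<times> {-r..r})" by (intro compact_Times) auto
  have "bounded (c ` ({t\<^sub>1..t\<^sub>2} \<times> {-r..r}))"
    by (intro compact_imp_bounded compact_continuous_image continuous_on_subset[OF c] cm) auto
  then obtain C where C: "\<And>t x. t \<in> {t\<^sub>1..t\<^sub>2} \<Longrightarrow> x \<in> {-r..r} \<Longrightarrow> \<bar>c (t, x)\<bar> \<le> C"
    unfolding bounded_iff by (auto simp del: atLeastAtMost_iff)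
  have int: "integrable lborel (\<lambda>x. j (w s x) * c (t, x))" if "0 \<le> s" "t \<in> {t\<^sub>1..t\<^sub>2}" for s t
    by (rule pairing_integrable[OF that(1) _ J cx out[OF that(2)]]) auto
  show ?thesis
    unfolding continuous_on_iff
  proof (intro ballI allI impI)
    fix s \<epsilon> :: real assume s: "s \<in> {t\<^sub>1..t\<^sub>2}" and "0 < \<epsilon>"
    define \<alpha> where "\<alpha> = \<epsilon> / (2 * (\<bar>\<Lambda>\<bar> * \<bar>C\<bar> + 1))"
    define \<beta> where "\<beta> = \<epsilon> / (2 * (J * (2 * \<bar>r\<bar>) + 1))"
    have den: "0 < \<bar>\<Lambda>\<bar> * \<bar>C\<bar> + 1" "0 < J * (2 * \<bar>r\<bar>) + 1" using J0 by (auto intro: add_nonneg_pos)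
    have pos: "0 < \<alpha>" "0 < \<beta>" using \<open>0 < \<epsilon>\<close> den by (auto simp: \<alpha>_def \<beta>_def)
    have s0: "0 \<le> s" using s t12 by simp
    have "\<forall>\<^sub>F t in at s within {0..}. (LBINT x. \<bar>w t x - w s x\<bar> * indicator {-r..r} x) < \<alpha>"
      using order_tendstoD(2)[OF L1_continuous[OF s0] pos(1)] .
    then obtain d1 where d1: "0 < d1" "\<And>t. 0 \<le> t \<Longrightarrow> t \<noteq> s \<Longrightarrow> dist t s < d1 \<Longrightarrow> (LBINT x. \<bar>w t x - w s x\<bar> * indicator {-r..r} x) < \<alpha>"
      unfolding eventually_at by auto
    have "uniformly_continuous_on ({t\<^sub>1..t\<^sub>2} \<times> {-r..r}) c"
      by (rule compact_uniformly_continuous[OF continuous_on_subset[OF c] cm]) auto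
    from uniformly_continuous_onE[OF this pos(2)] obtain d2 where d2: "0 < d2"
      "\<And>p q. p \<in> {t\<^sub>1..t\<^sub>2} \<times> {-r..r} \<Longrightarrow> q \<in> {t\<^sub>1..t\<^sub>2} \<times> {-r..r} \<Longrightarrow> dist q p < d2 \<Longrightarrow> dist (c q) (c p) < \<beta>"
      by metis
    show "\<exists>d>0. \<forall>t\<in>{t\<^sub>1..t\<^sub>2}. dist t s < d \<longrightarrow>
      dist (LBINT x. j (w t x) * c (t, x)) (LBINT x. j (w s x) * c (s, x)) < \<epsilon>"
    proof (intro exI[of _ "min d1 d2"] conjI ballI impI)
      fix t assume t: "t \<in> {t\<^sub>1..t\<^sub>2}" "dist t s < min d1 d2"
      have t0: "0 \<le> t" using t t12 by simp
      note [measurable] = meas[OF t0] meas[OF s0]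
      show "dist (LBINT x. j (w t x) * c (t, x)) (LBINT x. j (w s x) * c (s, x)) < \<epsilon>"
      proof (cases "t = s")
        case False
        have i1: "integrable lborel (\<lambda>x. \<bar>w t x - w s x\<bar> * indicator {-r..r} x)"
          by (rule integrable_bounded_support[where a = "-r" and b = r and B = "2 * K"])
            (use range[OF t0] range[OF s0] K_nonneg in \<open>auto simp: abs_mult indicator_def abs_le_iff, (smt (verit))+\<close>)
        have i2: "integrable lborel (indicator {-r..r} :: real \<Rightarrow> real)"
          by (auto intro!: integrable_real_indicator simp: emeasure_lborel_Icc_eq)
        have "(LBINT x. j (w t x) * c (t, x)) - (LBINT x. j (w s x) * c (s, x))
          = (LBINT x. j (w t x) * c (t, x) - j (w s x) * c (s, x))"
          using int[OF t0 t(1)] int[OF s0 s] by simp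
        then have "\<bar>(LBINT x. j (w t x) * c (t, x)) - (LBINT x. j (w s x) * c (s, x))\<bar>
          \<le> (LBINT x. \<bar>j (w t x) * c (t, x) - j (w s x) * c (s, x)\<bar>)"
          by (simp only: integral_abs_bound)
        also have "\<dots> \<le> (LBINT x. (\<bar>\<Lambda>\<bar> * \<bar>C\<bar>) * (\<bar>w t x - w s x\<bar> * indicator {-r..r} x) + (J * \<beta>) * indicator {-r..r} x)"
        proof (rule integral_mono)
          fix x
          show "\<bar>j (w t x) * c (t, x) - j (w s x) * c (s, x)\<bar>
            \<le> (\<bar>\<Lambda>\<bar> * \<bar>C\<bar>) * (\<bar>w t x - w s x\<bar> * indicator {-r..r} x) + (J * \<beta>) * indicator {-r..r} x"
          proof (cases "x \<in> {-r..r}")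
            case True
            have "dist (c (t, x)) (c (s, x)) < \<beta>" using t s True by (intro d2(2)) (auto simp: dist_Pair_Pair)
            then have cd: "\<bar>c (t, x) - c (s, x)\<bar> \<le> \<beta>" by (simp add: dist_real_def)
            have "\<bar>j (w t x) * c (t, x) - j (w s x) * c (s, x)\<bar>
              = \<bar>(j (w t x) - j (w s x)) * c (t, x) + j (w s x) * (c (t, x) - c (s, x))\<bar>" by (simp add: algebra_simps)
            also have "\<dots> \<le> \<bar>j (w t x) - j (w s x)\<bar> * \<bar>c (t, x)\<bar> + \<bar>j (w s x)\<bar> * \<bar>c (t, x) - c (s, x)\<bar>"
              by (metis abs_mult abs_triangle_ineq)
            also have "\<dots> \<le> (\<bar>\<Lambda>\<bar> * \<bar>w t x - w s x\<bar>) * \<bar>C\<bar> + J * \<beta>"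
            proof (intro add_mono mult_mono)
              show "\<bar>j (w t x) - j (w s x)\<bar> \<le> \<bar>\<Lambda>\<bar> * \<bar>w t x - w s x\<bar>"
                using lip[OF range[OF t0, of x] range[OF s0, of x]]
                by (rule order_trans) (auto intro: mult_right_mono)
            qed (use C[OF t(1) True] J[OF range[OF s0, of x]] cd J0 in auto)
            finally show ?thesis using True by (simp add: mult_ac)
          next
            case False
            then show ?thesis using out[OF t(1) False] out[OF s False] by simp
          qed
        qed (intro integrable_abs Bochner_Integration.integrable_diff Bochner_Integration.integrable_add
            integrable_mult_right int t0 s0 t(1) s i1 i2)+
        also have "\<dots> = (\<bar>\<Lambda>\<bar> * \<bar>C\<bar>) * (LBINT x. \<bar>w t x - w s x\<bar> * indicator {-r..r} x) + (J * \<beta>) * measure lborel {-r..r}"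
          using i1 i2 by simp
        also have "\<dots> \<le> (\<bar>\<Lambda>\<bar> * \<bar>C\<bar>) * \<alpha> + (J * \<beta>) * (2 * \<bar>r\<bar>)"
          using d1(2)[OF t0 False] t(2) J0 pos
          by (intro add_mono mult_left_mono) (auto simp: measure_def emeasure_lborel_Icc_eq)
        also have "\<dots> < (\<bar>\<Lambda>\<bar> * \<bar>C\<bar> + 1) * \<alpha> + (J * (2 * \<bar>r\<bar>) + 1) * \<beta>"
          using pos by (simp add: algebra_simps)
        also have "\<dots> = \<epsilon>"
        proof -
          have half: "d * (\<epsilon> / (2 * d)) = \<epsilon> / 2" if "0 < d" for d using that by (simp add: field_simps)
          have "(\<bar>\<Lambda>\<bar> * \<bar>C\<bar> + 1) * \<alpha> = \<epsilon> / 2" "(J * (2 * \<bar>r\<bar>) + 1) * \<beta> = \<epsilon> / 2"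
            unfolding \<alpha>_def \<beta>_def using half den by blast+
          then show ?thesis by simp
        qed
        finally show ?thesis by (simp add: dist_real_def)
      qed (use \<open>0 < \<epsilon>\<close> in simp)
    qed (use d1 d2 in auto)
  qed
qed

text \<open>Tests the entropy inequality with \<open>\<phi>\<close> times a smoothed indicator function of the time interval.\<close>

lemma entropy_slab_interior:
  fixes \<phi> \<phi>\<^sub>t \<phi>\<^sub>x :: "real \<times> real \<Rightarrow> real"
  assumes t12: "0 < t\<^sub>1" "t\<^sub>1 < t\<^sub>2"
    and d: "\<And>p. (\<phi> has_derivative (\<lambda>(s, y). \<phi>\<^sub>t p * s + \<phi>\<^sub>x p * y)) (at p)"
    and c: "continuous_on UNIV \<phi>\<^sub>t" "continuous_on UNIV \<phi>\<^sub>x" and nonneg: "\<And>p. 0 \<le> \<phi> p"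
    and out: "\<And>t x. t \<in> {t\<^sub>1..t\<^sub>2} \<Longrightarrow> x \<notin> {-r..r} \<Longrightarrow> \<phi> (t, x) = 0 \<and> \<phi>\<^sub>t (t, x) = 0 \<and> \<phi>\<^sub>x (t, x) = 0"
    and k: "k \<in> {-K..K}"
    and b: "\<And>t. t\<^sub>1 < t \<Longrightarrow> t < t\<^sub>2 \<Longrightarrow> (LBINT x. \<bar>w t x - k\<bar> * \<phi>\<^sub>t (t, x) + kflux f (w t x) k * \<phi>\<^sub>x (t, x)) \<le> b"
  shows "(LBINT x. \<bar>w t\<^sub>2 x - k\<bar> * \<phi> (t\<^sub>2, x)) - (LBINT x. \<bar>w t\<^sub>1 x - k\<bar> * \<phi> (t\<^sub>1, x)) \<le> b * (t\<^sub>2 - t\<^sub>1)"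
proof -
  have c0: "continuous_on UNIV \<phi>"
    using d by (meson continuous_at_imp_continuous_on has_derivative_continuous)
  have cx: "continuous_on UNIV (\<lambda>x. g (t, x))" if "continuous_on UNIV g" for g :: "real \<times> real \<Rightarrow> real" and t
    by (intro continuous_on_compose2[OF that] continuous_intros) auto
  define A where "A t = (LBINT x. \<bar>w t x - k\<bar> * \<phi> (t, x))" for t
  define B where "B t = (LBINT x. \<bar>w t x - k\<bar> * \<phi>\<^sub>t (t, x) + kflux f (w t x) k * \<phi>\<^sub>x (t, x))" for t
  have jlip: "\<bar>\<bar>a - k\<bar> - \<bar>b - k\<bar>\<bar> \<le> 1 * \<bar>a - b\<bar>" for a b by simp
  have qlip: "\<bar>kflux f a k - kflux f b k\<bar> \<le> L * \<bar>a - b\<bar>" if "a \<in> {-K..K}" "b \<in> {-K..K}" for a b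
    by (rule kflux_lipschitz[OF lipschitz_flux that k])
  have jb: "\<bar>\<bar>a - k\<bar>\<bar> \<le> 2 * K" if "a \<in> {-K..K}" for a using that k by auto
  have qb: "\<bar>kflux f a k\<bar> \<le> L * (2 * K)" if "a \<in> {-K..K}" for a
  proof -
    have "\<bar>kflux f a k\<bar> \<le> L * \<bar>a - k\<bar>" by (rule kflux_bound[OF lipschitz_flux that k])
    also have "\<dots> \<le> L * (2 * K)" using jb[OF that] L_nonneg by (intro mult_left_mono) auto
    finally show ?thesis .
  qed
  have i\<phi>: "integrable lborel (\<lambda>x. \<bar>w t x - k\<bar> * \<phi> (t, x))"
    and i\<phi>t: "integrable lborel (\<lambda>x. \<bar>w t x - k\<bar> * \<phi>\<^sub>t (t, x))"
    and i\<phi>x: "integrable lborel (\<lambda>x. kflux f (w t x) k * \<phi>\<^sub>x (t, x))" if "t \<in> {t\<^sub>1..t\<^sub>2}" for t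
  proof -
    have t0: "0 \<le> t" using that t12 by simp
    show "integrable lborel (\<lambda>x. \<bar>w t x - k\<bar> * \<phi> (t, x))"
      by (rule pairing_integrable[OF t0, where j = "\<lambda>a. \<bar>a - k\<bar>" and r = r]) (use jb cx c0 out[OF that] in auto)
    show "integrable lborel (\<lambda>x. \<bar>w t x - k\<bar> * \<phi>\<^sub>t (t, x))"
      by (rule pairing_integrable[OF t0, where j = "\<lambda>a. \<bar>a - k\<bar>" and r = r]) (use jb cx c out[OF that] in auto)
    show "integrable lborel (\<lambda>x. kflux f (w t x) k * \<phi>\<^sub>x (t, x))"
      by (rule pairing_integrable[OF t0, where j = "\<lambda>a. kflux f a k" and r = r]) (use qb cx c out[OF that] in auto)
  qed
  have cA: "continuous_on {t\<^sub>1..t\<^sub>2} A"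
    unfolding A_def by (rule pairing_continuous[where j = "\<lambda>a. \<bar>a - k\<bar>" and r = r and \<Lambda> = 1]) (use t12 jlip c0 out in auto)
  have cB: "continuous_on {t\<^sub>1..t\<^sub>2} B"
  proof -
    have "continuous_on {t\<^sub>1..t\<^sub>2} (\<lambda>t. (LBINT x. \<bar>w t x - k\<bar> * \<phi>\<^sub>t (t, x)) + (LBINT x. kflux f (w t x) k * \<phi>\<^sub>x (t, x)))"
    proof (rule continuous_on_add)
      show "continuous_on {t\<^sub>1..t\<^sub>2} (\<lambda>t. LBINT x. \<bar>w t x - k\<bar> * \<phi>\<^sub>t (t, x))"
        by (rule pairing_continuous[where j = "\<lambda>a. \<bar>a - k\<bar>" and r = r and \<Lambda> = 1]) (use t12 jlip c out in auto)
      show "continuous_on {t\<^sub>1..t\<^sub>2} (\<lambda>t. LBINT x. kflux f (w t x) k * \<phi>\<^sub>x (t, x))"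
        by (rule pairing_continuous[where j = "\<lambda>a. kflux f a k" and r = r and \<Lambda> = L]) (use t12 qlip c out in auto)
    qed
    then show ?thesis
      by (rule continuous_on_cong[THEN iffD1, rotated -1]) (use i\<phi>t i\<phi>x in \<open>auto simp: B_def\<close>)
  qed
  \<comment> \<open>Subtracting \<open>b * t\<close> reduces the claim to
    \<open>Z t\<^sub>2 \<le> Z t\<^sub>1\<close>.\<close>
  define Z where "Z t = A t - b * t" for t
  have cZ: "continuous_on {t\<^sub>1..t\<^sub>2} Z" unfolding Z_def by (intro continuous_intros cA)
  have "Z t\<^sub>2 - Z t\<^sub>1 \<le> 0"
  proof (rule field_le_epsilon)
    fix \<epsilon> :: real assume "0 < \<epsilon>"
    then have e2: "0 < \<epsilon> / 2" by simp
    obtain d1 where d1: "0 < d1" "\<And>t. t \<in> {t\<^sub>1..t\<^sub>2} \<Longrightarrow> dist t t\<^sub>1 < d1 \<Longrightarrow> dist (Z t) (Z t\<^sub>1) < \<epsilon> / 2"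
      using cZ[unfolded continuous_on_iff, rule_format, of t\<^sub>1, OF _ e2] t12 by auto
    obtain d2 where d2: "0 < d2" "\<And>t. t \<in> {t\<^sub>1..t\<^sub>2} \<Longrightarrow> dist t t\<^sub>2 < d2 \<Longrightarrow> dist (Z t) (Z t\<^sub>2) < \<epsilon> / 2"
      using cZ[unfolded continuous_on_iff, rule_format, of t\<^sub>2, OF _ e2] t12 by auto
    define e where "e = min (min d1 d2) (t\<^sub>2 - t\<^sub>1)"
    have e: "0 < e" "e \<le> d1" "e \<le> d2" "e \<le> t\<^sub>2 - t\<^sub>1" using d1 d2 t12 by (auto simp: e_def)
    obtain \<eta> \<kappa> \<kappa>' where "smooth_step e \<eta> \<kappa> \<kappa>'" using smooth_step_exists[OF e(1)] by blast
    then interpret smooth_step e \<eta> \<kappa> \<kappa>' .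
    \<comment> \<open>Rises from 0 to 1 just after \<open>t\<^sub>1\<close> and falls back just
      before \<open>t\<^sub>2\<close>, so its derivative is the difference of two approximate point
      masses at the ends. It is nonnegative because
      \<open>e \<le> t\<^sub>2 - t\<^sub>1\<close>.\<close>
    define \<zeta> where "\<zeta> t = \<eta> (t - t\<^sub>1) - \<eta> (t - (t\<^sub>2 - e))" for t
    define \<zeta>' where "\<zeta>' t = \<kappa> (t - t\<^sub>1) - \<kappa> (t - (t\<^sub>2 - e))" for t
    have \<zeta>0: "0 \<le> \<zeta> t" for t using step_mono[of "t - (t\<^sub>2 - e)" "t - t\<^sub>1"] e by (simp add: \<zeta>_def)
    have \<zeta>out: "\<zeta> t = 0" "\<zeta>' t = 0" if "t \<notin> {t\<^sub>1<..<t\<^sub>2}" for t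
    proof -
      from that consider "t \<le> t\<^sub>1" | "t\<^sub>2 \<le> t" by fastforce
      then show "\<zeta> t = 0" "\<zeta>' t = 0"
        using e by (cases; simp add: \<zeta>_def \<zeta>'_def step_left step_right kernel_outside)+
    qed
    have shift: "((\<lambda>t. t - s) has_real_derivative 1) (at t)" for s t :: real
      by (auto intro!: derivative_eq_intros)
    have d\<zeta>: "(\<zeta> has_real_derivative \<zeta>' t) (at t)" for t
      unfolding \<zeta>_def \<zeta>'_def
      using DERIV_diff[OF DERIV_chain2[OF step_deriv shift] DERIV_chain2[OF step_deriv shift]] by simp
    have c\<zeta>: "continuous_on S \<zeta>" "continuous_on S \<zeta>'" for S
      unfolding \<zeta>_def \<zeta>'_def
      by (intro continuous_intros continuous_on_compose2[OF continuous_step[of UNIV]] continuous_on_compose2[OF continuous_kernel[of UNIV]]; simp)+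
    define \<Phi> where "\<Phi> p = \<zeta> (fst p) * \<phi> p" for p
    define \<Phi>\<^sub>t where "\<Phi>\<^sub>t p = \<zeta>' (fst p) * \<phi> p + \<zeta> (fst p) * \<phi>\<^sub>t p" for p
    define \<Phi>\<^sub>x where "\<Phi>\<^sub>x p = \<zeta> (fst p) * \<phi>\<^sub>x p" for p
    have supp: "closure {p. \<Phi> p \<noteq> 0} \<subseteq> {t\<^sub>1..t\<^sub>2} \<times> {-r..r}"
    proof (rule closure_minimal)
      show "{p. \<Phi> p \<noteq> 0} \<subseteq> {t\<^sub>1..t\<^sub>2} \<times> {-r..r}"
      proof clarify
        fix t x assume nz: "\<Phi> (t, x) \<noteq> 0"
        then have "t \<in> {t\<^sub>1<..<t\<^sub>2}" using \<zeta>out(1)[of t] by (cases "t \<in> {t\<^sub>1<..<t\<^sub>2}") (auto simp: \<Phi>_def)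
        moreover from this have "x \<in> {-r..r}" using nz out[of t x] by (cases "x \<in> {-r..r}") (auto simp: \<Phi>_def)
        ultimately show "t \<in> {t\<^sub>1..t\<^sub>2} \<and> x \<in> {-r..r}" by auto
      qed
    qed (intro closed_Times closed_atLeastAtMost)
    have "test_function \<Phi> \<Phi>\<^sub>t \<Phi>\<^sub>x"
      unfolding test_function_def
    proof (intro conjI allI)
      fix p :: "real \<times> real"
      have "((\<lambda>q. \<zeta> (fst q)) has_derivative (\<lambda>q. fst q * \<zeta>' (fst p))) (at p)"
        using has_derivative_compose[OF has_derivative_fst[OF has_derivative_ident] d\<zeta>[of "fst p", unfolded has_field_derivative_def], of UNIV]
        by (simp add: mult.commute)
      from has_derivative_mult[OF this d[of p]]
      show "(\<Phi> has_derivative (\<lambda>(s, y). \<Phi>\<^sub>t p * s + \<Phi>\<^sub>x p * y)) (at p)"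
        unfolding \<Phi>_def \<Phi>\<^sub>t_def \<Phi>\<^sub>x_def
        by (rule has_derivative_eq_rhs) (auto simp: fun_eq_iff algebra_simps)
      show "0 \<le> \<Phi> p" using \<zeta>0 nonneg by (simp add: \<Phi>_def)
      show "compact (closure {p. \<Phi> p \<noteq> 0})"
        using compact_Int_closed[OF compact_Times[OF compact_Icc[of t\<^sub>1 t\<^sub>2] compact_Icc[of "-r" r]] closed_closure, of "{p. \<Phi> p \<noteq> 0}"] supp by (simp add: Int_absorb1)
      show "closure {p. \<Phi> p \<noteq> 0} \<subseteq> {0<..} \<times> UNIV" using supp t12 by fastforce
      show "continuous_on UNIV \<Phi>\<^sub>t" "continuous_on UNIV \<Phi>\<^sub>x"
        unfolding \<Phi>\<^sub>t_def \<Phi>\<^sub>x_def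
        by (intro continuous_intros c c0 continuous_on_compose2[OF c\<zeta>(1)[of UNIV]] continuous_on_compose2[OF c\<zeta>(2)[of UNIV]]; simp)+
    qed
    from entropy[OF this, of k]
    have ge0: "0 \<le> (LINT t:{0<..}|lebesgue. LBINT x. \<bar>w t x - k\<bar> * \<Phi>\<^sub>t (t, x) + kflux f (w t x) k * \<Phi>\<^sub>x (t, x))" .
    define I where "I t = \<zeta>' t * A t + \<zeta> t * B t" for t
    have I: "(LBINT x. \<bar>w t x - k\<bar> * \<Phi>\<^sub>t (t, x) + kflux f (w t x) k * \<Phi>\<^sub>x (t, x)) = I t" if "t \<in> {t\<^sub>1..t\<^sub>2}" for t
    proof -
      have "I t = (LBINT x. \<zeta>' t * (\<bar>w t x - k\<bar> * \<phi> (t, x)) + \<zeta> t * (\<bar>w t x - k\<bar> * \<phi>\<^sub>t (t, x) + kflux f (w t x) k * \<phi>\<^sub>x (t, x)))"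
        unfolding I_def A_def B_def using i\<phi>[OF that] i\<phi>t[OF that] i\<phi>x[OF that] by simp
      then show ?thesis by (simp add: \<Phi>\<^sub>t_def \<Phi>\<^sub>x_def algebra_simps)
    qed
    have iI: "integrable lborel (\<lambda>t. indicator {t\<^sub>1..t\<^sub>2} t *\<^sub>R I t)"
      by (rule borel_integrable_compact) (auto simp: I_def intro!: continuous_intros cA cB c\<zeta>)
    have "(LINT t:{0<..}|lebesgue. LBINT x. \<bar>w t x - k\<bar> * \<Phi>\<^sub>t (t, x) + kflux f (w t x) k * \<Phi>\<^sub>x (t, x))
      = (LINT t|lebesgue. indicator {t\<^sub>1..t\<^sub>2} t *\<^sub>R I t)"
      unfolding set_lebesgue_integral_def
    proof (rule Bochner_Integration.integral_cong)
      fix t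
      show "indicat_real {0<..} t *\<^sub>R (LBINT x. \<bar>w t x - k\<bar> * \<Phi>\<^sub>t (t, x) + kflux f (w t x) k * \<Phi>\<^sub>x (t, x))
        = indicator {t\<^sub>1..t\<^sub>2} t *\<^sub>R I t"
      proof (cases "t \<in> {t\<^sub>1..t\<^sub>2}")
        case True
        then show ?thesis using I[OF True] t12 by (simp add: indicator_def)
      next
        case False
        then have "t \<notin> {t\<^sub>1<..<t\<^sub>2}" by auto
        then show ?thesis using False \<zeta>out[of t] by (simp add: \<Phi>\<^sub>t_def \<Phi>\<^sub>x_def)
      qed
    qed simp
    also have "\<dots> = (LBINT t. indicator {t\<^sub>1..t\<^sub>2} t *\<^sub>R I t)"
      by (rule integral_completion) (use iI in auto)
    finally have "0 \<le> (LBINT t. indicator {t\<^sub>1..t\<^sub>2} t *\<^sub>R I t)" using ge0 by simp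
    \<comment> \<open>With \<open>A = Z + b t\<close> and \<open>B \<le> b\<close>, the terms
      containing b form the derivative of \<open>\<zeta> t * (b * t)\<close>, which integrates to 0.
      What remains are averages of Z over windows of width e at the two ends, each within
      \<open>\<epsilon> / 2\<close> of the value at the end point.\<close>
    also have "\<dots> \<le> (LBINT t. (\<zeta>' t * (b * t) + \<zeta> t * b) * indicator {t\<^sub>1..t\<^sub>2} t
        + (Z t\<^sub>1 + \<epsilon> / 2) * \<kappa> (t - t\<^sub>1) - (Z t\<^sub>2 - \<epsilon> / 2) * \<kappa> (t - (t\<^sub>2 - e)))"
    proof (rule integral_mono[OF iI])
      fix t
      show "indicator {t\<^sub>1..t\<^sub>2} t *\<^sub>R I t \<le> (\<zeta>' t * (b * t) + \<zeta> t * b) * indicator {t\<^sub>1..t\<^sub>2} t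
        + (Z t\<^sub>1 + \<epsilon> / 2) * \<kappa> (t - t\<^sub>1) - (Z t\<^sub>2 - \<epsilon> / 2) * \<kappa> (t - (t\<^sub>2 - e))"
      proof (cases "t \<in> {t\<^sub>1..t\<^sub>2}")
        case True
        have "\<zeta> t * B t \<le> \<zeta> t * b"
          using b[of t] \<zeta>0[of t] \<zeta>out(1)[of t] by (cases "t \<in> {t\<^sub>1<..<t\<^sub>2}") (auto simp: B_def intro: mult_left_mono)
        moreover have "\<kappa> (t - t\<^sub>1) * Z t \<le> \<kappa> (t - t\<^sub>1) * (Z t\<^sub>1 + \<epsilon> / 2)"
        proof (cases "t - t\<^sub>1 \<in> {0<..<e}")
          case T: True
          then have "dist (Z t) (Z t\<^sub>1) < \<epsilon> / 2" using e True by (intro d1(2)) (auto simp: dist_real_def)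
          then show ?thesis unfolding dist_real_def by (intro mult_left_mono kernel_nonneg) linarith
        qed (simp add: kernel_outside)
        moreover have "\<kappa> (t - (t\<^sub>2 - e)) * (Z t\<^sub>2 - \<epsilon> / 2) \<le> \<kappa> (t - (t\<^sub>2 - e)) * Z t"
        proof (cases "t - (t\<^sub>2 - e) \<in> {0<..<e}")
          case T: True
          then have "dist (Z t) (Z t\<^sub>2) < \<epsilon> / 2" using e True by (intro d2(2)) (auto simp: dist_real_def)
          then show ?thesis unfolding dist_real_def by (intro mult_left_mono kernel_nonneg) linarith
        qed (simp add: kernel_outside)
        moreover have "\<zeta>' t * A t = \<zeta>' t * (b * t) + \<kappa> (t - t\<^sub>1) * Z t - \<kappa> (t - (t\<^sub>2 - e)) * Z t"
          by (simp add: \<zeta>'_def Z_def algebra_simps)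
        ultimately show ?thesis using True by (simp add: I_def mult.commute)
      next
        case False
        then have "\<kappa> (t - t\<^sub>1) = 0" "\<kappa> (t - (t\<^sub>2 - e)) = 0" using e by (auto intro!: kernel_outside)
        then show ?thesis using False by simp
      qed
    next
      have "integrable lborel (\<lambda>t. indicator {t\<^sub>1..t\<^sub>2} t *\<^sub>R (\<zeta>' t * (b * t) + \<zeta> t * b))"
        by (rule borel_integrable_compact) (auto intro!: continuous_intros c\<zeta>)
      then have "integrable lborel (\<lambda>t. (\<zeta>' t * (b * t) + \<zeta> t * b) * indicator {t\<^sub>1..t\<^sub>2} t)" by (simp add: mult.commute)
      then show "integrable lborel (\<lambda>t. (\<zeta>' t * (b * t) + \<zeta> t * b) * indicator {t\<^sub>1..t\<^sub>2} t
        + (Z t\<^sub>1 + \<epsilon> / 2) * \<kappa> (t - t\<^sub>1) - (Z t\<^sub>2 - \<epsilon> / 2) * \<kappa> (t - (t\<^sub>2 - e)))"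
        using has_integral_kernel_shifted by (auto simp: has_bochner_integral_iff)
    qed
    also have "\<dots> = 0 + (Z t\<^sub>1 + \<epsilon> / 2) * 1 - (Z t\<^sub>2 - \<epsilon> / 2) * 1"
    proof (rule has_bochner_integral_integral_eq)
      have "has_bochner_integral lborel (\<lambda>t. (\<zeta>' t * (b * t) + \<zeta> t * b) * indicator {t\<^sub>1..t\<^sub>2} t) (\<zeta> t\<^sub>2 * (b * t\<^sub>2) - \<zeta> t\<^sub>1 * (b * t\<^sub>1))"
      proof (rule has_bochner_integral_FTC_Icc_real)
        show "((\<lambda>t. \<zeta> t * (b * t)) has_real_derivative \<zeta>' t * (b * t) + \<zeta> t * b) (at t)" for t
          by (rule DERIV_cong[OF DERIV_mult[OF d\<zeta>[of t] DERIV_cmult_Id[of b]]]) (simp add: mult_ac)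
        have "continuous_on UNIV (\<lambda>t. \<zeta>' t * (b * t) + \<zeta> t * b)" by (intro continuous_intros c\<zeta>)
        then show "isCont (\<lambda>t. \<zeta>' t * (b * t) + \<zeta> t * b) t" for t by (simp add: continuous_on_eq_continuous_at)
      qed (use t12 in simp)
      then have "has_bochner_integral lborel (\<lambda>t. (\<zeta>' t * (b * t) + \<zeta> t * b) * indicator {t\<^sub>1..t\<^sub>2} t) 0"
        using \<zeta>out(1)[of t\<^sub>1] \<zeta>out(1)[of t\<^sub>2] by simp
      then show "has_bochner_integral lborel (\<lambda>t. (\<zeta>' t * (b * t) + \<zeta> t * b) * indicator {t\<^sub>1..t\<^sub>2} t
        + (Z t\<^sub>1 + \<epsilon> / 2) * \<kappa> (t - t\<^sub>1) - (Z t\<^sub>2 - \<epsilon> / 2) * \<kappa> (t - (t\<^sub>2 - e))) (0 + (Z t\<^sub>1 + \<epsilon> / 2) * 1 - (Z t\<^sub>2 - \<epsilon> / 2) * 1)"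
        by (intro has_bochner_integral_add has_bochner_integral_diff has_bochner_integral_mult_right has_integral_kernel_shifted) auto
    qed
    finally show "Z t\<^sub>2 - Z t\<^sub>1 \<le> 0 + \<epsilon>" by simp
  qed
  then show ?thesis by (simp add: Z_def A_def algebra_simps)
qed

text \<open>Test functions are supported in \<open>t > 0\<close>, so the initial time is not
  directly accessible. It is reached by letting the left end of the slab decrease to
  \<open>t\<^sub>1\<close> and using continuity of the pairing.\<close>

lemma entropy_slab:
  fixes \<phi> \<phi>\<^sub>t \<phi>\<^sub>x :: "real \<times> real \<Rightarrow> real"
  assumes t12: "0 \<le> t\<^sub>1" "t\<^sub>1 < t\<^sub>2"
    and d: "\<And>p. (\<phi> has_derivative (\<lambda>(s, y). \<phi>\<^sub>t p * s + \<phi>\<^sub>x p * y)) (at p)"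
    and c: "continuous_on UNIV \<phi>\<^sub>t" "continuous_on UNIV \<phi>\<^sub>x" and nonneg: "\<And>p. 0 \<le> \<phi> p"
    and out: "\<And>t x. t \<in> {t\<^sub>1..t\<^sub>2} \<Longrightarrow> x \<notin> {-r..r} \<Longrightarrow> \<phi> (t, x) = 0 \<and> \<phi>\<^sub>t (t, x) = 0 \<and> \<phi>\<^sub>x (t, x) = 0"
    and k: "k \<in> {-K..K}"
    and b: "\<And>t. t\<^sub>1 < t \<Longrightarrow> t < t\<^sub>2 \<Longrightarrow> (LBINT x. \<bar>w t x - k\<bar> * \<phi>\<^sub>t (t, x) + kflux f (w t x) k * \<phi>\<^sub>x (t, x)) \<le> b"
  shows "(LBINT x. \<bar>w t\<^sub>2 x - k\<bar> * \<phi> (t\<^sub>2, x)) - (LBINT x. \<bar>w t\<^sub>1 x - k\<bar> * \<phi> (t\<^sub>1, x)) \<le> b * (t\<^sub>2 - t\<^sub>1)"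
proof -
  have c0: "continuous_on UNIV \<phi>"
    using d by (meson continuous_at_imp_continuous_on has_derivative_continuous)
  define A where "A t = (LBINT x. \<bar>w t x - k\<bar> * \<phi> (t, x))" for t
  have cA: "continuous_on {t\<^sub>1..t\<^sub>2} A"
    unfolding A_def by (rule pairing_continuous[where j = "\<lambda>a. \<bar>a - k\<bar>" and r = r and \<Lambda> = 1]) (use t12 c0 out in auto)
  have "A t\<^sub>2 - A t\<^sub>1 - b * (t\<^sub>2 - t\<^sub>1) \<le> 0"
  proof (rule continuous_le_on_closure[where f = "\<lambda>s. A t\<^sub>2 - A s - b * (t\<^sub>2 - s)" and S = "{t\<^sub>1<..<t\<^sub>2}"])
    show "continuous_on (closure {t\<^sub>1<..<t\<^sub>2}) (\<lambda>s. A t\<^sub>2 - A s - b * (t\<^sub>2 - s))"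
      using t12 by (auto intro!: continuous_intros cA)
    show "t\<^sub>1 \<in> closure {t\<^sub>1<..<t\<^sub>2}" using t12 by simp
    fix s assume s: "s \<in> {t\<^sub>1<..<t\<^sub>2}"
    have "A t\<^sub>2 - A s \<le> b * (t\<^sub>2 - s)"
      unfolding A_def by (rule entropy_slab_interior[OF _ _ d c nonneg out k b]) (use s t12 in auto)
    then show "A t\<^sub>2 - A s - b * (t\<^sub>2 - s) \<le> 0" by simp
  qed
  then show ?thesis by (simp add: A_def)
qed

lemma entropy_static:
  assumes t12: "0 \<le> t\<^sub>1" "t\<^sub>1 < t\<^sub>2"
    and d: "\<And>x. (\<theta> has_real_derivative \<theta>' x) (at x)" and c: "continuous_on UNIV \<theta>'"
    and nonneg: "\<And>x. 0 \<le> \<theta> x" and out: "\<And>x. x \<notin> {-r..r} \<Longrightarrow> \<theta> x = 0" and k: "k \<in> {-K..K}"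
    and b: "\<And>t. t\<^sub>1 < t \<Longrightarrow> t < t\<^sub>2 \<Longrightarrow> (LBINT x. kflux f (w t x) k * \<theta>' x) \<le> b"
  shows "(LBINT x. \<bar>w t\<^sub>2 x - k\<bar> * \<theta> x) - (LBINT x. \<bar>w t\<^sub>1 x - k\<bar> * \<theta> x) \<le> b * (t\<^sub>2 - t\<^sub>1)"
proof -
  have "(LBINT x. \<bar>w t\<^sub>2 x - k\<bar> * \<theta> (snd (t\<^sub>2, x))) - (LBINT x. \<bar>w t\<^sub>1 x - k\<bar> * \<theta> (snd (t\<^sub>1, x))) \<le> b * (t\<^sub>2 - t\<^sub>1)"
  proof (rule entropy_slab[OF t12, where \<phi> = "\<lambda>p. \<theta> (snd p)" and \<phi>\<^sub>t = "\<lambda>p. 0" and \<phi>\<^sub>x = "\<lambda>p. \<theta>' (snd p)" and r = r])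
    show "((\<lambda>p. \<theta> (snd p)) has_derivative (\<lambda>(s, y). 0 * s + \<theta>' (snd p) * y)) (at p)" for p :: "real \<times> real"
      using has_derivative_compose[OF has_derivative_snd[OF has_derivative_ident] d[of "snd p", unfolded has_field_derivative_def], of UNIV]
      by (simp add: case_prod_beta')
    show "continuous_on UNIV (\<lambda>p::real \<times> real. \<theta>' (snd p))"
      by (intro continuous_on_compose2[OF c] continuous_intros) auto
  qed (use nonneg out k b deriv_compact_support(1)[OF d c out] in auto)
  then show ?thesis by simp
qed

text \<open>The test function lives in a truncated cone whose sides move inwards with speed \<open>L\<close>.\<close>

lemma finite_speed_oneside:
  assumes init: "AE x in lborel. R\<^sub>0 < \<sigma> * x \<longrightarrow> w 0 x = 0" and t: "0 < t" and \<sigma>: "\<sigma> = 1 \<or> \<sigma> = -1"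
  shows "AE x in lborel. R\<^sub>0 + L * t < \<sigma> * x \<longrightarrow> w t x = 0"
proof -
  define P where "P z = (max 0 z)\<^sup>2" for z :: real
  define P' where "P' z = 2 * max 0 z" for z :: real
  have dP: "(P has_real_derivative P' z) (at z)" for z unfolding P_def P'_def by (rule pos_square_deriv)
  have cP: "continuous_on UNIV P" "continuous_on UNIV P'" unfolding P_def P'_def by (intro continuous_intros)+
  have P: "0 \<le> P z" "0 \<le> P' z" for z by (auto simp: P_def P'_def)
  have neg: "z \<le> 0 \<Longrightarrow> P z = 0 \<and> P' z = 0" for z by (simp add: P_def P'_def)
  \<comment> \<open>The second factor truncates the half-line at its far end, since the test
    function must have compact support in x. The truncation M then runs through the natural numbers,
    and countably many null sets are discarded. The sign \<sigma> treats both directions at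
    once.\<close>
  have "AE x in lborel. \<bar>w t x\<bar> * (P (\<sigma> * x - R\<^sub>0 - L * t) * P (real M - \<sigma> * x - L * t)) = 0" for M :: nat
  proof -
    define a where "a p = \<sigma> * snd p - R\<^sub>0 - L * fst p" for p :: "real \<times> real"
    define b where "b p = real M - \<sigma> * snd p - L * fst p" for p :: "real \<times> real"
    define \<phi> where "\<phi> p = P (a p) * P (b p)" for p
    define \<phi>\<^sub>t where "\<phi>\<^sub>t p = - L * (P' (a p) * P (b p) + P (a p) * P' (b p))" for p
    define \<phi>\<^sub>x where "\<phi>\<^sub>x p = \<sigma> * (P' (a p) * P (b p) - P (a p) * P' (b p))" for p
    define r where "r = \<bar>R\<^sub>0\<bar> + real M"
    have ca: "continuous_on UNIV a" "continuous_on UNIV b" unfolding a_def b_def by (intro continuous_intros)+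
    have cPab: "continuous_on UNIV (\<lambda>p. P (a p))" "continuous_on UNIV (\<lambda>p. P' (a p))"
      "continuous_on UNIV (\<lambda>p. P (b p))" "continuous_on UNIV (\<lambda>p. P' (b p))"
      by (intro continuous_on_compose2[OF cP(1)] continuous_on_compose2[OF cP(2)] ca; simp)+
    have d: "(\<phi> has_derivative (\<lambda>(s, y). \<phi>\<^sub>t p * s + \<phi>\<^sub>x p * y)) (at p)" for p
    proof -
      have "(a has_derivative (\<lambda>(s, y). \<sigma> * y - L * s)) (at p)"
        unfolding a_def case_prod_beta' by (auto intro!: derivative_eq_intros)
      from has_derivative_compose[OF this dP[of "a p", unfolded has_field_derivative_def]]
      have da: "((\<lambda>p. P (a p)) has_derivative (\<lambda>q. P' (a p) * (\<sigma> * snd q - L * fst q))) (at p)"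
        by (simp add: case_prod_beta')
      have "(b has_derivative (\<lambda>(s, y). - \<sigma> * y - L * s)) (at p)"
        unfolding b_def case_prod_beta' by (auto intro!: derivative_eq_intros)
      from has_derivative_compose[OF this dP[of "b p", unfolded has_field_derivative_def]]
      have db: "((\<lambda>p. P (b p)) has_derivative (\<lambda>q. P' (b p) * (- \<sigma> * snd q - L * fst q))) (at p)"
        by (simp add: case_prod_beta')
      show ?thesis
        unfolding \<phi>_def \<phi>\<^sub>t_def \<phi>\<^sub>x_def
        by (rule has_derivative_eq_rhs[OF has_derivative_mult[OF da db]]) (auto simp: fun_eq_iff algebra_simps)
    qed
    have ab0: "a (s, x) \<le> 0 \<or> b (s, x) \<le> 0" if "0 \<le> s" "x \<notin> {-r..r}" for s x
    proof -
      have "0 \<le> L * s" using L_nonneg that by simp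
      then show ?thesis using that \<sigma> by (auto simp: a_def b_def r_def)
    qed
    have out: "\<phi> (s, x) = 0 \<and> \<phi>\<^sub>t (s, x) = 0 \<and> \<phi>\<^sub>x (s, x) = 0" if "s \<in> {0..t}" "x \<notin> {-r..r}" for s x
      using ab0[of s x] that neg by (auto simp: \<phi>_def \<phi>\<^sub>t_def \<phi>\<^sub>x_def)
    have c0: "continuous_on UNIV \<phi>" unfolding \<phi>_def by (intro continuous_intros cPab)
    have i: "integrable lborel (\<lambda>x. \<bar>w t x - 0\<bar> * \<phi> (t, x))"
    proof (rule pairing_integrable[where j = "\<lambda>a. \<bar>a - 0\<bar>" and r = r and J = K])
      show "continuous_on UNIV (\<lambda>x. \<phi> (t, x))" by (intro continuous_on_compose2[OF c0] continuous_intros) auto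
    qed (use t out[of t] in auto)
    have "(LBINT x. \<bar>w t x - 0\<bar> * \<phi> (t, x)) - (LBINT x. \<bar>w 0 x - 0\<bar> * \<phi> (0, x)) \<le> 0 * (t - 0)"
    proof (rule entropy_slab[OF order_refl t d _ _ _ out])
      show "continuous_on UNIV \<phi>\<^sub>t" "continuous_on UNIV \<phi>\<^sub>x" unfolding \<phi>\<^sub>t_def \<phi>\<^sub>x_def by (intro continuous_intros cPab)+
      show "0 \<le> \<phi> p" for p unfolding \<phi>_def using P by simp
      show "0 \<in> {-K..K}" using K_nonneg by simp
      fix s assume s: "0 < s" "s < t"
      \<comment> \<open>Both sides of the cone move inwards with speed L, so
        \<open>\<phi>\<^sub>t = - L * (S\<^sub>1 + S\<^sub>2)\<close> while
        \<open>\<bar>\<phi>\<^sub>x\<bar> \<le> S\<^sub>1 + S\<^sub>2\<close>; the flux is at most L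
        times the entropy and is absorbed.\<close>
      have "\<bar>w s x - 0\<bar> * \<phi>\<^sub>t (s, x) + kflux f (w s x) 0 * \<phi>\<^sub>x (s, x) \<le> 0" for x
      proof -
        define S\<^sub>1 S\<^sub>2 where "S\<^sub>1 = P' (a (s, x)) * P (b (s, x))" and "S\<^sub>2 = P (a (s, x)) * P' (b (s, x))"
        have S: "0 \<le> S\<^sub>1" "0 \<le> S\<^sub>2" using P by (auto simp: S\<^sub>1_def S\<^sub>2_def)
        have "kflux f (w s x) 0 * \<phi>\<^sub>x (s, x) \<le> \<bar>kflux f (w s x) 0\<bar> * \<bar>\<phi>\<^sub>x (s, x)\<bar>" by (metis abs_ge_self abs_mult)
        also have "\<dots> \<le> (L * \<bar>w s x - 0\<bar>) * (S\<^sub>1 + S\<^sub>2)"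
        proof (intro mult_mono)
          show "\<bar>kflux f (w s x) 0\<bar> \<le> L * \<bar>w s x - 0\<bar>"
            by (rule kflux_bound[OF lipschitz_flux range]) (use s K_nonneg in auto)
          show "\<bar>\<phi>\<^sub>x (s, x)\<bar> \<le> S\<^sub>1 + S\<^sub>2"
            using S \<sigma> by (auto simp: \<phi>\<^sub>x_def S\<^sub>1_def[symmetric] S\<^sub>2_def[symmetric])
        qed (use L_nonneg S in auto)
        finally show ?thesis by (simp add: \<phi>\<^sub>t_def S\<^sub>1_def S\<^sub>2_def algebra_simps)
      qed
      then have "0 \<le> (LBINT x. - (\<bar>w s x - 0\<bar> * \<phi>\<^sub>t (s, x) + kflux f (w s x) 0 * \<phi>\<^sub>x (s, x)))"
        by (intro integral_nonneg_AE AE_I2) (simp only: neg_0_le_iff_le)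
      then show "(LBINT x. \<bar>w s x - 0\<bar> * \<phi>\<^sub>t (s, x) + kflux f (w s x) 0 * \<phi>\<^sub>x (s, x)) \<le> 0"
        by (simp only: integral_minus neg_0_le_iff_le)
    qed
    moreover have "(LBINT x. \<bar>w 0 x - 0\<bar> * \<phi> (0, x)) = 0"
    proof (rule integral_eq_zero_AE)
      show "AE x in lborel. \<bar>w 0 x - 0\<bar> * \<phi> (0, x) = 0"
        using init
      proof eventually_elim
        case (elim x)
        then show ?case using neg[of "a (0, x)"] by (cases "R\<^sub>0 < \<sigma> * x") (auto simp: \<phi>_def a_def)
      qed
    qed
    moreover have nn: "0 \<le> \<bar>w t x - 0\<bar> * \<phi> (t, x)" for x unfolding \<phi>_def using P by simp
    then have "0 \<le> (LBINT x. \<bar>w t x - 0\<bar> * \<phi> (t, x))" by (intro integral_nonneg_AE) simp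
    ultimately have "(LBINT x. \<bar>w t x - 0\<bar> * \<phi> (t, x)) = 0" by linarith
    then have "AE x in lborel. \<bar>w t x - 0\<bar> * \<phi> (t, x) = 0"
      using integral_nonneg_eq_0_iff_AE[OF i] nn by simp
    then show ?thesis by (simp add: \<phi>_def a_def b_def)
  qed
  then have "AE x in lborel. \<forall>M::nat. \<bar>w t x\<bar> * (P (\<sigma> * x - R\<^sub>0 - L * t) * P (real M - \<sigma> * x - L * t)) = 0"
    unfolding AE_all_countable by blast
  then show ?thesis
  proof eventually_elim
    case (elim x)
    show ?case
    proof
      assume x: "R\<^sub>0 + L * t < \<sigma> * x"
      obtain M :: nat where "\<sigma> * x + L * t < real M" using reals_Archimedean2 by blast
      with x have "P (\<sigma> * x - R\<^sub>0 - L * t) \<noteq> 0" "P (real M - \<sigma> * x - L * t) \<noteq> 0" by (auto simp: P_def)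
      with elim show "w t x = 0" by auto
    qed
  qed
qed

lemma finite_speed:
  assumes init: "AE x in lborel. x \<notin> {-R\<^sub>0..R\<^sub>0} \<longrightarrow> w 0 x = 0" and t: "0 \<le> t"
  shows "AE x in lborel. x \<notin> {-(R\<^sub>0 + L * t)..R\<^sub>0 + L * t} \<longrightarrow> w t x = 0"
proof (cases "t = 0")
  case False
  with t have t: "0 < t" by simp
  have "AE x in lborel. R\<^sub>0 < 1 * x \<longrightarrow> w 0 x = 0" "AE x in lborel. R\<^sub>0 < -1 * x \<longrightarrow> w 0 x = 0"
    using init by (eventually_elim, auto)+
  from finite_speed_oneside[OF this(1) t] finite_speed_oneside[OF this(2) t]
  show ?thesis by auto
qed (use init in simp)

text \<open>The constant \<open>k = 0\<close> shows that \<open>\<integral>\<bar>w\<bar>\<close> does not increase, \<open>k = K\<close> that \<open>\<integral>w\<close> does not decrease.\<close>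

lemma nonneg_and_mass:
  assumes init: "AE x in lborel. x \<notin> {-R\<^sub>0..R\<^sub>0} \<longrightarrow> w 0 x = 0" "AE x in lborel. 0 \<le> w 0 x" and t: "0 \<le> t"
  shows "AE x in lborel. 0 \<le> w t x" "(LBINT x. w t x) = (LBINT x. w 0 x)"
proof -
  define R where "R = R\<^sub>0 + L * t"
  have z: "AE x in lborel. x \<notin> {-R..R} \<longrightarrow> w s x = 0" if "s \<in> {0..t}" for s
  proof -
    have "L * s \<le> L * t" using that L_nonneg by (intro mult_left_mono) auto
    then show ?thesis
      using finite_speed[OF init(1), of s] that by (auto simp: R_def elim!: eventually_mono)
  qed
  have int: "integrable lborel (w s)" if "s \<in> {0..t}" for s
  proof -
    note [measurable] = meas[of s]
    have s: "0 \<le> s" using that by simp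
    have "integrable lborel (\<lambda>x. w s x * indicator {-R..R} x)"
      by (rule integrable_bounded_support[where a = "-R" and b = R and B = K])
        (use range[OF s] s K_nonneg in \<open>auto simp: indicator_def abs_le_iff, (smt (verit))?\<close>)
    then show ?thesis
      by (rule integrable_cong_AE_imp) (use z[OF that] s in \<open>auto simp: indicator_def elim!: eventually_mono\<close>)
  qed
  obtain \<eta> \<kappa> \<kappa>' where "smooth_step 1 \<eta> \<kappa> \<kappa>'" using smooth_step_exists[of 1] by auto
  then interpret smooth_step 1 \<eta> \<kappa> \<kappa>' .
  define \<theta> where "\<theta> x = \<eta> (R + 1 - x) * \<eta> (x + R + 1)" for x
  define \<theta>' where "\<theta>' x = \<eta> (R + 1 - x) * \<kappa> (x + R + 1) - \<kappa> (R + 1 - x) * \<eta> (x + R + 1)" for x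
  have shift: "((\<lambda>x. x + R + 1) has_real_derivative 1) (at x)" "((\<lambda>x. R + 1 - x) has_real_derivative -1) (at x)" for x
    by (auto intro!: derivative_eq_intros)
  have d: "(\<theta> has_real_derivative \<theta>' x) (at x)" for x
    unfolding \<theta>_def
    by (rule DERIV_cong[OF DERIV_mult[OF DERIV_chain2[OF step_deriv shift(2)] DERIV_chain2[OF step_deriv shift(1)]]])
      (simp add: \<theta>'_def algebra_simps)
  have c: "continuous_on UNIV \<theta>'" unfolding \<theta>'_def
    by (intro continuous_intros continuous_on_compose2[OF continuous_step[of UNIV]] continuous_on_compose2[OF continuous_kernel[of UNIV]]) auto
  have nonneg: "0 \<le> \<theta> x" for x by (simp add: \<theta>_def step_nonneg)
  have out: "\<theta> x = 0" if "x \<notin> {-(R+1)..R+1}" for x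
  proof -
    have "R + 1 - x \<le> 0 \<or> x + R + 1 \<le> 0" using that by auto
    then show ?thesis by (auto simp: \<theta>_def step_left)
  qed
  have inside: "\<theta> x = 1" "\<theta>' x = 0" if "x \<in> {-R..R}" for x
    using that by (auto simp: \<theta>_def \<theta>'_def step_right kernel_outside)
  have c\<theta>: "continuous_on UNIV \<theta>" using d by (meson DERIV_isCont continuous_at_imp_continuous_on)
  have i\<theta>: "integrable lborel \<theta>"
    using pairing_integrable[of t "\<lambda>_. 1" 1 \<theta> "R + 1"] t c\<theta> out by simp
  have [measurable]: "\<theta> \<in> borel_measurable borel" "\<theta>' \<in> borel_measurable borel"
    using c c\<theta> by (auto intro: borel_measurable_continuous_onI)
  have I\<theta>': "has_bochner_integral lborel \<theta>' 0" by (rule deriv_compact_support(2)[OF d c out])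
  have tt: "0 \<in> {0..t}" "t \<in> {0..t}" using t by auto
  have A0: "(LBINT x. \<bar>w s x - 0\<bar> * \<theta> x) = (LBINT x. \<bar>w s x\<bar>)" if "s \<in> {0..t}" for s
  proof (rule integral_cong_AE)
    show "AE x in lborel. \<bar>w s x - 0\<bar> * \<theta> x = \<bar>w s x\<bar>" using z[OF that] by eventually_elim (use inside in auto)
  qed (use meas[of s] that in auto)
  have AK: "(LBINT x. \<bar>w s x - K\<bar> * \<theta> x) = (LBINT x. K * \<theta> x) - (LBINT x. w s x)" if "s \<in> {0..t}" for s
  proof -
    have "(LBINT x. \<bar>w s x - K\<bar> * \<theta> x) = (LBINT x. K * \<theta> x - w s x)"
    proof (rule integral_cong_AE)
      show "AE x in lborel. \<bar>w s x - K\<bar> * \<theta> x = K * \<theta> x - w s x"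
        using z[OF that]
      proof eventually_elim
        case (elim x)
        then show ?case using inside(1)[of x] range[of s x] that K_nonneg by (cases "x \<in> {-R..R}") auto
      qed
    qed (use meas[of s] that in auto)
    also have "\<dots> = (LBINT x. K * \<theta> x) - (LBINT x. w s x)" using i\<theta> int[OF that] by simp
    finally show ?thesis .
  qed
  \<comment> \<open>\<theta> is 1 on \<open>[-R, R]\<close>, so \<theta>' lives where
    \<open>w s\<close> is 0. There the flux is the constant \<open>kflux f 0 k\<close>, and
    \<theta>' has integral 0.\<close>
  have flux: "(LBINT x. kflux f (w s x) k * \<theta>' x) = 0" if "s \<in> {0..t}" for s k
  proof -
    have "(LBINT x. kflux f (w s x) k * \<theta>' x) = (LBINT x. kflux f 0 k * \<theta>' x)"
    proof (rule integral_cong_AE)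
      show "AE x in lborel. kflux f (w s x) k * \<theta>' x = kflux f 0 k * \<theta>' x"
        using z[OF that] by eventually_elim (use inside in auto)
    qed (use meas[of s] that in auto)
    then show ?thesis using I\<theta>' by (simp add: has_bochner_integral_iff)
  qed
  have "(AE x in lborel. 0 \<le> w t x) \<and> (LBINT x. w t x) = (LBINT x. w 0 x)"
  proof (cases "t = 0")
    case False
    with t have t: "0 < t" by simp
    have k: "0 \<in> {-K..K}" "K \<in> {-K..K}" using K_nonneg by auto
    have "(LBINT x. \<bar>w t x - 0\<bar> * \<theta> x) - (LBINT x. \<bar>w 0 x - 0\<bar> * \<theta> x) \<le> 0 * (t - 0)"
      by (rule entropy_static[OF order_refl t d c nonneg out k(1)]) (use flux in auto)
    then have 1: "(LBINT x. \<bar>w t x\<bar>) \<le> (LBINT x. \<bar>w 0 x\<bar>)" using A0 tt by simp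
    have "(LBINT x. \<bar>w t x - K\<bar> * \<theta> x) - (LBINT x. \<bar>w 0 x - K\<bar> * \<theta> x) \<le> 0 * (t - 0)"
      by (rule entropy_static[OF order_refl t d c nonneg out k(2)]) (use flux in auto)
    then have 2: "(LBINT x. w 0 x) \<le> (LBINT x. w t x)" using AK tt by simp
    have 3: "(LBINT x. \<bar>w 0 x\<bar>) = (LBINT x. w 0 x)"
      by (rule integral_cong_AE) (use init(2) meas[of 0] in auto)
    have 4: "(LBINT x. w t x) \<le> (LBINT x. \<bar>w t x\<bar>)" using int[OF tt(2)] by (intro integral_mono) auto
    have i: "integrable lborel (\<lambda>x. \<bar>w t x\<bar> - w t x)" using int[OF tt(2)] by auto
    \<comment> \<open>The chain \<open>\<integral>w 0 \<le> \<integral>w t \<le> \<integral>\<bar>w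
      t\<bar> \<le> \<integral>\<bar>w 0\<bar> = \<integral>w 0\<close> closes up; equality gives
      conservation of mass and, almost everywhere, the sign.\<close>
    have "(LBINT x. \<bar>w t x\<bar> - w t x) = 0" using 1 2 3 4 int[OF tt(2)] by simp
    then have "AE x in lborel. \<bar>w t x\<bar> - w t x = 0" using integral_nonneg_eq_0_iff_AE[OF i] by simp
    moreover have "(LBINT x. w t x) = (LBINT x. w 0 x)" using 1 2 3 4 by linarith
    ultimately show ?thesis by auto
  qed (use init in auto)
  then show "AE x in lborel. 0 \<le> w t x" "(LBINT x. w t x) = (LBINT x. w 0 x)" by blast+
qed

text \<open>Taking the positive part and restricting to the region reached at finite speed by time T
  changes each slice only on a null set, by the two preceding results, and makes range and support
  hold everywhere.\<close>

lemma kruzhkov_curve_representative: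
  assumes init: "AE x in lborel. x \<notin> {-R\<^sub>0..R\<^sub>0} \<longrightarrow> w 0 x = 0" "AE x in lborel. 0 \<le> w 0 x" "(LBINT x. w 0 x) = 1"
    and "0 \<le> R\<^sub>0" "0 \<le> T" and f0: "f 0 = 0"
  defines "R \<equiv> R\<^sub>0 + L * T"
  defines "u \<equiv> \<lambda>t x. max 0 (w t x) * indicator {-R..R} x"
  shows "kruzhkov_curve f K L R T u" "\<And>t. t \<in> {0..T} \<Longrightarrow> AE x in lborel. u t x = w t x"
proof -
  have um: "u t \<in> borel_measurable borel" if "t \<in> {0..T}" for t
    using meas[of t] that unfolding u_def by auto
  show eq: "AE x in lborel. u t x = w t x" if t: "t \<in> {0..T}" for t
  proof -
    have t0: "0 \<le> t" using t by simp
    have "L * t \<le> L * T" using t L_nonneg by (intro mult_left_mono) auto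
    show ?thesis
      using finite_speed[OF init(1) t0] nonneg_and_mass(1)[OF init(1,2) t0]
    proof eventually_elim
      case (elim x)
      then show ?case using \<open>L * t \<le> L * T\<close> by (auto simp: u_def R_def indicator_def)
    qed
  qed
  have R0: "0 \<le> R" using assms(4,5) L_nonneg by (simp add: R_def)
  have range_u: "u t x \<in> {0..K}" if "t \<in> {0..T}" for t x
    using range[of t x] that K_nonneg by (auto simp: u_def indicator_def)
  have supp: "u t x = 0" if "x \<notin> {-R..R}" for t x using that by (simp add: u_def)
  have iu: "integrable lborel (u t)" if "t \<in> {0..T}" for t
    by (rule integrable_bounded_support[where a = "-R" and b = R and B = K]) (use um[OF that] range_u[OF that] supp in auto)
  have L1: "\<exists>h>0. \<forall>t\<in>{0..T}. \<bar>t - s\<bar> < h \<longrightarrow> (LBINT x. \<bar>u t x - u s x\<bar>) < \<epsilon>" if s: "s \<in> {0..T}" and "0 < \<epsilon>" for s \<epsilon>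
  proof -
    have s0: "0 \<le> s" using s by simp
    have "\<forall>\<^sub>F t in at s within {0..}. (LBINT x. \<bar>w t x - w s x\<bar> * indicator {-R..R} x) < \<epsilon>"
      using order_tendstoD(2)[OF L1_continuous[OF s0] \<open>0 < \<epsilon>\<close>] .
    then obtain d where d: "0 < d" "\<And>t. 0 \<le> t \<Longrightarrow> t \<noteq> s \<Longrightarrow> dist t s < d \<Longrightarrow> (LBINT x. \<bar>w t x - w s x\<bar> * indicator {-R..R} x) < \<epsilon>"
      unfolding eventually_at by auto
    show ?thesis
    proof (intro exI[of _ d] conjI ballI impI)
      fix t assume t: "t \<in> {0..T}" "\<bar>t - s\<bar> < d"
      show "(LBINT x. \<bar>u t x - u s x\<bar>) < \<epsilon>"
      proof (cases "t = s")
        case False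
        note [measurable] = um[OF t(1)] um[OF s] meas[of t] meas[of s]
        have "(LBINT x. \<bar>u t x - u s x\<bar>) = (LBINT x. \<bar>w t x - w s x\<bar> * indicator {-R..R} x)"
        proof (rule integral_cong_AE)
          show "AE x in lborel. \<bar>u t x - u s x\<bar> = \<bar>w t x - w s x\<bar> * indicator {-R..R} x"
            using eq[OF t(1)] eq[OF s]
          proof eventually_elim
            case (elim x)
            then show ?case using supp[of x] by (cases "x \<in> {-R..R}") auto
          qed
        qed (use t s in auto)
        also have "\<dots> < \<epsilon>" using d(2)[of t] t False by (auto simp: dist_real_def)
        finally show ?thesis .
      qed (use \<open>0 < \<epsilon>\<close> in simp)
    qed (rule d(1))
  qed
  show "kruzhkov_curve f K L R T u"
  proof
    show "\<bar>f a - f b\<bar> \<le> L * \<bar>a - b\<bar>" if "a \<in> {0..K}" "b \<in> {0..K}" for a b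
      using that by (intro lipschitz_flux) auto
    show "(LBINT x. u t x) = 1" if "t \<in> {0..T}" for t
    proof -
      have "(LBINT x. u t x) = (LBINT x. w t x)"
        by (rule integral_cong_AE) (use eq[OF that] um[OF that] meas[of t] that in auto)
      then show ?thesis using nonneg_and_mass(2)[OF init(1,2), of t] init(3) that by simp
    qed
    show "\<exists>h>0. \<forall>s\<in>{0..T}. \<forall>t\<in>{0..T}. \<bar>s - t\<bar> < h \<longrightarrow> (LBINT x. \<bar>u s x - u t x\<bar>) < \<epsilon>" if "0 < \<epsilon>" for \<epsilon>
    proof -
      have "\<exists>h>0. \<forall>t\<in>{0..T}. \<bar>t - s\<bar> < h \<longrightarrow> (LBINT x. \<bar>u t x - u s x\<bar>) < \<epsilon> / 2" if "s \<in> {0..T}" for s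
        by (rule L1[OF that]) (use \<open>0 < \<epsilon>\<close> in simp)
      then obtain h where h: "\<And>s. s \<in> {0..T} \<Longrightarrow> 0 < h s"
        "\<And>s t. s \<in> {0..T} \<Longrightarrow> t \<in> {0..T} \<Longrightarrow> \<bar>t - s\<bar> < h s \<Longrightarrow> (LBINT x. \<bar>u t x - u s x\<bar>) < \<epsilon> / 2" by metis
      \<comment> \<open>Balls of half the radius: if s is in the half ball around c and t is closer
        to s than half of \<open>h c\<close>, then both times are within \<open>h c\<close> of the
        same centre, which makes the pointwise continuity uniform.\<close>
      obtain S where S: "S \<subseteq> {0..T}" "finite S" "{0..T} \<subseteq> (\<Union>s\<in>S. ball s (h s / 2))"
        by (rule compactE_image[of "{0..T}" "{0..T}" "\<lambda>s. ball s (h s / 2)"]) (use h in auto)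
      define d where "d = Min (insert 1 ((\<lambda>s. h s / 2) ` S))"
      have d: "0 < d" using S h by (auto simp: d_def)
      have d_le: "d \<le> h s / 2" if "s \<in> S" for s unfolding d_def by (rule Min_le) (use S that in auto)
      show ?thesis
      proof (intro exI[of _ d] conjI ballI impI)
        fix s t assume st: "s \<in> {0..T}" "t \<in> {0..T}" "\<bar>s - t\<bar> < d"
        obtain c where c: "c \<in> S" "\<bar>c - s\<bar> < h c / 2" using S(3) st(1) by (auto simp: dist_real_def)
        have cT: "c \<in> {0..T}" using c S by auto
        have "\<bar>s - c\<bar> < h c" "\<bar>t - c\<bar> < h c" using c d_le[OF c(1)] st by linarith+
        from h(2)[OF cT st(1) this(1)] h(2)[OF cT st(2) this(2)]
        have "(LBINT x. \<bar>u s x - u c x\<bar>) + (LBINT x. \<bar>u t x - u c x\<bar>) < \<epsilon>" by simp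
        moreover have "(LBINT x. \<bar>u s x - u t x\<bar>) \<le> (LBINT x. \<bar>u s x - u c x\<bar> + \<bar>u t x - u c x\<bar>)"
          using iu[OF st(1)] iu[OF st(2)] iu[OF cT] by (intro integral_mono) auto
        moreover have "\<dots> = (LBINT x. \<bar>u s x - u c x\<bar>) + (LBINT x. \<bar>u t x - u c x\<bar>)"
          using iu[OF st(1)] iu[OF st(2)] iu[OF cT] by simp
        ultimately show "(LBINT x. \<bar>u s x - u t x\<bar>) < \<epsilon>" by linarith
      qed (rule d)
    qed
    fix t\<^sub>1 t\<^sub>2 k b r :: real and \<theta> \<theta>' :: "real \<Rightarrow> real"
    assume t12: "0 \<le> t\<^sub>1" "t\<^sub>1 < t\<^sub>2" "t\<^sub>2 \<le> T" and k: "k \<in> {0..K}"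
      and d: "\<And>x. (\<theta> has_real_derivative \<theta>' x) (at x)" and c: "continuous_on UNIV \<theta>'"
      and nonneg: "\<And>x. 0 \<le> \<theta> x" and out: "\<And>x. x \<notin> {-r..r} \<Longrightarrow> \<theta> x = 0"
      and b: "\<And>\<tau>. t\<^sub>1 < \<tau> \<Longrightarrow> \<tau> < t\<^sub>2 \<Longrightarrow> (LBINT x. kflux f (u \<tau> x) k * \<theta>' x) \<le> b"
    have c\<theta>: "continuous_on UNIV \<theta>" using d by (meson DERIV_isCont continuous_at_imp_continuous_on)
    note [measurable] = borel_measurable_continuous_onI[OF c] borel_measurable_continuous_onI[OF c\<theta>]
    have tr: "(LBINT x. \<bar>u t x - k\<bar> * \<theta> x) = (LBINT x. \<bar>w t x - k\<bar> * \<theta> x)"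
      "(LBINT x. kflux f (u t x) k * \<theta>' x) = (LBINT x. kflux f (w t x) k * \<theta>' x)" if "t \<in> {0..T}" for t
    proof -
      have t0: "0 \<le> t" using that by simp
      note [measurable] = um[OF that] meas[OF t0]
      show "(LBINT x. \<bar>u t x - k\<bar> * \<theta> x) = (LBINT x. \<bar>w t x - k\<bar> * \<theta> x)"
        "(LBINT x. kflux f (u t x) k * \<theta>' x) = (LBINT x. kflux f (w t x) k * \<theta>' x)"
        by (rule integral_cong_AE; use eq[OF that] in \<open>auto elim!: eventually_mono\<close>)+
    qed
    have "(LBINT x. \<bar>w t\<^sub>2 x - k\<bar> * \<theta> x) - (LBINT x. \<bar>w t\<^sub>1 x - k\<bar> * \<theta> x) \<le> b * (t\<^sub>2 - t\<^sub>1)"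
      by (rule entropy_static[OF t12(1,2) d c nonneg out]) (use k tr(2) b t12 in auto)
    then show "(LBINT x. \<bar>u t\<^sub>2 x - k\<bar> * \<theta> x) - (LBINT x. \<bar>u t\<^sub>1 x - k\<bar> * \<theta> x) \<le> b * (t\<^sub>2 - t\<^sub>1)"
      using tr(1) t12 by simp
  qed (use continuous_flux f0 R0 L_nonneg um range_u supp in auto)
qed

end

section \<open>Distribution functions and quantiles\<close>

text \<open>Slopes of a convex function increase, so every slope inside \<open>[-K, K]\<close> lies
  between slopes over unit intervals adjacent to the two points. The latter are at most
  \<open>2 * \<bar>M\<bar>\<close> when M bounds \<open>f\<close> on
  \<open>[-K-1, K+1]\<close>.\<close>

lemma convex_on_UNIV_lipschitz:
  fixes f :: "real \<Rightarrow> real"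
  assumes f: "convex_on UNIV f"
  obtains L where "0 \<le> L" "\<And>a b. a \<in> {-K..K} \<Longrightarrow> b \<in> {-K..K} \<Longrightarrow> \<bar>f a - f b\<bar> \<le> L * \<bar>a - b\<bar>"
proof -
  have c: "continuous_on UNIV f" using f by (intro convex_on_continuous) auto
  have "bounded (f ` {-K-1..K+1})"
    by (intro compact_imp_bounded compact_continuous_image continuous_on_subset[OF c]) auto
  then obtain M where "\<forall>y\<in>f ` {-K-1..K+1}. norm y \<le> M" unfolding bounded_iff by blast
  then have M: "\<bar>f x\<bar> \<le> M" if "x \<in> {-K-1..K+1}" for x using that by auto
  have less: "\<bar>f a - f b\<bar> \<le> (2 * \<bar>M\<bar>) * \<bar>a - b\<bar>" if "a \<in> {-K..K}" "b \<in> {-K..K}" "a < b" for a b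
  proof -
    note slope = convex_on_slope_le[OF f UNIV_I UNIV_I]
    define q where "q = (f a - f b) / (a - b)"
    have 1: "q \<le> (f b - f (b + 1)) / (b - (b + 1))" unfolding q_def
      by (rule order_trans[OF slope(1,2)]) (use that in auto)
    have 2: "(f (a - 1) - f a) / ((a - 1) - a) \<le> q" unfolding q_def
      by (rule order_trans[OF slope(1,2)]) (use that in auto)
    from 1 2 have "q \<le> f (b + 1) - f b" "f a - f (a - 1) \<le> q" by simp_all
    moreover have "\<bar>f a\<bar> \<le> M" "\<bar>f b\<bar> \<le> M" "\<bar>f (b + 1)\<bar> \<le> M" "\<bar>f (a - 1)\<bar> \<le> M"
      using that by (auto intro!: M)
    ultimately have "\<bar>q\<bar> \<le> 2 * \<bar>M\<bar>" by linarith
    then have "\<bar>q\<bar> * \<bar>a - b\<bar> \<le> 2 * \<bar>M\<bar> * \<bar>a - b\<bar>" by (rule mult_right_mono) simp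
    moreover have "q * (a - b) = f a - f b" using that by (simp add: q_def)
    ultimately show ?thesis by (simp flip: abs_mult)
  qed
  show thesis
  proof (rule that[of "2 * \<bar>M\<bar>"])
    fix a b assume "a \<in> {-K..K}" "b \<in> {-K..K}"
    then show "\<bar>f a - f b\<bar> \<le> (2 * \<bar>M\<bar>) * \<bar>a - b\<bar>"
      using less[of a b] less[of b a] by (cases a b rule: linorder_cases) (auto simp: abs_minus_commute)
  qed simp
qed

lemma kruzhkov_curve_mono_radius:
  assumes "kruzhkov_curve f K L R T u" "R \<le> R'" shows "kruzhkov_curve f K L R' T u"
proof -
  interpret kruzhkov_curve f K L R T u by fact
  show ?thesis
  proof
    show "u t x = 0" if "t \<in> {0..T}" "x \<notin> {-R'..R'}" for t x
      using that assms(2) by (intro curve_support) auto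
    show "0 \<le> R'" using radius_nonneg assms(2) by simp
  qed (fact flux_continuous flux_0 flux_lipschitz lipschitz_nonneg curve_measurable curve_range curve_mass
      curve_uniform curve_entropy)+
qed

text \<open>Translation invariance of the equation: the entropy inequality of the shifted curve is
  that of the original curve for the test function shifted the opposite way. The radius grows by
  \<open>\<bar>d\<bar>\<close>.\<close>

lemma kruzhkov_curve_shift:
  assumes "kruzhkov_curve f K L R T u" shows "kruzhkov_curve f K L (R + \<bar>d\<bar>) T (\<lambda>t x. u t (x + d))"
proof -
  interpret kruzhkov_curve f K L R T u by fact
  have tr: "(LBINT x. g (x + d)) = (LBINT x. g x)" for g :: "real \<Rightarrow> real"
    using LBINT_translate[of g "-d"] by simp
  show ?thesis
  proof
    show "(\<lambda>x. u t (x + d)) \<in> borel_measurable borel" if "t \<in> {0..T}" for t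
      using curve_measurable[OF that] by measurable
    show "u t (x + d) = 0" if "t \<in> {0..T}" "x \<notin> {- (R + \<bar>d\<bar>)..R + \<bar>d\<bar>}" for t x
      using that by (intro curve_support) auto
    show "(LBINT x. u t (x + d)) = 1" if "t \<in> {0..T}" for t using tr[of "u t"] curve_mass[OF that] by simp
    show "\<exists>h>0. \<forall>s\<in>{0..T}. \<forall>t\<in>{0..T}. \<bar>s - t\<bar> < h \<longrightarrow> (LBINT x. \<bar>u s (x + d) - u t (x + d)\<bar>) < \<epsilon>" if "0 < \<epsilon>" for \<epsilon>
      unfolding tr[of "\<lambda>x. \<bar>u _ x - u _ x\<bar>"] using curve_uniform[OF that] .
    fix t\<^sub>1 t\<^sub>2 k b r :: real and \<theta> \<theta>' :: "real \<Rightarrow> real"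
    assume t12: "0 \<le> t\<^sub>1" "t\<^sub>1 < t\<^sub>2" "t\<^sub>2 \<le> T" and k: "k \<in> {0..K}"
      and der: "\<And>x. (\<theta> has_real_derivative \<theta>' x) (at x)" and c: "continuous_on UNIV \<theta>'"
      and nonneg: "\<And>x. 0 \<le> \<theta> x" and out: "\<And>x. x \<notin> {-r..r} \<Longrightarrow> \<theta> x = 0"
      and b: "\<And>\<tau>. t\<^sub>1 < \<tau> \<Longrightarrow> \<tau> < t\<^sub>2 \<Longrightarrow> (LBINT x. kflux f (u \<tau> (x + d)) k * \<theta>' x) \<le> b"
    have "(LBINT x. \<bar>u t\<^sub>2 x - k\<bar> * \<theta> (x - d)) - (LBINT x. \<bar>u t\<^sub>1 x - k\<bar> * \<theta> (x - d)) \<le> b * (t\<^sub>2 - t\<^sub>1)"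
    proof (rule curve_entropy[OF t12 k])
      show "((\<lambda>x. \<theta> (x - d)) has_real_derivative \<theta>' (x - d)) (at x)" for x
        using DERIV_chain2[where f = \<theta> and g = "\<lambda>x. x - d", OF der DERIV_diff[OF DERIV_ident DERIV_const]] by simp
      show "continuous_on UNIV (\<lambda>x. \<theta>' (x - d))" by (intro continuous_on_compose2[OF c] continuous_intros) auto
      show "\<theta> (x - d) = 0" if "x \<notin> {- (r + \<bar>d\<bar>)..r + \<bar>d\<bar>}" for x using that by (intro out) auto
      show "(LBINT x. kflux f (u \<tau> x) k * \<theta>' (x - d)) \<le> b" if "t\<^sub>1 < \<tau>" "\<tau> < t\<^sub>2" for \<tau>
        using b[OF that] tr[of "\<lambda>x. kflux f (u \<tau> x) k * \<theta>' (x - d)"] by simp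
    qed (rule nonneg)
    then show "(LBINT x. \<bar>u t\<^sub>2 (x + d) - k\<bar> * \<theta> x) - (LBINT x. \<bar>u t\<^sub>1 (x + d) - k\<bar> * \<theta> x) \<le> b * (t\<^sub>2 - t\<^sub>1)"
      using tr[of "\<lambda>x. \<bar>u t\<^sub>2 x - k\<bar> * \<theta> (x - d)"] tr[of "\<lambda>x. \<bar>u t\<^sub>1 x - k\<bar> * \<theta> (x - d)"] by simp
  qed (use flux_continuous flux_0 flux_lipschitz lipschitz_nonneg radius_nonneg curve_range in auto)
qed

section \<open>Quantiles and the translation between \<open>W_inf\<close> and ordered distribution
  functions\<close>

context kruzhkov_curve begin

lemma cdf_shift: "kruzhkov_curve.cdf (\<lambda>t x. u t (x + d)) t x = cdf t (x + d)"
proof -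
  interpret shifted: kruzhkov_curve f K L "R + \<bar>d\<bar>" T "\<lambda>t x. u t (x + d)"
    using kruzhkov_curve_axioms by (rule kruzhkov_curve_shift)
  have "(LBINT z. u t z * indicator {..x + d} z) = (LBINT z. u t (z + d) * indicator {..x + d} (z + d))"
    using LBINT_translate[of "\<lambda>z. u t z * indicator {..x + d} z" "-d"] by simp
  then show ?thesis unfolding cdf_def shifted.cdf_def by (simp add: indicator_def)
qed

lemma cdf_left: assumes "t \<in> {0..T}" "x < -R" shows "cdf t x = 0"
  unfolding cdf_def using curve_support[OF assms(1)] assms(2)
  by (intro integral_eq_zero_AE AE_I2) (auto simp: indicator_def)

lemma cdf_right: assumes "t \<in> {0..T}" "R \<le> x" shows "cdf t x = 1"
proof -
  have "u t z * indicator {..x} z = u t z" for z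
    using curve_support[OF assms(1), of z] assms(2) by (auto simp: indicator_def)
  then show ?thesis by (simp only: cdf_def curve_mass[OF assms(1)])
qed

lemma cdf_bounds: assumes "t \<in> {0..T}" shows "0 \<le> cdf t x" "cdf t x \<le> 1"
  using cdf_mono[OF assms, of "min x (-R - 1)" x] cdf_left[OF assms, of "min x (-R - 1)"]
    cdf_mono[OF assms, of x "max x R"] cdf_right[OF assms, of "max x R"] by auto

definition quantile :: "real \<Rightarrow> real \<Rightarrow> real" where
  "quantile t \<xi> = Inf {x. cdf t x > \<xi>}"

lemma quantile_set:
  assumes t: "t \<in> {0..T}" and \<xi>: "0 \<le> \<xi>" "\<xi> < 1"
  shows "R \<in> {x. cdf t x > \<xi>}" "\<And>x. x \<in> {x. cdf t x > \<xi>} \<Longrightarrow> - R \<le> x" "bdd_below {x. cdf t x > \<xi>}"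
proof -
  show "R \<in> {x. cdf t x > \<xi>}" using cdf_right[OF t, of R] \<xi> by simp
  show *: "- R \<le> x" if "x \<in> {x. cdf t x > \<xi>}" for x using cdf_left[OF t, of x] that \<xi> by force
  show "bdd_below {x. cdf t x > \<xi>}" by (rule bdd_belowI[OF *])
qed

lemma quantile_bounds:
  assumes t: "t \<in> {0..T}" and \<xi>: "0 \<le> \<xi>" "\<xi> < 1"
  shows "- R \<le> quantile t \<xi>" "quantile t \<xi> \<le> R"
proof -
  note q = quantile_set[OF assms]
  show "- R \<le> quantile t \<xi>" unfolding quantile_def by (rule cInf_greatest) (use q in auto)
  show "quantile t \<xi> \<le> R" unfolding quantile_def by (rule cInf_lower) (use q in auto)
qed

lemma quantile_mono:
  assumes t: "t \<in> {0..T}" and \<xi>: "0 \<le> \<xi>" "\<xi> \<le> \<zeta>" "\<zeta> < 1"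
  shows "quantile t \<xi> \<le> quantile t \<zeta>"
  unfolding quantile_def
proof (rule cInf_superset_mono)
  show "{x. cdf t x > \<zeta>} \<noteq> {}" using quantile_set(1)[OF t, of \<zeta>] \<xi> by auto
  show "bdd_below {x. cdf t x > \<xi>}" using quantile_set(3)[OF t, of \<xi>] \<xi> by auto
qed (use \<xi> in auto)

lemma quantile_measurable:
  assumes t: "t \<in> {0..T}" shows "quantile t \<in> borel_measurable (lebesgue_on {0..1})"
proof -
  \<comment> \<open>The quantile is monotone on \<open>[0, 1)\<close> only, the defining set being
    empty at 1. Continuing it by its bounds \<open>-R\<close> and \<open>R\<close> gives a monotone
    function on the whole line; the single point 1 is patched afterwards.\<close>
  define g where "g \<xi> = (if \<xi> < 0 then - R else if \<xi> < 1 then quantile t \<xi> else R)" for \<xi>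
  have "mono g"
    unfolding mono_def g_def using quantile_mono[OF t] quantile_bounds[OF t] radius_nonneg by auto
  then have [measurable]: "g \<in> borel_measurable borel" by (rule borel_measurable_mono)
  have "(\<lambda>\<xi>. if \<xi> = 1 then quantile t 1 else g \<xi>) \<in> borel_measurable borel" by measurable
  then have "(\<lambda>\<xi>. if \<xi> = 1 then quantile t 1 else g \<xi>) \<in> borel_measurable lebesgue"
    by (intro measurable_completion) simp
  then have "(\<lambda>\<xi>. if \<xi> = 1 then quantile t 1 else g \<xi>) \<in> borel_measurable (lebesgue_on {0..1})"
    by (rule measurable_restrict_space1)
  then show ?thesis
    by (rule measurable_cong[THEN iffD1, rotated -1]) (auto simp: g_def)
qed

end

text \<open>If the inequality failed, every level \<xi> strictly between the two values would have
  u-quantile at most x, while the v-quantile would exceed \<open>x + r\<close>. The excess is strict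
  because a K-Lipschitz distribution function needs a further length \<open>(\<xi> - a) / K\<close>
  to climb from a to \<xi>. An interval of levels has positive measure, contradicting the almost
  everywhere bound.\<close>

lemma cdf_le_shift_of_quantile:
  assumes U: "kruzhkov_curve f K L R T u" and V: "kruzhkov_curve f K L R T v" and t: "t \<in> {0..T}"
    and q: "AE \<xi> in lebesgue_on {0..1}. \<bar>kruzhkov_curve.quantile u t \<xi> - kruzhkov_curve.quantile v t \<xi>\<bar> \<le> r"
  shows "kruzhkov_curve.cdf u t x \<le> kruzhkov_curve.cdf v t (x + r)"
proof (rule ccontr)
  interpret u: kruzhkov_curve f K L R T u by fact
  interpret v: kruzhkov_curve f K L R T v by fact
  define a b where "a = v.cdf t (x + r)" and "b = u.cdf t x"
  assume "\<not> u.cdf t x \<le> v.cdf t (x + r)"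
  then have ab: "a < b" by (simp add: a_def b_def)
  have a0: "0 \<le> a" and b1: "b \<le> 1" using u.cdf_bounds[OF t] v.cdf_bounds[OF t] by (auto simp: a_def b_def)
  \<comment> \<open>Unit mass excludes \<open>K = 0\<close>, so dividing by the Lipschitz constant
    is legitimate.\<close>
  have K: "0 < K"
  proof (rule ccontr)
    assume "\<not> 0 < K"
    then have "K = 0" using u.bound_nonneg[OF t] by simp
    then have "v t z = 0" for z using v.curve_range[OF t, of z] by simp
    then show False using v.curve_mass[OF t] by simp
  qed
  have big: "r < \<bar>u.quantile t \<xi> - v.quantile t \<xi>\<bar>" if \<xi>: "a < \<xi>" "\<xi> < b" for \<xi>
  proof -
    have \<xi>01: "0 \<le> \<xi>" "\<xi> < 1" using \<xi> a0 b1 by auto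
    have "u.quantile t \<xi> \<le> x"
      unfolding u.quantile_def by (rule cInf_lower) (use \<xi> u.quantile_set(3)[OF t \<xi>01] in \<open>auto simp: b_def\<close>)
    moreover have "x + r + (\<xi> - a) / K \<le> v.quantile t \<xi>"
      unfolding v.quantile_def
    proof (rule cInf_greatest)
      show "{x. \<xi> < v.cdf t x} \<noteq> {}" using v.quantile_set(1)[OF t \<xi>01] by auto
      fix z assume z: "z \<in> {x. \<xi> < v.cdf t x}"
      have "x + r \<le> z"
        using z \<xi>(1) v.cdf_mono[OF t, of z "x + r"] unfolding a_def by (cases "x + r \<le> z") auto
      then have "v.cdf t z - a \<le> K * (z - (x + r))" unfolding a_def by (rule v.cdf_lipschitz[OF t])
      with z have "\<xi> - a \<le> (z - (x + r)) * K" by (simp add: mult.commute)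
      then have "(\<xi> - a) / K \<le> z - (x + r)" using K by (simp add: pos_divide_le_eq)
      then show "x + r + (\<xi> - a) / K \<le> z" by simp
    qed
    moreover have "0 < (\<xi> - a) / K" using \<xi> K by simp
    ultimately show ?thesis by linarith
  qed
  have "AE \<xi> in lebesgue. \<xi> \<in> {0..1} \<longrightarrow> \<bar>u.quantile t \<xi> - v.quantile t \<xi>\<bar> \<le> r"
    using q by (subst (asm) AE_restrict_space_iff) auto
  then have "AE \<xi> in lborel. \<xi> \<notin> {a<..<b}"
    unfolding AE_completion_iff
  proof eventually_elim
    case (elim \<xi>)
    show ?case
    proof
      assume "\<xi> \<in> {a<..<b}"
      with big[of \<xi>] elim a0 b1 show False by auto
    qed
  qed
  then have "emeasure lborel {a<..<b} = 0"
    by (subst (asm) AE_iff_measurable[where N = "{a<..<b}"]) auto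
  then show False using ab by (simp add: emeasure_lborel_Ioo)
qed

lemma quantile_diff_le_of_cdf:
  assumes U: "kruzhkov_curve f K L R T u" and V: "kruzhkov_curve f K L R T v" and t: "t \<in> {0..T}"
    and le: "\<And>x. kruzhkov_curve.cdf u t x \<le> kruzhkov_curve.cdf v t (x + r)" and \<xi>: "0 \<le> \<xi>" "\<xi> < 1"
  shows "kruzhkov_curve.quantile v t \<xi> \<le> kruzhkov_curve.quantile u t \<xi> + r"
proof -
  interpret u: kruzhkov_curve f K L R T u by fact
  interpret v: kruzhkov_curve f K L R T v by fact
  have "v.quantile t \<xi> - r \<le> u.quantile t \<xi>"
    unfolding u.quantile_def
  proof (rule cInf_greatest)
    show "{x. \<xi> < u.cdf t x} \<noteq> {}" using u.quantile_set(1)[OF t \<xi>] by auto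
    fix x assume "x \<in> {x. \<xi> < u.cdf t x}"
    then have "x + r \<in> {x. \<xi> < v.cdf t x}" using le[of x] by auto
    then have "v.quantile t \<xi> \<le> x + r"
      unfolding v.quantile_def using v.quantile_set(3)[OF t \<xi>] by (rule cInf_lower)
    then show "v.quantile t \<xi> - r \<le> x" by simp
  qed
  then show ?thesis by simp
qed

section \<open>Borel representatives of entropy solutions\<close>

lemma ess_supp_AE: "AE x in lebesgue. x \<notin> ess_supp u \<longrightarrow> u x = 0"
proof -
  define \<A> where "\<A> = {A. open A \<and> (AE x in lebesgue. x \<in> A \<longrightarrow> u x = 0)}"
  \<comment> \<open>The union of all open sets on which u vanishes almost everywhere may be
    uncountable; by Lindelof a countable subfamily has the same union, and countably many null sets
    can be discarded.\<close>
  obtain \<B> where B: "\<B> \<subseteq> \<A>" "countable \<B>" "\<Union>\<B> = \<Union>\<A>"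
    using Lindelof[of \<A>] by (auto simp: \<A>_def)
  have "AE x in lebesgue. \<forall>A\<in>\<B>. x \<in> A \<longrightarrow> u x = 0"
    by (subst AE_ball_countable[OF B(2)]) (use B(1) in \<open>auto simp: \<A>_def\<close>)
  then show ?thesis
  proof eventually_elim
    case (elim x)
    then show ?case using B(3) unfolding ess_supp_def \<A>_def by auto
  qed
qed

text \<open>The bridge from the completed measure of the definitions to Borel measure, on which
  product measures and Fubini are used.\<close>

lemma lebesgue_integral_eq_LBINT:
  fixes g h :: "real \<Rightarrow> real"
  assumes "h \<in> borel_measurable lebesgue" and g: "g \<in> borel_measurable borel" and "AE x in lborel. h x = g x"
  shows "(LINT x|lebesgue. h x) = (LBINT x. g x)"
proof -
  have "(LINT x|lebesgue. h x) = (LINT x|lebesgue. g x)"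
    by (rule integral_cong_AE) (use assms in \<open>auto intro: measurable_completion AE_completion\<close>)
  then show ?thesis using integral_completion[of g lborel] g by simp
qed

text \<open>Each slice is replaced by a Borel function clamped to \<open>[-K, K]\<close>. The
  exceptional null set may depend on t: every clause of the definition sees the solution only
  through single slices or integrals over x at a fixed time, so all of them survive the
  change.\<close>

lemma entropy_solution_representative:
  assumes sol: "entropy_solution f w\<^sub>0 w" and f: "continuous_on UNIV f" "f 0 = 0"
    and lip: "\<And>a b. a \<in> {-K..K} \<Longrightarrow> b \<in> {-K..K} \<Longrightarrow> \<bar>f a - f b\<bar> \<le> L * \<bar>a - b\<bar>" "0 \<le> L"
    and K: "0 \<le> K" "\<And>t. 0 \<le> t \<Longrightarrow> Linf_norm lebesgue (w t) \<le> ereal K"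
    and dens: "w\<^sub>0 \<in> densities" and "0 \<le> T"
  obtains R w' where "kruzhkov_curve f K L R T w'" "\<And>t. t \<in> {0..T} \<Longrightarrow> AE x in lborel. w' t x = w t x"
proof -
  have m: "w t \<in> borel_measurable lebesgue" if "0 \<le> t" for t using sol that by (simp add: entropy_solution_def)
  have "\<exists>g. 0 \<le> t \<longrightarrow> g \<in> borel_measurable borel \<and> (AE x in lborel. w t x = g x)" for t
    using completion_ex_borel_measurable_real[OF m[of t]] by auto
  then obtain g where g: "\<And>t. 0 \<le> t \<Longrightarrow> g t \<in> borel_measurable borel" "\<And>t. 0 \<le> t \<Longrightarrow> AE x in lborel. w t x = g t x"
    by metis
  define w' where "w' t x = max (- K) (min K (g t x))" for t x
  have m': "w' t \<in> borel_measurable borel" if "0 \<le> t" for t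
    using g(1)[OF that] unfolding w'_def by measurable
  have eq: "AE x in lborel. w t x = w' t x" if t: "0 \<le> t" for t
  proof -
    have "AE x in lebesgue. ereal \<bar>w t x\<bar> \<le> Linf_norm lebesgue (w t)"
      unfolding Linf_norm_def by (rule esssup_AE)
    then have "AE x in lborel. ereal \<bar>w t x\<bar> \<le> Linf_norm lebesgue (w t)" by (simp add: AE_completion_iff)
    then show ?thesis using g(2)[OF t]
    proof eventually_elim
      case (elim x)
      then have "ereal \<bar>w t x\<bar> \<le> ereal K" using K(2)[OF t] by (meson order_trans)
      then show ?case using elim(2) by (auto simp: w'_def)
    qed
  qed
  interpret entropy_curve f K L w'
  proof
    show "w' t x \<in> {-K..K}" for t x using K(1) by (auto simp: w'_def)
    show "((\<lambda>t. LBINT x. \<bar>w' t x - w' s x\<bar> * indicator {-R..R} x) \<longlongrightarrow> 0) (at s within {0..})" if s: "0 \<le> s" for s R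
    proof -
      have lim: "((\<lambda>t. LINT x:{-R..R}|lebesgue. \<bar>w t x - w s x\<bar>) \<longlongrightarrow> 0) (at s within {0..})"
        using sol s by (simp add: entropy_solution_def)
      have same: "(LINT x:{-R..R}|lebesgue. \<bar>w t x - w s x\<bar>) = (LBINT x. \<bar>w' t x - w' s x\<bar> * indicator {-R..R} x)" if t: "0 \<le> t" for t
        unfolding set_lebesgue_integral_def
      proof (rule lebesgue_integral_eq_LBINT)
        note [measurable] = m[OF s] m[OF t] m'[OF s] m'[OF t]
        show "(\<lambda>x. indicat_real {-R..R} x *\<^sub>R \<bar>w t x - w s x\<bar>) \<in> borel_measurable lebesgue"
          by (intro borel_measurable_scaleR borel_measurable_indicator borel_measurable_abs borel_measurable_diff m s t) simp
        show "(\<lambda>x. \<bar>w' t x - w' s x\<bar> * indicat_real {-R..R} x) \<in> borel_measurable borel" by measurable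
        show "AE x in lborel. indicat_real {-R..R} x *\<^sub>R \<bar>w t x - w s x\<bar> = \<bar>w' t x - w' s x\<bar> * indicat_real {-R..R} x"
          using eq[OF s] eq[OF t] by eventually_elim auto
      qed
      show ?thesis
        by (rule Lim_transform_within[OF lim zero_less_one same]) simp
    qed
    fix k and \<phi> \<phi>\<^sub>t \<phi>\<^sub>x :: "real \<times> real \<Rightarrow> real" assume tf: "test_function \<phi> \<phi>\<^sub>t \<phi>\<^sub>x"
    have c: "continuous_on UNIV (\<lambda>x. \<phi>\<^sub>t (t, x))" "continuous_on UNIV (\<lambda>x. \<phi>\<^sub>x (t, x))" for t
      using tf unfolding test_function_def
      by (auto intro!: continuous_on_compose2[of UNIV \<phi>\<^sub>t] continuous_on_compose2[of UNIV \<phi>\<^sub>x] continuous_intros)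
    have inner: "(LINT x|lebesgue. \<bar>w t x - k\<bar> * \<phi>\<^sub>t (t, x) + sgn (w t x - k) * (f (w t x) - f k) * \<phi>\<^sub>x (t, x))
      = (LBINT x. \<bar>w' t x - k\<bar> * \<phi>\<^sub>t (t, x) + kflux f (w' t x) k * \<phi>\<^sub>x (t, x))" if t: "0 \<le> t" for t
    proof (rule lebesgue_integral_eq_LBINT)
      note cm = borel_measurable_continuous_onI[OF c(1)[of t]] borel_measurable_continuous_onI[OF c(2)[of t]]
        borel_measurable_continuous_onI[OF f(1)]
      note [measurable] = m[OF t] m'[OF t] cm
      have [measurable]: "(\<lambda>x. \<phi>\<^sub>t (t, x)) \<in> borel_measurable lebesgue" "(\<lambda>x. \<phi>\<^sub>x (t, x)) \<in> borel_measurable lebesgue"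
        using cm(1,2) by (auto intro: measurable_completion)
      show "(\<lambda>x. \<bar>w t x - k\<bar> * \<phi>\<^sub>t (t, x) + sgn (w t x - k) * (f (w t x) - f k) * \<phi>\<^sub>x (t, x)) \<in> borel_measurable lebesgue"
        by measurable
      show "(\<lambda>x. \<bar>w' t x - k\<bar> * \<phi>\<^sub>t (t, x) + kflux f (w' t x) k * \<phi>\<^sub>x (t, x)) \<in> borel_measurable borel"
        by measurable
      show "AE x in lborel. \<bar>w t x - k\<bar> * \<phi>\<^sub>t (t, x) + sgn (w t x - k) * (f (w t x) - f k) * \<phi>\<^sub>x (t, x)
        = \<bar>w' t x - k\<bar> * \<phi>\<^sub>t (t, x) + kflux f (w' t x) k * \<phi>\<^sub>x (t, x)"
        using eq[OF t] by eventually_elim (simp add: kflux_def)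
    qed
    have "0 \<le> (LINT t:{0<..}|lebesgue. LINT x|lebesgue. \<bar>w t x - k\<bar> * \<phi>\<^sub>t (t, x) + sgn (w t x - k) * (f (w t x) - f k) * \<phi>\<^sub>x (t, x))"
      using sol tf unfolding entropy_solution_def by blast
    also have "\<dots> = (LINT t:{0<..}|lebesgue. LBINT x. \<bar>w' t x - k\<bar> * \<phi>\<^sub>t (t, x) + kflux f (w' t x) k * \<phi>\<^sub>x (t, x))"
      unfolding set_lebesgue_integral_def
      by (rule Bochner_Integration.integral_cong) (auto simp: inner indicator_def)
    finally show "0 \<le> (LINT t:{0<..}|lebesgue. LBINT x. \<bar>w' t x - k\<bar> * \<phi>\<^sub>t (t, x) + kflux f (w' t x) k * \<phi>\<^sub>x (t, x))" .
  qed (use f lip m' in auto)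
  have eq0: "AE x in lborel. w' 0 x = w\<^sub>0 x"
  proof -
    have "AE x in lborel. w 0 x = w\<^sub>0 x" using sol by (simp add: entropy_solution_def AE_completion_iff)
    then show ?thesis using eq[of 0] by auto
  qed
  have dm: "w\<^sub>0 \<in> borel_measurable lebesgue" and dpos: "AE x in lborel. 0 \<le> w\<^sub>0 x"
    and dsupp: "compact (ess_supp w\<^sub>0)" and dint: "(LINT x|lebesgue. w\<^sub>0 x) = 1"
    using dens by (auto simp: densities_def Linf_def AE_completion_iff)
  obtain R\<^sub>0 where "\<forall>x\<in>ess_supp w\<^sub>0. norm x \<le> R\<^sub>0" using compact_imp_bounded[OF dsupp] unfolding bounded_iff by blast
  then have R0: "x \<in> ess_supp w\<^sub>0 \<Longrightarrow> x \<in> {-\<bar>R\<^sub>0\<bar>..\<bar>R\<^sub>0\<bar>}" for x by (force simp: abs_le_iff)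
  have "AE x in lborel. x \<notin> ess_supp w\<^sub>0 \<longrightarrow> w\<^sub>0 x = 0" using ess_supp_AE[of w\<^sub>0] by (simp add: AE_completion_iff)
  then have "AE x in lborel. x \<notin> {-\<bar>R\<^sub>0\<bar>..\<bar>R\<^sub>0\<bar>} \<longrightarrow> w' 0 x = 0"
    using eq0 by eventually_elim (use R0 in auto)
  moreover have "AE x in lborel. 0 \<le> w' 0 x" using dpos eq0 by auto
  moreover have "(LBINT x. w' 0 x) = 1"
  proof -
    have "AE x in lborel. w\<^sub>0 x = w' 0 x" using eq0 by eventually_elim simp
    from lebesgue_integral_eq_LBINT[OF dm _ this] show ?thesis using m' dint by simp
  qed
  ultimately have init: "AE x in lborel. x \<notin> {-\<bar>R\<^sub>0\<bar>..\<bar>R\<^sub>0\<bar>} \<longrightarrow> w' 0 x = 0" "AE x in lborel. 0 \<le> w' 0 x" "(LBINT x. w' 0 x) = 1"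
    by auto
  show thesis
  proof (rule that[OF kruzhkov_curve_representative(1)[OF init abs_ge_zero \<open>0 \<le> T\<close> f(2)]])
    fix t assume t: "t \<in> {0..T}"
    show "AE x in lborel. max 0 (w' t x) * indicator {- (\<bar>R\<^sub>0\<bar> + L * T)..\<bar>R\<^sub>0\<bar> + L * T} x = w t x"
    proof -
      have "0 \<le> t" using t by simp
      from kruzhkov_curve_representative(2)[OF init abs_ge_zero \<open>0 \<le> T\<close> f(2) t] eq[OF this]
      show ?thesis by eventually_elim metis
    qed
  qed
qed

text \<open>The distribution functions agree at every x, hence the defining sets are literally the
  same; so the equality holds for every \<xi>, including \<open>\<xi> = 1\<close>, where both sides
  are the infimum of the empty set.\<close>

lemma (in kruzhkov_curve) pseudo_inverse_eq_quantile:
  assumes t: "t \<in> {0..T}" and m: "w \<in> borel_measurable lebesgue" and eq: "AE x in lborel. u t x = w x"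
  shows "pseudo_inverse w = quantile t"
proof -
  have "cdf_of w x = cdf t x" for x
    unfolding cdf_of_def cdf_def set_lebesgue_integral_def
  proof (rule lebesgue_integral_eq_LBINT)
    show "AE y in lborel. indicat_real {..x} y *\<^sub>R w y = u t y * indicat_real {..x} y"
      using eq by eventually_elim auto
    show "(\<lambda>y. indicat_real {..x} y *\<^sub>R w y) \<in> borel_measurable lebesgue"
      by (intro borel_measurable_scaleR borel_measurable_indicator m) simp
    show "(\<lambda>y. u t y * indicat_real {..x} y) \<in> borel_measurable borel"
      using curve_measurable[OF t] by measurable
  qed
  then show ?thesis by (simp add: fun_eq_iff pseudo_inverse_def quantile_def)
qed

theorem proposition4p3:
  fixes u\<^sub>0 v\<^sub>0 f :: "real \<Rightarrow> real" and u v :: "real \<Rightarrow> real \<Rightarrow> real" and C M t :: real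
  assumes "u\<^sub>0 \<in> densities \<inter> BV" and "v\<^sub>0 \<in> densities \<inter> BV"
    and "convex_on UNIV f" and "superlinear f"
    and "f 0 = 0" and "\<And>w. f 0 \<le> f w"
    and "ereal M = max (Linf_norm lebesgue u\<^sub>0) (Linf_norm lebesgue v\<^sub>0)"
    and "Linf_norm (lebesgue_on {0..M}) (a_coeff f) \<le> ereal C"
    and "entropy_solution f u\<^sub>0 u" and "entropy_solution f v\<^sub>0 v"
    and "t > 0"
  shows "W_inf (u t) (v t) \<le> W_inf u\<^sub>0 v\<^sub>0"
proof -
  obtain K\<^sub>u K\<^sub>v where Ku: "\<And>s. 0 \<le> s \<Longrightarrow> Linf_norm lebesgue (u s) \<le> ereal K\<^sub>u"
    and Kv: "\<And>s. 0 \<le> s \<Longrightarrow> Linf_norm lebesgue (v s) \<le> ereal K\<^sub>v"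
    using assms(9,10) unfolding entropy_solution_def by metis
  \<comment> \<open>The comparison needs one range \<open>[0, K]\<close>, one Lipschitz constant on
    it and below also one radius R for both curves. The sup bounds come from the definition of
    entropy solution and hold for all times.\<close>
  define K where "K = \<bar>K\<^sub>u\<bar> + \<bar>K\<^sub>v\<bar>"
  have K0: "0 \<le> K" by (simp add: K_def)
  have Kb: "Linf_norm lebesgue (u s) \<le> ereal K" "Linf_norm lebesgue (v s) \<le> ereal K" if "0 \<le> s" for s
    by (rule order_trans[OF Ku[OF that]], simp add: K_def) (rule order_trans[OF Kv[OF that]], simp add: K_def)
  have fc: "continuous_on UNIV f" using assms(3) by (intro convex_on_continuous) auto
  obtain L where L: "0 \<le> L" "\<And>a b. a \<in> {-K..K} \<Longrightarrow> b \<in> {-K..K} \<Longrightarrow> \<bar>f a - f b\<bar> \<le> L * \<bar>a - b\<bar>"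
    using convex_on_UNIV_lipschitz[OF assms(3)] by metis
  have T: "0 \<in> {0..t}" "t \<in> {0..t}" "0 \<le> t" using assms(11) by auto
  obtain R\<^sub>u u' where u': "kruzhkov_curve f K L R\<^sub>u t u'" "\<And>s. s \<in> {0..t} \<Longrightarrow> AE x in lborel. u' s x = u s x"
    by (rule entropy_solution_representative[OF assms(9) fc assms(5) L(2,1) K0 Kb(1) _ T(3)]) (use assms(1) in auto)
  obtain R\<^sub>v v' where v': "kruzhkov_curve f K L R\<^sub>v t v'" "\<And>s. s \<in> {0..t} \<Longrightarrow> AE x in lborel. v' s x = v s x"
    by (rule entropy_solution_representative[OF assms(10) fc assms(5) L(2,1) K0 Kb(2) _ T(3)]) (use assms(2) in auto)
  define R where "R = max R\<^sub>u R\<^sub>v"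
  have U: "kruzhkov_curve f K L R t u'" and V: "kruzhkov_curve f K L R t v'"
    using kruzhkov_curve_mono_radius[OF u'(1)] kruzhkov_curve_mono_radius[OF v'(1)] by (auto simp: R_def)
  interpret U: kruzhkov_curve f K L R t u' by (rule U)
  interpret V: kruzhkov_curve f K L R t v' by (rule V)
  have mu: "u s \<in> borel_measurable lebesgue" "v s \<in> borel_measurable lebesgue" if "0 \<le> s" for s
    using assms(9,10) that by (auto simp: entropy_solution_def)
  have m0: "u\<^sub>0 \<in> borel_measurable lebesgue" "v\<^sub>0 \<in> borel_measurable lebesgue"
    using assms(1,2) by (auto simp: densities_def Linf_def)
  have eq0: "AE x in lborel. u' 0 x = u\<^sub>0 x" "AE x in lborel. v' 0 x = v\<^sub>0 x"
    using u'(2)[OF T(1)] v'(2)[OF T(1)] assms(9,10) by (auto simp: entropy_solution_def AE_completion_iff)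
  have W0: "W_inf u\<^sub>0 v\<^sub>0 = Linf_norm (lebesgue_on {0..1}) (\<lambda>\<xi>. U.quantile 0 \<xi> - V.quantile 0 \<xi>)"
    unfolding W_inf_def U.pseudo_inverse_eq_quantile[OF T(1) m0(1) eq0(1)] V.pseudo_inverse_eq_quantile[OF T(1) m0(2) eq0(2)] ..
  have Wt: "W_inf (u t) (v t) = Linf_norm (lebesgue_on {0..1}) (\<lambda>\<xi>. U.quantile t \<xi> - V.quantile t \<xi>)"
    unfolding W_inf_def U.pseudo_inverse_eq_quantile[OF T(2) mu(1)[OF T(3)] u'(2)[OF T(2)]]
      V.pseudo_inverse_eq_quantile[OF T(2) mu(2)[OF T(3)] v'(2)[OF T(2)]] ..
  have ae0: "AE \<xi> in lebesgue_on {0..1}. ereal \<bar>U.quantile 0 \<xi> - V.quantile 0 \<xi>\<bar> \<le> W_inf u\<^sub>0 v\<^sub>0"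
    unfolding W0 Linf_norm_def by (rule esssup_AE)
  \<comment> \<open>The essential supremum is an extended real. As \<open>[0, 1]\<close> has measure
    1, that of the zero function is 0, which excludes minus infinity and leaves a real distance r or
    the trivial infinite case.\<close>
  have pos: "0 \<le> W_inf u\<^sub>0 v\<^sub>0"
  proof -
    have "emeasure (lebesgue_on {0..1::real}) (space (lebesgue_on {0..1})) = 1"
      by (simp add: emeasure_restrict_space)
    then have "(0::ereal) = esssup (lebesgue_on {0..1::real}) (\<lambda>_. 0)" by (simp add: esssup_const)
    also have "\<dots> \<le> W_inf u\<^sub>0 v\<^sub>0" unfolding W0 Linf_norm_def by (rule esssup_mono) auto
    finally show ?thesis .
  qed
  show ?thesis
  proof (cases "W_inf u\<^sub>0 v\<^sub>0")
    case (real r)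
    have q: "AE \<xi> in lebesgue_on {0..1}. \<bar>U.quantile 0 \<xi> - V.quantile 0 \<xi>\<bar> \<le> r"
      using ae0 by (simp add: real)
    then have q': "AE \<xi> in lebesgue_on {0..1}. \<bar>V.quantile 0 \<xi> - U.quantile 0 \<xi>\<bar> \<le> r"
      by (simp add: abs_minus_commute)
    \<comment> \<open>The shift by r is absorbed into the second curve, which again is a curve of
      the same kind on a larger interval; then the plain order of distribution functions is
      propagated. It is used in both directions.\<close>
    have compare: "kruzhkov_curve.cdf a t x \<le> kruzhkov_curve.cdf b t (x + r)"
      if A: "kruzhkov_curve f K L R t a" and B: "kruzhkov_curve f K L R t b"
        and le: "\<And>x. kruzhkov_curve.cdf a 0 x \<le> kruzhkov_curve.cdf b 0 (x + r)" for a b x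
    proof -
      have A': "kruzhkov_curve f K L (R + \<bar>r\<bar>) t a" by (rule kruzhkov_curve_mono_radius[OF A]) simp
      have B': "kruzhkov_curve f K L (R + \<bar>r\<bar>) t (\<lambda>s x. b s (x + r))" by (rule kruzhkov_curve_shift[OF B])
      show ?thesis
        using cdf_comparison[OF A' B' assms(11), of x] le
        by (simp add: kruzhkov_curve.cdf_shift[OF B])
    qed
    have c1: "U.cdf t x \<le> V.cdf t (x + r)" for x
      by (rule compare[OF U V]) (rule cdf_le_shift_of_quantile[OF U V T(1) q])
    have c2: "V.cdf t x \<le> U.cdf t (x + r)" for x
      by (rule compare[OF V U]) (rule cdf_le_shift_of_quantile[OF V U T(1) q'])
    have le: "\<bar>U.quantile t \<xi> - V.quantile t \<xi>\<bar> \<le> r" if "0 \<le> \<xi>" "\<xi> < 1" for \<xi>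
      using quantile_diff_le_of_cdf[OF U V T(2) c1 that] quantile_diff_le_of_cdf[OF V U T(2) c2 that] by linarith
    \<comment> \<open>At \<open>\<xi> = 1\<close> the quantiles carry no information, but a single
      point is a null set.\<close>
    have "AE \<xi> in lborel. \<xi> \<noteq> (1::real)" by (rule AE_lborel_singleton)
    then have "AE \<xi> in lebesgue_on {0..1}. ereal \<bar>U.quantile t \<xi> - V.quantile t \<xi>\<bar> \<le> ereal r"
      by (subst AE_restrict_space_iff) (use le in \<open>auto simp: AE_completion_iff elim!: eventually_mono\<close>)
    moreover have "(\<lambda>\<xi>. ereal \<bar>U.quantile t \<xi> - V.quantile t \<xi>\<bar>) \<in> borel_measurable (lebesgue_on {0..1})"
      using U.quantile_measurable[OF T(2)] V.quantile_measurable[OF T(2)] by measurable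
    ultimately show ?thesis unfolding Wt real Linf_norm_def by (intro esssup_I)
  qed (use pos in auto)
qed

end
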